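(* Let $n>2$, let $A$ be an $\mathbb S_n$-stable subgroup of $(\mathbb Z/2)^n$, $G=A\rtimes\mathbb S_n$, $\sigma=(a_1,\dots,a_n)\in A$, and let $\rho=\theta_{\chi,\mu}\in\widehat{G^\sigma}$ with $\chi=\chi_2^{b_1}\otimes\cdots\otimes\chi_2^{b_n}\in\widehat A$ and $\mu\in\widehat{(\mathbb S_n^\sigma)_\chi}$. Then $\dim\mathfrak B(\mathcal O_\sigma^G,\rho)<\infty$ if and only if $f_\sigma$ is odd and at least one of $W_\chi=W_\sigma$, $|W_\sigma|=n$, $|W_\chi|=n$ holds.
   Context: Group. $\mathbb S_n$ acts on $(\mathbb Z/2)^n$ (additive) by $(h\cdot a)_i=a_{h^{-1}(i)}$; $G=A\rtimes\mathbb S_n$ has product $(a,\sigma)(b,\tau)=(a+\sigma\cdot b,\sigma\tau)$, and $A,\mathbb S_n$ are viewed as subgroups. Nichols algebras. For a finite group $G$ and $s\in G$, $G^s$ is the centralizer, $\mathcal O_s^G$ the conjugacy class, $\widehat G$ the set of isomorphism classes of irreducible complex representations. For $(\rho,V)\in\widehat{G^s}$, $M(\mathcal O_s^G,\rho)$ is the Yetter-Drinfeld module $\mathbb CG\otimes_{\mathbb CG^s}V$ with the induced action and coaction $\delta(h\otimes v)=hsh^{-1}\otimes(h\otimes v)$; the braiding is $c(x\otimes y)=x_{(-1)}\cdot y\otimes x_{(0)}$, $\mathfrak B(M)$ is the Nichols algebra of $M$, and $\mathfrak B(\mathcal O_s^G,\rho)=\mathfrak B(M(\mathcal O_s^G,\rho))$.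 Representations. For $\sigma\in A$, $G^\sigma=A\rtimes\mathbb S_n^\sigma$ with $\mathbb S_n^\sigma=\{\tau\in\mathbb S_n:\tau\cdot\sigma=\sigma\}$. $\chi=\chi_2^{b_1}\otimes\cdots\otimes\chi_2^{b_n}$ ($b_i\in\mathbb Z/2$) means $\chi(a)=(-1)^{\sum_ia_ib_i}$; $(\mathbb S_n^\sigma)_\chi$ is the stabilizer of $\chi$ in $\mathbb S_n^\sigma$; $\theta_{\chi,\mu}$ is the representation of $G^\sigma$ induced from $\chi\otimes\mu$ on $A\rtimes(\mathbb S_n^\sigma)_\chi$. Every irreducible representation of $G^\sigma$ has this form. $W_\sigma=\{i:a_i\neq0\}$, $W_\chi=\{i:b_i\neq0\}$, $f_\sigma=|W_\sigma\cap W_\chi|$. *)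

theory Defs
  imports
    "HOL-Library.Z2"
    "HOL-Algebra.Sym_Groups"
    "HOL-Algebra.Group_Action"
    "HOL-Algebra.QuotRing"
    "Jordan_Normal_Form.VS_Connect"
begin

section \<open>Quotients of vector spaces and algebras\<close>

text \<open>Complex vector spaces are \<^locale>\<open>vectorspace\<close>s over \<^term>\<open>class_ring :: complex ring\<close>.
  The ring multiplication of a \<^typ>\<open>(complex, 'v) module\<close> record is only meaningful for those
  records below that are algebras.\<close>

abbreviation complex_field :: "complex ring" (\<open>\<complex>\<^sub>F\<close>)
  where "\<complex>\<^sub>F \<equiv> class_ring"

text \<open>The quotient by a subspace (as an algebra, if the subspace is a two-sided ideal): the
  HOL-Algebra ring quotient, equipped with the induced scalar multiplication.\<close>

definition quot_module :: "(complex, 'v) module \<Rightarrow> 'v set \<Rightarrow> (complex, 'v set) module"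
  where "quot_module M N =
    \<lparr>carrier = carrier (M Quot N), mult = mult (M Quot N), one = one (M Quot N),
     zero = zero (M Quot N), add = add (M Quot N),
     smult = (\<lambda>c X. \<Union>x\<in>X. N +>\<^bsub>M\<^esub> (c \<odot>\<^bsub>M\<^esub> x))\<rparr>"

text \<open>The endomorphism of \<open>M / N\<close> induced by an endomorphism \<open>\<phi>\<close> of \<open>M\<close> with \<open>\<phi> N \<subseteq> N\<close>.\<close>

definition quot_map :: "(complex, 'v) module \<Rightarrow> 'v set \<Rightarrow> ('v \<Rightarrow> 'v) \<Rightarrow> 'v set \<Rightarrow> 'v set"
  where "quot_map M N \<phi> X = (\<Union>x\<in>X. N +>\<^bsub>M\<^esub> \<phi> x)"


section \<open>Representations\<close>

definition representation ::
  "('g, 'x) monoid_scheme \<Rightarrow> (complex, 'v) module \<Rightarrow> ('g \<Rightarrow> 'v \<Rightarrow> 'v) \<Rightarrow> bool"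
  where "representation G V \<rho> \<longleftrightarrow>
    vectorspace \<complex>\<^sub>F V \<and>
    (\<forall>g\<in>carrier G. linear_map \<complex>\<^sub>F V V (\<rho> g)) \<and>
    (\<forall>v\<in>carrier V. \<rho> \<one>\<^bsub>G\<^esub> v = v) \<and>
    (\<forall>g\<in>carrier G. \<forall>h\<in>carrier G. \<forall>v\<in>carrier V. \<rho> (g \<otimes>\<^bsub>G\<^esub> h) v = \<rho> g (\<rho> h v))"

definition irreducible_representation ::
  "('g, 'x) monoid_scheme \<Rightarrow> (complex, 'v) module \<Rightarrow> ('g \<Rightarrow> 'v \<Rightarrow> 'v) \<Rightarrow> bool"
  where "irreducible_representation G V \<rho> \<longleftrightarrow>
    representation G V \<rho> \<and> carrier V \<noteq> {\<zero>\<^bsub>V\<^esub>} \<and>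
    (\<forall>W. subspace \<complex>\<^sub>F W V \<and> (\<forall>g\<in>carrier G. \<rho> g ` W \<subseteq> W) \<longrightarrow>
         W = {\<zero>\<^bsub>V\<^esub>} \<or> W = carrier V)"

text \<open>The vector space \<open>\<complex>G \<otimes>\<^sub>\<complex> V\<close>, realised as the finitely supported functions \<open>G \<rightarrow> V\<close>:
  \<open>f\<close> stands for the sum of all \<open>g \<otimes> f g\<close>.\<close>

definition tensor_group_algebra ::
  "('g, 'x) monoid_scheme \<Rightarrow> (complex, 'v) module \<Rightarrow> (complex, 'g \<Rightarrow> 'v) module"
  where "tensor_group_algebra G V =
    \<lparr>carrier = {f. (\<forall>g\<in>carrier G. f g \<in> carrier V) \<and> (\<forall>g. g \<notin> carrier G \<longrightarrow> f g = \<zero>\<^bsub>V\<^esub>) \<and>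
                   finite {g. f g \<noteq> \<zero>\<^bsub>V\<^esub>}},
     mult = undefined, one = undefined,
     zero = (\<lambda>g. \<zero>\<^bsub>V\<^esub>), add = (\<lambda>f f' g. f g \<oplus>\<^bsub>V\<^esub> f' g),
     smult = (\<lambda>c f g. c \<odot>\<^bsub>V\<^esub> f g)\<rparr>"

definition pure_tensor :: "(complex, 'v) module \<Rightarrow> 'g \<Rightarrow> 'v \<Rightarrow> 'g \<Rightarrow> 'v"
  where "pure_tensor V g v = (\<lambda>x. if x = g then v else \<zero>\<^bsub>V\<^esub>)"

text \<open>The relations \<open>g h \<otimes> v = g \<otimes> \<rho>(h) v\<close>, for \<open>h\<close> in the subgroup \<open>H\<close>, defining the tensor
  product over \<open>\<complex>H\<close>.\<close>

definition balanced_relations ::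
  "('g, 'x) monoid_scheme \<Rightarrow> 'g set \<Rightarrow> (complex, 'v) module \<Rightarrow> ('g \<Rightarrow> 'v \<Rightarrow> 'v) \<Rightarrow> ('g \<Rightarrow> 'v) set"
  where "balanced_relations G H V \<rho> = LinearCombinations.module.span \<complex>\<^sub>F (tensor_group_algebra G V)
    {pure_tensor V (g \<otimes>\<^bsub>G\<^esub> h) v \<ominus>\<^bsub>tensor_group_algebra G V\<^esub> pure_tensor V g (\<rho> h v) | g h v.
      g \<in> carrier G \<and> h \<in> H \<and> v \<in> carrier V}"

text \<open>The induced representation \<open>\<complex>G \<otimes>\<^bsub>\<complex>H\<^esub> V\<close>; an element \<open>x\<close> of \<open>G\<close> acts by
  \<open>x (g \<otimes> v) = x g \<otimes> v\<close>.\<close>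

definition induced_module ::
  "('g, 'x) monoid_scheme \<Rightarrow> 'g set \<Rightarrow> (complex, 'v) module \<Rightarrow> ('g \<Rightarrow> 'v \<Rightarrow> 'v)
    \<Rightarrow> (complex, ('g \<Rightarrow> 'v) set) module"
  where "induced_module G H V \<rho> =
    quot_module (tensor_group_algebra G V) (balanced_relations G H V \<rho>)"

definition induced_action ::
  "('g, 'x) monoid_scheme \<Rightarrow> 'g set \<Rightarrow> (complex, 'v) module \<Rightarrow> ('g \<Rightarrow> 'v \<Rightarrow> 'v)
    \<Rightarrow> 'g \<Rightarrow> ('g \<Rightarrow> 'v) set \<Rightarrow> ('g \<Rightarrow> 'v) set"
  where "induced_action G H V \<rho> x =
    quot_map (tensor_group_algebra G V) (balanced_relations G H V \<rho>)
      (\<lambda>f g. if g \<in> carrier G then f (inv\<^bsub>G\<^esub> x \<otimes>\<^bsub>G\<^esub> g) else \<zero>\<^bsub>V\<^esub>)"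


section \<open>The Yetter-Drinfeld module of a centralizer representation\<close>

definition centralizer :: "('g, 'x) monoid_scheme \<Rightarrow> 'g \<Rightarrow> 'g set"
  where "centralizer G s = {g \<in> carrier G. g \<otimes>\<^bsub>G\<^esub> s = s \<otimes>\<^bsub>G\<^esub> g}"

abbreviation centralizer_group :: "('g, 'x) monoid_scheme \<Rightarrow> 'g \<Rightarrow> ('g, 'x) monoid_scheme"
  where "centralizer_group G s \<equiv> G\<lparr>carrier := centralizer G s\<rparr>"

text \<open>\<open>M(O\<^sub>s, \<rho>) = \<complex>G \<otimes> V\<close>, tensored over the group algebra of the centralizer of \<open>s\<close>. A
  coaction \<open>\<delta>\<close> of the group algebra is given by its components \<open>\<delta>\<^sub>t\<close>, where \<open>\<delta> x\<close> is the sum of all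
  \<open>t \<otimes> \<delta>\<^sub>t x\<close>. As \<open>\<delta>(h \<otimes> v) = h s h\<^sup>-\<^sup>1 \<otimes> (h \<otimes> v)\<close>, the map \<open>\<delta>\<^sub>t\<close> keeps the summands \<open>h \<otimes> v\<close>
  with \<open>h s h\<^sup>-\<^sup>1 = t\<close>.\<close>

definition yd_module ::
  "('g, 'x) monoid_scheme \<Rightarrow> 'g \<Rightarrow> (complex, 'v) module \<Rightarrow> ('g \<Rightarrow> 'v \<Rightarrow> 'v)
    \<Rightarrow> (complex, ('g \<Rightarrow> 'v) set) module"
  where "yd_module G s V \<rho> = induced_module G (centralizer G s) V \<rho>"

definition yd_action ::
  "('g, 'x) monoid_scheme \<Rightarrow> 'g \<Rightarrow> (complex, 'v) module \<Rightarrow> ('g \<Rightarrow> 'v \<Rightarrow> 'v)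
    \<Rightarrow> 'g \<Rightarrow> ('g \<Rightarrow> 'v) set \<Rightarrow> ('g \<Rightarrow> 'v) set"
  where "yd_action G s V \<rho> = induced_action G (centralizer G s) V \<rho>"

definition yd_coaction ::
  "('g, 'x) monoid_scheme \<Rightarrow> 'g \<Rightarrow> (complex, 'v) module \<Rightarrow> ('g \<Rightarrow> 'v \<Rightarrow> 'v)
    \<Rightarrow> 'g \<Rightarrow> ('g \<Rightarrow> 'v) set \<Rightarrow> ('g \<Rightarrow> 'v) set"
  where "yd_coaction G s V \<rho> t =
    quot_map (tensor_group_algebra G V) (balanced_relations G (centralizer G s) V \<rho>)
      (\<lambda>f h. if h \<in> carrier G \<and> h \<otimes>\<^bsub>G\<^esub> s \<otimes>\<^bsub>G\<^esub> inv\<^bsub>G\<^esub> h = t then f h else \<zero>\<^bsub>V\<^esub>)"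


section \<open>Nichols algebras\<close>

text \<open>The free algebra on the underlying set of \<open>M\<close>: finite formal combinations of words.\<close>

definition free_algebra :: "(complex, 'm) module \<Rightarrow> (complex, 'm list \<Rightarrow> complex) module"
  where "free_algebra M =
    \<lparr>carrier = {t. finite {w. t w \<noteq> 0} \<and> (\<forall>w. t w \<noteq> 0 \<longrightarrow> set w \<subseteq> carrier M)},
     mult = (\<lambda>s t w. \<Sum>k\<le>length w. s (take k w) * t (drop k w)),
     one = (\<lambda>w. if w = [] then 1 else 0),
     zero = (\<lambda>w. 0), add = (\<lambda>s t w. s w + t w), smult = (\<lambda>c t w. c * t w)\<rparr>"

definition word :: "'m list \<Rightarrow> 'm list \<Rightarrow> complex"
  where "word w = (\<lambda>u. if u = w then 1 else 0)"

definition multilinear_relations :: "(complex, 'm) module \<Rightarrow> ('m list \<Rightarrow> complex) set"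
  where "multilinear_relations M = LinearCombinations.module.span \<complex>\<^sub>F (free_algebra M)
    ({word (u @ [x \<oplus>\<^bsub>M\<^esub> y] @ v)
        \<ominus>\<^bsub>free_algebra M\<^esub> (word (u @ [x] @ v) \<oplus>\<^bsub>free_algebra M\<^esub> word (u @ [y] @ v)) | u v x y.
       set u \<subseteq> carrier M \<and> set v \<subseteq> carrier M \<and> x \<in> carrier M \<and> y \<in> carrier M} \<union>
     {word (u @ [c \<odot>\<^bsub>M\<^esub> x] @ v)
        \<ominus>\<^bsub>free_algebra M\<^esub> (c \<odot>\<^bsub>free_algebra M\<^esub> word (u @ [x] @ v)) | u v c x.
       set u \<subseteq> carrier M \<and> set v \<subseteq> carrier M \<and> x \<in> carrier M})"

text \<open>\<open>T(M)\<close>; the class of the word \<open>[x\<^sub>1, \<dots>, x\<^sub>k]\<close> is the tensor \<open>x\<^sub>1 \<otimes> \<dots> \<otimes> x\<^sub>k\<close>.\<close>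

definition tensor_algebra :: "(complex, 'm) module \<Rightarrow> (complex, ('m list \<Rightarrow> complex) set) module"
  where "tensor_algebra M = quot_module (free_algebra M) (multilinear_relations M)"

definition linear_extension ::
  "('m list \<Rightarrow> 'm list \<Rightarrow> complex) \<Rightarrow> ('m list \<Rightarrow> complex) \<Rightarrow> 'm list \<Rightarrow> complex"
  where "linear_extension \<phi> t = (\<lambda>z. \<Sum>w | t w \<noteq> 0. t w * \<phi> w z)"

text \<open>The braiding \<open>c(x \<otimes> y) = x\<^sub>(\<^sub>-\<^sub>1\<^sub>) \<sqdot> y \<otimes> x\<^sub>(\<^sub>0\<^sub>)\<close>, i.e. the sum over \<open>g\<close> of all
  \<open>g \<sqdot> y \<otimes> \<delta>\<^sub>g x\<close>, applied to the (counting from 0) tensor factors \<open>i\<close> and \<open>i + 1\<close>.\<close>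

definition braid_word ::
  "('g, 'x) monoid_scheme \<Rightarrow> ('g \<Rightarrow> 'm \<Rightarrow> 'm) \<Rightarrow> ('g \<Rightarrow> 'm \<Rightarrow> 'm) \<Rightarrow> nat \<Rightarrow> 'm list
    \<Rightarrow> 'm list \<Rightarrow> complex"
  where "braid_word G act \<delta> i w =
    (if Suc i < length w
     then (\<lambda>z. \<Sum>g\<in>carrier G.
            word (take i w @ [act g (w ! Suc i), \<delta> g (w ! i)] @ drop (Suc (Suc i)) w) z)
     else word w)"

definition braid ::
  "('g, 'x) monoid_scheme \<Rightarrow> ('g \<Rightarrow> 'm \<Rightarrow> 'm) \<Rightarrow> ('g \<Rightarrow> 'm \<Rightarrow> 'm) \<Rightarrow> nat
    \<Rightarrow> ('m list \<Rightarrow> complex) \<Rightarrow> 'm list \<Rightarrow> complex"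
  where "braid G act \<delta> i = linear_extension (braid_word G act \<delta> i)"

text \<open>With \<open>c\<^sub>i\<close> the braiding of the factors \<open>i\<close> and \<open>i + 1\<close> (counting from 0),
  \<open>braid_sum k = id + c\<^bsub>k-1\<^esub> + c\<^bsub>k-1\<^esub> c\<^bsub>k-2\<^esub> + \<dots> + c\<^bsub>k-1\<^esub> \<cdots> c\<^sub>0\<close>
  is the sum of the braid lifts of the shortest representatives of the cosets \<open>S\<^sub>k \<pi>\<close>
  in \<open>S\<^bsub>k+1\<^esub>\<close>. Hence \<open>quantum_symmetrizer k\<close> is the sum over all \<open>\<pi>\<close> in \<open>S\<^sub>k\<close> of the braid
  (Matsumoto) lifts of \<open>\<pi>\<close>, acting on the first \<open>k\<close> factors.\<close>

primrec braid_sum ::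
  "('g, 'x) monoid_scheme \<Rightarrow> ('g \<Rightarrow> 'm \<Rightarrow> 'm) \<Rightarrow> ('g \<Rightarrow> 'm \<Rightarrow> 'm) \<Rightarrow> nat
    \<Rightarrow> ('m list \<Rightarrow> complex) \<Rightarrow> 'm list \<Rightarrow> complex"
  where
    "braid_sum G act \<delta> 0 t = t"
  | "braid_sum G act \<delta> (Suc k) t = (\<lambda>z. t z + braid G act \<delta> k (braid_sum G act \<delta> k t) z)"

primrec quantum_symmetrizer ::
  "('g, 'x) monoid_scheme \<Rightarrow> ('g \<Rightarrow> 'm \<Rightarrow> 'm) \<Rightarrow> ('g \<Rightarrow> 'm \<Rightarrow> 'm) \<Rightarrow> nat
    \<Rightarrow> ('m list \<Rightarrow> complex) \<Rightarrow> 'm list \<Rightarrow> complex"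
  where
    "quantum_symmetrizer G act \<delta> 0 t = t"
  | "quantum_symmetrizer G act \<delta> (Suc k) t =
      quantum_symmetrizer G act \<delta> k (braid_sum G act \<delta> k t)"

definition total_symmetrizer ::
  "('g, 'x) monoid_scheme \<Rightarrow> ('g \<Rightarrow> 'm \<Rightarrow> 'm) \<Rightarrow> ('g \<Rightarrow> 'm \<Rightarrow> 'm)
    \<Rightarrow> ('m list \<Rightarrow> complex) \<Rightarrow> 'm list \<Rightarrow> complex"
  where "total_symmetrizer G act \<delta> =
    linear_extension (\<lambda>w. quantum_symmetrizer G act \<delta> (length w) (word w))"

text \<open>The Nichols algebra: the quotient of \<open>T(M)\<close> by the direct sum over \<open>k\<close> of the kernels of the
  quantum symmetrizers on \<open>M\<^bsup>\<otimes>k\<^esup>\<close>.\<close>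

definition nichols_ideal ::
  "('g, 'x) monoid_scheme \<Rightarrow> (complex, 'm) module \<Rightarrow> ('g \<Rightarrow> 'm \<Rightarrow> 'm) \<Rightarrow> ('g \<Rightarrow> 'm \<Rightarrow> 'm)
    \<Rightarrow> ('m list \<Rightarrow> complex) set set"
  where "nichols_ideal G M act \<delta> = a_kernel (tensor_algebra M) (tensor_algebra M)
    (quot_map (free_algebra M) (multilinear_relations M) (total_symmetrizer G act \<delta>))"

definition nichols_algebra ::
  "('g, 'x) monoid_scheme \<Rightarrow> (complex, 'm) module \<Rightarrow> ('g \<Rightarrow> 'm \<Rightarrow> 'm) \<Rightarrow> ('g \<Rightarrow> 'm \<Rightarrow> 'm)
    \<Rightarrow> (complex, ('m list \<Rightarrow> complex) set set) module"
  where "nichols_algebra G M act \<delta> = quot_module (tensor_algebra M) (nichols_ideal G M act \<delta>)"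

definition nichols_algebra_of_class ::
  "('g, 'x) monoid_scheme \<Rightarrow> 'g \<Rightarrow> (complex, 'v) module \<Rightarrow> ('g \<Rightarrow> 'v \<Rightarrow> 'v)
    \<Rightarrow> (complex, (('g \<Rightarrow> 'v) set list \<Rightarrow> complex) set set) module"
  where "nichols_algebra_of_class G s V \<rho> =
    nichols_algebra G (yd_module G s V \<rho>) (yd_action G s V \<rho>) (yd_coaction G s V \<rho>)"


section \<open>The groups and their representations\<close>

text \<open>Elements of \<open>(\<int>/2)\<^sup>n\<close> are indexed by \<open>1, \<dots>, n\<close> and extended by 0. The group is written
  multiplicatively, as all groups in HOL-Algebra.\<close>

definition bit_group :: "nat \<Rightarrow> (nat \<Rightarrow> bit) monoid"
  where "bit_group n =
    \<lparr>carrier = {a. \<forall>i. i \<notin> {1..n} \<longrightarrow> a i = 0}, mult = (\<lambda>a b i. a i + b i), one = (\<lambda>i. 0)\<rparr>"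

definition perm_act :: "(nat \<Rightarrow> nat) \<Rightarrow> (nat \<Rightarrow> bit) \<Rightarrow> nat \<Rightarrow> bit"
  where "perm_act h a = (\<lambda>i. a (inv' h i))"

definition semidirect :: "nat \<Rightarrow> (nat \<Rightarrow> bit) set \<Rightarrow> ((nat \<Rightarrow> bit) \<times> (nat \<Rightarrow> nat)) monoid"
  where "semidirect n A =
    \<lparr>carrier = A \<times> carrier (sym_group n),
     mult = (\<lambda>(a, \<sigma>) (b, \<tau>). (a \<otimes>\<^bsub>bit_group n\<^esub> perm_act \<sigma> b, \<sigma> \<otimes>\<^bsub>sym_group n\<^esub> \<tau>)),
     one = (\<one>\<^bsub>bit_group n\<^esub>, \<one>\<^bsub>sym_group n\<^esub>)\<rparr>"

text \<open>The character \<open>x \<mapsto> (-1)\<^bsup>x\<^sub>1 b\<^sub>1 + \<dots> + x\<^sub>n b\<^sub>n\<^esup>\<close> of \<open>A\<close>; the exponent lives in \<open>\<int>/2\<close>. It is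
  restricted to \<open>A\<close>, so that equality of characters is equality on \<open>A\<close> even if several \<open>b\<close> define
  the same character.\<close>

definition bit_character :: "nat \<Rightarrow> (nat \<Rightarrow> bit) set \<Rightarrow> (nat \<Rightarrow> bit) \<Rightarrow> (nat \<Rightarrow> bit) \<Rightarrow> complex"
  where "bit_character n A b = (\<lambda>x\<in>A. if (\<Sum>i\<in>{1..n}. x i * b i) = 0 then 1 else -1)"

definition char_act ::
  "(nat \<Rightarrow> bit) set \<Rightarrow> (nat \<Rightarrow> nat) \<Rightarrow> ((nat \<Rightarrow> bit) \<Rightarrow> complex) \<Rightarrow> (nat \<Rightarrow> bit) \<Rightarrow> complex"
  where "char_act A h \<chi> = (\<lambda>x\<in>A. \<chi> (perm_act (inv' h) x))"

definition elem_stabilizer :: "nat \<Rightarrow> (nat \<Rightarrow> bit) \<Rightarrow> (nat \<Rightarrow> nat) set"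
  where "elem_stabilizer n a = stabilizer (sym_group n) perm_act a"

definition char_stabilizer ::
  "nat \<Rightarrow> (nat \<Rightarrow> bit) set \<Rightarrow> (nat \<Rightarrow> bit) \<Rightarrow> ((nat \<Rightarrow> bit) \<Rightarrow> complex) \<Rightarrow> (nat \<Rightarrow> nat) set"
  where "char_stabilizer n A a \<chi> =
    stabilizer ((sym_group n)\<lparr>carrier := elem_stabilizer n a\<rparr>) (char_act A) \<chi>"

text \<open>\<open>\<chi> \<otimes> \<mu>\<close>, on the space \<open>V\<close> of \<open>\<mu>\<close>.\<close>

definition char_tensor ::
  "((nat \<Rightarrow> bit) \<Rightarrow> complex) \<Rightarrow> (complex, 'v) module \<Rightarrow> ((nat \<Rightarrow> nat) \<Rightarrow> 'v \<Rightarrow> 'v)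
    \<Rightarrow> (nat \<Rightarrow> bit) \<times> (nat \<Rightarrow> nat) \<Rightarrow> 'v \<Rightarrow> 'v"
  where "char_tensor \<chi> V \<mu> = (\<lambda>(x, \<tau>) v. \<chi> x \<odot>\<^bsub>V\<^esub> \<mu> \<tau> v)"

text \<open>The representation \<open>\<theta>\<^bsub>\<chi>,\<mu>\<^esub>\<close> of the centralizer of \<open>(a, id)\<close>, induced from
  \<open>A \<rtimes> char_stabilizer n A a \<chi>\<close>.\<close>

definition theta_module ::
  "nat \<Rightarrow> (nat \<Rightarrow> bit) set \<Rightarrow> (nat \<Rightarrow> bit) \<Rightarrow> ((nat \<Rightarrow> bit) \<Rightarrow> complex)
    \<Rightarrow> (complex, 'v) module \<Rightarrow> ((nat \<Rightarrow> nat) \<Rightarrow> 'v \<Rightarrow> 'v)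
    \<Rightarrow> (complex, ((nat \<Rightarrow> bit) \<times> (nat \<Rightarrow> nat) \<Rightarrow> 'v) set) module"
  where "theta_module n A a \<chi> V \<mu> =
    induced_module (centralizer_group (semidirect n A) (a, id))
      (A \<times> char_stabilizer n A a \<chi>) V (char_tensor \<chi> V \<mu>)"

definition theta ::
  "nat \<Rightarrow> (nat \<Rightarrow> bit) set \<Rightarrow> (nat \<Rightarrow> bit) \<Rightarrow> ((nat \<Rightarrow> bit) \<Rightarrow> complex)
    \<Rightarrow> (complex, 'v) module \<Rightarrow> ((nat \<Rightarrow> nat) \<Rightarrow> 'v \<Rightarrow> 'v)
    \<Rightarrow> (nat \<Rightarrow> bit) \<times> (nat \<Rightarrow> nat)
    \<Rightarrow> ((nat \<Rightarrow> bit) \<times> (nat \<Rightarrow> nat) \<Rightarrow> 'v) set \<Rightarrow> ((nat \<Rightarrow> bit) \<times> (nat \<Rightarrow> nat) \<Rightarrow> 'v) set"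
  where "theta n A a \<chi> V \<mu> =
    induced_action (centralizer_group (semidirect n A) (a, id))
      (A \<times> char_stabilizer n A a \<chi>) V (char_tensor \<chi> V \<mu>)"

definition bit_support :: "nat \<Rightarrow> (nat \<Rightarrow> bit) \<Rightarrow> nat set"
  where "bit_support n a = {i \<in> {1..n}. a i \<noteq> 0}"

lemma centralizer_semidirect:
  assumes "A \<subseteq> carrier (bit_group n)" "a \<in> A"
  shows "centralizer (semidirect n A) (a, id) = A \<times> elem_stabilizer n a"
proof -
  have "(\<lambda>i. x i + c i) = (\<lambda>i. a i + perm_act id x i) \<longleftrightarrow> c = a" for x c :: "nat \<Rightarrow> bit"
  proof -
    have "x i + c i = a i + x i \<longleftrightarrow> c i = a i" for i
      by (metis add.commute add_left_cancel)
    then show ?thesis by (auto simp: perm_act_def fun_eq_iff)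
  qed
  then show ?thesis
    by (auto simp: centralizer_def semidirect_def elem_stabilizer_def stabilizer_def
        sym_group_def bit_group_def)
qed

end

theory Submission
  imports Defs
begin

text \<open>Why the theorem holds. Conjugates of \<open>\<sigma>\<close> lie in the abelian group \<open>A\<close>, so \<open>M(O\<^sub>\<sigma>, \<rho>)\<close> splits into
  joint eigenspaces: it has a basis of vectors attached to elements \<open>k\<close> of \<open>G\<close>, of degree \<open>k \<sigma> k\<^sup>-\<^sup>1\<close>
  and on which \<open>A\<close> acts by the character \<open>k \<sqdot> \<chi>\<close>. Its braiding is therefore diagonal,
  \<open>c(x\<^sub>k \<otimes> x\<^sub>l) = q\<^bsub>k,l\<^esub> x\<^sub>l \<otimes> x\<^sub>k\<close>, and with \<open>\<pi>\<close> the permutation part of \<open>l\<^sup>-\<^sup>1 k\<close> the sign \<open>q\<^bsub>k,l\<^esub>\<close> is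
  \<open>\<chi>(\<pi> \<sqdot> \<sigma>)\<close>. In particular \<open>q\<^bsub>k,k\<^esub> = \<chi>(\<sigma>) = (-1)\<^bsup>f\<^esup>\<close> with \<open>f = f\<^sub>\<sigma>\<close>.

  For a diagonal braiding, the coefficient of the word \<open>u\<^sub>1 \<dots> u\<^sub>m\<close> in a quantum symmetrizer is
  computed by skew derivations: it is \<open>D\<^bsub>u\<^sub>1\<^esub> \<cdots> D\<^bsub>u\<^sub>m\<^esub> t\<close>, where
  \<open>D\<^sub>i (w x\<^sub>j) = \<delta>\<^bsub>i,j\<^esub> w + q\<^bsub>i,j\<^esub> D\<^sub>i(w) x\<^sub>j\<close>. The Nichols algebra is finite-dimensional iff
  these numbers vanish for all long words (\<open>fin_dim_if_symm_coord_vanishes\<close> and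
  \<open>not_fin_dim_if_symm_coord_nonzero\<close>). Three situations occur.

  \<^item> \<open>f\<close> even. Then \<open>q\<^bsub>k,k\<^esub> = 1\<close>, and \<open>D\<^sub>k\<^sup>m x\<^sub>k\<^sup>m = m!\<close>: infinite dimension.

  \<^item> \<open>f\<close> odd and one of the three conditions on the supports. Then \<open>\<chi>(\<pi> \<sqdot> \<sigma>) = \<chi>(\<pi>\<^sup>-\<^sup>1 \<sqdot> \<sigma>)\<close> for all \<open>\<pi>\<close>, so
    \<open>q\<^bsub>k,l\<^esub> q\<^bsub>l,k\<^esub> = 1\<close> and \<open>q\<^bsub>k,k\<^esub> = -1\<close>. The \<open>D\<^sub>k\<close> commute up to scalars and square to 0, so every
    chain of derivations longer than a basis vanishes.

  \<^item> \<open>f\<close> odd and none of the conditions. At least two of the sets \<open>W\<^sub>\<sigma> - W\<^sub>\<chi>\<close>, \<open>W\<^sub>\<chi> - W\<^sub>\<sigma>\<close> and the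
    complement of \<open>W\<^sub>\<sigma> \<union> W\<^sub>\<chi>\<close> are nonempty. With points of two of them and one of \<open>W\<^sub>\<sigma> \<inter> W\<^sub>\<chi>\<close> one
    forms a 3-cycle \<open>h\<close>, for which \<open>\<chi>(h \<sqdot> \<sigma>) \<chi>(h\<^sup>-\<^sup>1 \<sqdot> \<sigma>) = -1\<close>. Hence the vectors attached to
    \<open>1, h, h\<^sup>-\<^sup>1\<close> span a braided subspace with \<open>q\<^bsub>k,k\<^esub> = -1\<close> and \<open>q\<^bsub>k,l\<^esub> q\<^bsub>l,k\<^esub> = -1\<close>: the affine Cartan
    type \<open>A\<^sub>2\<^sup>(\<^sup>1\<^sup>)\<close> at -1. Its imaginary root vector \<open>z = [[x\<^sub>0, x\<^sub>1], x\<^sub>2]\<close> braids trivially with the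
    generators, and \<open>D\<^sub>0 D\<^sub>2 D\<^sub>1 z\<^sup>m = \<plusminus>4 m z\<^sup>m\<^sup>-\<^sup>1\<close>; so no power of \<open>z\<close> is zero in the Nichols algebra
    (\<open>skew_ders_nested_comm_power\<close>).

  The remaining work is to reach this description from the quotients that define the objects. An
  induced module is analysed through the maps \<open>f \<mapsto> \<Sum>h\<in>H. \<rho>(h) f(y h)\<close>, whose common kernel is exactly
  the space of balancing relations (\<open>balanced_iff_orbit_sums_zero\<close>). Applied to both inductions, they
  yield linear functionals on \<open>M(O\<^sub>\<sigma>, \<rho>)\<close> that are eigenvectors for the coaction and the action of \<open>A\<close> and
  separate points (\<open>nichols_diagonal\<close>). Coordinates of tensors with respect to such functionals
  turn the relations of \<open>T(M)\<close> and the symmetrizers into the explicit formulas above.\<close>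

section \<open>Linear algebra over the complex numbers\<close>

lemma linear_mapI:
  assumes "vectorspace \<complex>\<^sub>F V" "vectorspace \<complex>\<^sub>F W"
    and "\<And>x. x \<in> carrier V \<Longrightarrow> f x \<in> carrier W"
    and "\<And>x y. x \<in> carrier V \<Longrightarrow> y \<in> carrier V \<Longrightarrow> f (x \<oplus>\<^bsub>V\<^esub> y) = f x \<oplus>\<^bsub>W\<^esub> f y"
    and "\<And>c x. x \<in> carrier V \<Longrightarrow> f (c \<odot>\<^bsub>V\<^esub> x) = c \<odot>\<^bsub>W\<^esub> f x"
  shows "linear_map \<complex>\<^sub>F V W f"
  using assms
  unfolding linear_map_def mod_hom_def mod_hom_axioms_def LinearCombinations.module_hom_def
  by (auto simp: vectorspace_def)

lemma linear_mapD:
  assumes "linear_map \<complex>\<^sub>F V W f"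
  shows "x \<in> carrier V \<Longrightarrow> f x \<in> carrier W"
    and "x \<in> carrier V \<Longrightarrow> y \<in> carrier V \<Longrightarrow> f (x \<oplus>\<^bsub>V\<^esub> y) = f x \<oplus>\<^bsub>W\<^esub> f y"
    and "x \<in> carrier V \<Longrightarrow> f (c \<odot>\<^bsub>V\<^esub> x) = c \<odot>\<^bsub>W\<^esub> f x"
    and "f \<zero>\<^bsub>V\<^esub> = \<zero>\<^bsub>W\<^esub>"
    and "vectorspace \<complex>\<^sub>F V" "vectorspace \<complex>\<^sub>F W"
proof -
  interpret linear_map "\<complex>\<^sub>F :: complex ring" V W f by fact
  show "x \<in> carrier V \<Longrightarrow> f x \<in> carrier W"
    and "x \<in> carrier V \<Longrightarrow> y \<in> carrier V \<Longrightarrow> f (x \<oplus>\<^bsub>V\<^esub> y) = f x \<oplus>\<^bsub>W\<^esub> f y"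
    and "x \<in> carrier V \<Longrightarrow> f (c \<odot>\<^bsub>V\<^esub> x) = c \<odot>\<^bsub>W\<^esub> f x"
    and "f \<zero>\<^bsub>V\<^esub> = \<zero>\<^bsub>W\<^esub>"
    by auto
  show "vectorspace \<complex>\<^sub>F V" "vectorspace \<complex>\<^sub>F W" by unfold_locales
qed

lemma complex_vs_criteria:
  assumes "\<zero>\<^bsub>V\<^esub> \<in> carrier V"
    and "\<And>x y. x \<in> carrier V \<Longrightarrow> y \<in> carrier V \<Longrightarrow> x \<oplus>\<^bsub>V\<^esub> y \<in> carrier V"
    and "\<And>c x. x \<in> carrier V \<Longrightarrow> c \<odot>\<^bsub>V\<^esub> x \<in> carrier V"
    and "\<And>x y. x \<in> carrier V \<Longrightarrow> y \<in> carrier V \<Longrightarrow> x \<oplus>\<^bsub>V\<^esub> y = y \<oplus>\<^bsub>V\<^esub> x"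
    and "\<And>x y z. x \<in> carrier V \<Longrightarrow> y \<in> carrier V \<Longrightarrow> z \<in> carrier V \<Longrightarrow>
           (x \<oplus>\<^bsub>V\<^esub> y) \<oplus>\<^bsub>V\<^esub> z = x \<oplus>\<^bsub>V\<^esub> (y \<oplus>\<^bsub>V\<^esub> z)"
    and "\<And>x. x \<in> carrier V \<Longrightarrow> x \<oplus>\<^bsub>V\<^esub> \<zero>\<^bsub>V\<^esub> = x"
    and "\<And>c d x. x \<in> carrier V \<Longrightarrow> (c * d) \<odot>\<^bsub>V\<^esub> x = c \<odot>\<^bsub>V\<^esub> (d \<odot>\<^bsub>V\<^esub> x)"
    and "\<And>x. x \<in> carrier V \<Longrightarrow> 1 \<odot>\<^bsub>V\<^esub> x = x"
    and "\<And>x. x \<in> carrier V \<Longrightarrow> 0 \<odot>\<^bsub>V\<^esub> x = \<zero>\<^bsub>V\<^esub>"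
    and "\<And>c d x. x \<in> carrier V \<Longrightarrow> (c + d) \<odot>\<^bsub>V\<^esub> x = c \<odot>\<^bsub>V\<^esub> x \<oplus>\<^bsub>V\<^esub> d \<odot>\<^bsub>V\<^esub> x"
    and "\<And>c x y. x \<in> carrier V \<Longrightarrow> y \<in> carrier V \<Longrightarrow>
           c \<odot>\<^bsub>V\<^esub> (x \<oplus>\<^bsub>V\<^esub> y) = c \<odot>\<^bsub>V\<^esub> x \<oplus>\<^bsub>V\<^esub> c \<odot>\<^bsub>V\<^esub> y"
  shows "vectorspace \<complex>\<^sub>F V"
proof (rule vs_criteria)
  show "field \<complex>\<^sub>F" by (rule class_field)
  show "\<forall>v\<in>carrier V. \<exists>w\<in>carrier V. v \<oplus>\<^bsub>V\<^esub> w = \<zero>\<^bsub>V\<^esub>"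
  proof
    fix v assume v: "v \<in> carrier V"
    have "v \<oplus>\<^bsub>V\<^esub> (-1) \<odot>\<^bsub>V\<^esub> v = \<zero>\<^bsub>V\<^esub>"
      using assms(10)[OF v, of 1 "-1"] assms(8,9)[OF v] by simp
    then show "\<exists>w\<in>carrier V. v \<oplus>\<^bsub>V\<^esub> w = \<zero>\<^bsub>V\<^esub>"
      using assms(3)[OF v] by blast
  qed
qed (use assms in auto)

lemma subspaceI:
  assumes "vectorspace \<complex>\<^sub>F V" "N \<subseteq> carrier V" "\<zero>\<^bsub>V\<^esub> \<in> N"
    and "\<And>x y. x \<in> N \<Longrightarrow> y \<in> N \<Longrightarrow> x \<oplus>\<^bsub>V\<^esub> y \<in> N"
    and "\<And>c x. x \<in> N \<Longrightarrow> c \<odot>\<^bsub>V\<^esub> x \<in> N"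
  shows "subspace \<complex>\<^sub>F N V"
  using assms unfolding subspace_def submodule_def by (auto simp: vectorspace_def)

lemma subspaceD:
  assumes "subspace \<complex>\<^sub>F N V"
  shows "vectorspace \<complex>\<^sub>F V" "N \<subseteq> carrier V" "\<zero>\<^bsub>V\<^esub> \<in> N"
    and "x \<in> N \<Longrightarrow> y \<in> N \<Longrightarrow> x \<oplus>\<^bsub>V\<^esub> y \<in> N"
    and "x \<in> N \<Longrightarrow> c \<odot>\<^bsub>V\<^esub> x \<in> N"
  using assms unfolding subspace_def submodule_def by auto

lemma a_minus_smult:
  assumes "vectorspace \<complex>\<^sub>F V" "x \<in> carrier V" "y \<in> carrier V"
  shows "x \<ominus>\<^bsub>V\<^esub> y = x \<oplus>\<^bsub>V\<^esub> (-1) \<odot>\<^bsub>V\<^esub> y"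
proof -
  interpret vectorspace "\<complex>\<^sub>F :: complex ring" V by fact
  have "\<ominus>\<^bsub>\<complex>\<^sub>F\<^esub> 1 = (-1 :: complex)" by (simp add: class_ring_simps)
  then show ?thesis
    using smult_minus_1[OF assms(3)] by (simp add: a_minus_def)
qed

lemma span_least:
  assumes "subspace \<complex>\<^sub>F W V" "S \<subseteq> W"
  shows "LinearCombinations.module.span \<complex>\<^sub>F V S \<subseteq> W"
proof -
  interpret vectorspace "\<complex>\<^sub>F :: complex ring" V using subspaceD(1)[OF assms(1)] .
  show ?thesis using span_is_subset[OF assms(2)] assms(1) by (simp add: subspace_def)
qed

lemma span_subspace:
  assumes "vectorspace \<complex>\<^sub>F V" "S \<subseteq> carrier V"
  shows "subspace \<complex>\<^sub>F (LinearCombinations.module.span \<complex>\<^sub>F V S) V"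
    and "S \<subseteq> LinearCombinations.module.span \<complex>\<^sub>F V S"
proof -
  interpret vectorspace "\<complex>\<^sub>F :: complex ring" V by fact
  show "subspace \<complex>\<^sub>F (span S) V" "S \<subseteq> span S"
    using span_is_subspace[OF assms(2)] in_own_span[OF assms(2)] by auto
qed

lemma fin_dimI:
  assumes "vectorspace \<complex>\<^sub>F V" "finite B" "B \<subseteq> carrier V"
    and "\<And>W. subspace \<complex>\<^sub>F W V \<Longrightarrow> B \<subseteq> W \<Longrightarrow> carrier V \<subseteq> W"
  shows "vectorspace.fin_dim \<complex>\<^sub>F V"
proof -
  interpret vectorspace "\<complex>\<^sub>F :: complex ring" V by fact
  have "carrier V \<subseteq> span B" using assms(4) span_subspace[OF assms(1,3)] by blast
  then have "span B = carrier V" using span_is_subset2[OF assms(3)] by blast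
  then show ?thesis using assms(2,3) unfolding fin_dim_def by blast
qed

lemma fin_dimE:
  assumes "vectorspace \<complex>\<^sub>F V" "vectorspace.fin_dim \<complex>\<^sub>F V"
  obtains B where "finite B" "B \<subseteq> carrier V"
    and "\<And>W. subspace \<complex>\<^sub>F W V \<Longrightarrow> B \<subseteq> W \<Longrightarrow> carrier V \<subseteq> W"
proof -
  interpret vectorspace "\<complex>\<^sub>F :: complex ring" V by fact
  from assms(2) obtain B where "finite B" "B \<subseteq> carrier V" "span B = carrier V"
    unfolding fin_dim_def by blast
  with span_least that show ?thesis by metis
qed

subsection \<open>Quotients\<close>

context
  fixes M :: "(complex, 'v) module" and N :: "'v set"
  assumes N: "subspace \<complex>\<^sub>F N M"
begin

interpretation vectorspace "\<complex>\<^sub>F :: complex ring" M using subspaceD(1)[OF N] .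

lemma abelian_subgroup_quot: "abelian_subgroup N M"
proof (rule abelian_subgroupI3)
  have "\<ominus>\<^bsub>M\<^esub> x \<in> N" if "x \<in> N" for x
  proof -
    have x: "x \<in> carrier M" using that subspaceD(2)[OF N] by blast
    have "\<zero>\<^bsub>M\<^esub> \<ominus>\<^bsub>M\<^esub> x = \<zero>\<^bsub>M\<^esub> \<oplus>\<^bsub>M\<^esub> (-1) \<odot>\<^bsub>M\<^esub> x"
      using a_minus_smult[OF subspaceD(1)[OF N]] x by simp
    then show ?thesis using subspaceD[OF N] that x by (simp add: a_minus_def)
  qed
  then have "subgroup N (add_monoid M)"
    using subspaceD[OF N] by (intro subgroup.intro) (auto simp: a_inv_def)
  then show "additive_subgroup N M" by (rule additive_subgroupI)
  show "abelian_group M" by unfold_locales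
qed

interpretation S: abelian_subgroup N M by (rule abelian_subgroup_quot)

lemma carrier_quot_module: "carrier (quot_module M N) = (\<lambda>x. N +>\<^bsub>M\<^esub> x) ` carrier M"
  by (auto simp: quot_module_def FactRing_def A_RCOSETS_def')

lemma quot_coset_eq_iff:
  assumes "x \<in> carrier M" "y \<in> carrier M"
  shows "N +>\<^bsub>M\<^esub> x = N +>\<^bsub>M\<^esub> y \<longleftrightarrow> x \<ominus>\<^bsub>M\<^esub> y \<in> N"
proof -
  have "x \<in> N +>\<^bsub>M\<^esub> y \<longleftrightarrow> x \<ominus>\<^bsub>M\<^esub> y \<in> N"
    using S.a_rcos_module[of y x] assms by (simp add: a_minus_def)
  moreover have "N +>\<^bsub>M\<^esub> x = N +>\<^bsub>M\<^esub> y \<longleftrightarrow> x \<in> N +>\<^bsub>M\<^esub> y"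
    using S.a_repr_independence'[of x y] S.a_rcos_self[OF assms(1)] assms by auto
  ultimately show ?thesis by simp
qed

lemma quot_zero: "\<zero>\<^bsub>quot_module M N\<^esub> = N +>\<^bsub>M\<^esub> \<zero>\<^bsub>M\<^esub>"
  using subspaceD(2)[OF N] by (simp add: quot_module_def FactRing_def)

lemma quot_add:
  assumes "x \<in> carrier M" "y \<in> carrier M"
  shows "(N +>\<^bsub>M\<^esub> x) \<oplus>\<^bsub>quot_module M N\<^esub> (N +>\<^bsub>M\<^esub> y) = N +>\<^bsub>M\<^esub> (x \<oplus>\<^bsub>M\<^esub> y)"
  using S.a_rcos_sum[OF assms] by (simp add: quot_module_def FactRing_def)

lemma quot_coset_carrier: "x \<in> carrier M \<Longrightarrow> z \<in> N +>\<^bsub>M\<^esub> x \<Longrightarrow> z \<in> carrier M"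
  using S.a_elemrcos_carrier by (meson abelian_group_axioms)

lemma quot_map_gen:
  assumes x: "x \<in> carrier M"
    and \<phi>: "\<And>x. x \<in> carrier M \<Longrightarrow> \<phi> x \<in> carrier M"
    and wd: "\<And>x y. x \<in> carrier M \<Longrightarrow> y \<in> carrier M \<Longrightarrow> x \<ominus>\<^bsub>M\<^esub> y \<in> N \<Longrightarrow> \<phi> x \<ominus>\<^bsub>M\<^esub> \<phi> y \<in> N"
  shows "quot_map M N \<phi> (N +>\<^bsub>M\<^esub> x) = N +>\<^bsub>M\<^esub> \<phi> x"
proof -
  have "N +>\<^bsub>M\<^esub> \<phi> z = N +>\<^bsub>M\<^esub> \<phi> x" if "z \<in> N +>\<^bsub>M\<^esub> x" for z
  proof -
    have z: "z \<in> carrier M" using quot_coset_carrier[OF x that] .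
    then have "z \<ominus>\<^bsub>M\<^esub> x \<in> N"
      using S.a_rcos_module[of x z] x that by (simp add: a_minus_def)
    then show ?thesis using quot_coset_eq_iff z x \<phi> wd by simp
  qed
  then show ?thesis using S.a_rcos_self[OF x] unfolding quot_map_def by blast
qed

lemma quot_smult:
  assumes "x \<in> carrier M"
  shows "c \<odot>\<^bsub>quot_module M N\<^esub> (N +>\<^bsub>M\<^esub> x) = N +>\<^bsub>M\<^esub> (c \<odot>\<^bsub>M\<^esub> x)"
proof -
  have "quot_map M N (\<lambda>x. c \<odot>\<^bsub>M\<^esub> x) (N +>\<^bsub>M\<^esub> x) = N +>\<^bsub>M\<^esub> (c \<odot>\<^bsub>M\<^esub> x)"
  proof (rule quot_map_gen[OF assms])
    fix x y assume xy: "x \<in> carrier M" "y \<in> carrier M" "x \<ominus>\<^bsub>M\<^esub> y \<in> N"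
    have "c \<odot>\<^bsub>M\<^esub> x \<ominus>\<^bsub>M\<^esub> c \<odot>\<^bsub>M\<^esub> y = c \<odot>\<^bsub>M\<^esub> (x \<ominus>\<^bsub>M\<^esub> y)"
      using xy a_minus_smult[OF subspaceD(1)[OF N]]
      by (simp add: smult_r_distr smult_assoc1[symmetric])
    then show "c \<odot>\<^bsub>M\<^esub> x \<ominus>\<^bsub>M\<^esub> c \<odot>\<^bsub>M\<^esub> y \<in> N" using xy subspaceD(5)[OF N] by simp
  qed simp
  then show ?thesis by (simp add: quot_module_def quot_map_def)
qed

lemma vectorspace_quot: "vectorspace \<complex>\<^sub>F (quot_module M N)"
proof (rule complex_vs_criteria, goal_cases)
  case 1 show ?case using quot_zero carrier_quot_module by auto
next
  case (2 x y) then show ?case by (auto simp: carrier_quot_module quot_add)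
next
  case (3 c x) then show ?case by (auto simp: carrier_quot_module quot_smult)
next
  case (4 x y) then show ?case by (auto simp: carrier_quot_module quot_add a_comm)
next
  case (5 x y z) then show ?case by (auto simp: carrier_quot_module quot_add a_assoc)
next
  case (6 x) then show ?case by (auto simp: carrier_quot_module quot_add quot_zero)
next
  case (7 c d x) then show ?case
    using smult_assoc1[of c d] by (auto simp: carrier_quot_module quot_smult)
next
  case (8 x) then show ?case using smult_one by (auto simp: carrier_quot_module quot_smult)
next
  case (9 x) then show ?case
    using lmult_0 by (auto simp: carrier_quot_module quot_smult quot_zero)
next
  case (10 c d x) then show ?case
    using smult_l_distr[of c d] by (auto simp: carrier_quot_module quot_smult quot_add)
next
  case (11 c x y) then show ?case
    using smult_r_distr[of c] by (auto simp: carrier_quot_module quot_smult quot_add)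
qed

lemma linear_map_quot: "linear_map \<complex>\<^sub>F M (quot_module M N) (\<lambda>x. N +>\<^bsub>M\<^esub> x)"
  by (rule linear_mapI)
    (auto simp: subspaceD(1)[OF N] vectorspace_quot carrier_quot_module quot_add quot_smult)

lemma quot_coset_zero_iff:
  assumes "x \<in> carrier M"
  shows "N +>\<^bsub>M\<^esub> x = \<zero>\<^bsub>quot_module M N\<^esub> \<longleftrightarrow> x \<in> N"
  using assms quot_coset_eq_iff[OF assms M.zero_closed] a_minus_smult[OF subspaceD(1)[OF N]]
  unfolding quot_zero by (simp add: smult_r_null)

lemma quot_map_coset:
  assumes x: "x \<in> carrier M" and \<phi>: "linear_map \<complex>\<^sub>F M M \<phi>"
    and "\<And>x. x \<in> N \<Longrightarrow> \<phi> x \<in> N"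
  shows "quot_map M N \<phi> (N +>\<^bsub>M\<^esub> x) = N +>\<^bsub>M\<^esub> \<phi> x"
proof (rule quot_map_gen[OF x])
  interpret T: linear_map "\<complex>\<^sub>F :: complex ring" M M \<phi> by fact
  fix x y assume "x \<in> carrier M" "y \<in> carrier M" "x \<ominus>\<^bsub>M\<^esub> y \<in> N"
  then show "\<phi> x \<ominus>\<^bsub>M\<^esub> \<phi> y \<in> N" using assms(3)[of "x \<ominus>\<^bsub>M\<^esub> y"] by simp
qed (use linear_mapD[OF \<phi>] in auto)

lemma linear_map_quot_map:
  assumes \<phi>: "linear_map \<complex>\<^sub>F M M \<phi>" and N\<phi>: "\<And>x. x \<in> N \<Longrightarrow> \<phi> x \<in> N"
  shows "linear_map \<complex>\<^sub>F (quot_module M N) (quot_module M N) (quot_map M N \<phi>)"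
  by (rule linear_mapI)
    (auto simp: vectorspace_quot carrier_quot_module quot_add quot_smult
        quot_map_coset[OF _ \<phi> N\<phi>] linear_mapD[OF \<phi>])

end

text \<open>The map induced on a quotient by \<open>\<phi>\<close>, as the value at some representative; this is only
  meaningful if \<open>\<phi>\<close> vanishes on the subspace.\<close>

definition quot_lift :: "('v \<Rightarrow> 'w) \<Rightarrow> 'v set \<Rightarrow> 'w"
  where "quot_lift \<phi> X = \<phi> (SOME x. x \<in> X)"

lemma quot_lift_coset:
  fixes M :: "(complex, 'v) module"
  assumes N: "subspace \<complex>\<^sub>F N M" and x: "x \<in> carrier M" and \<phi>: "linear_map \<complex>\<^sub>F M W \<phi>"
    and ker: "\<And>x. x \<in> N \<Longrightarrow> \<phi> x = \<zero>\<^bsub>W\<^esub>"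
  shows "quot_lift \<phi> (N +>\<^bsub>M\<^esub> x) = \<phi> x"
proof -
  interpret T: linear_map "\<complex>\<^sub>F :: complex ring" M W \<phi> by fact
  interpret S: abelian_subgroup N M by (rule abelian_subgroup_quot[OF N])
  define y where "y = (SOME y. y \<in> N +>\<^bsub>M\<^esub> x)"
  have y: "y \<in> N +>\<^bsub>M\<^esub> x" unfolding y_def by (rule someI[of _ x]) (rule S.a_rcos_self[OF x])
  then have "y \<in> carrier M" using quot_coset_carrier[OF N x] by blast
  moreover from this have "y \<ominus>\<^bsub>M\<^esub> x \<in> N"
    using S.a_rcos_module[of x y] x y by (simp add: a_minus_def)
  ultimately have "\<phi> y \<ominus>\<^bsub>W\<^esub> \<phi> x = \<zero>\<^bsub>W\<^esub>" using ker x by (metis T.f_minus)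
  then have "\<phi> y = \<phi> x" using x \<open>y \<in> carrier M\<close> linear_mapD(1,6)[OF \<phi>]
    by (metis abelian_group.minus_other_side module.axioms(2) vectorspace.axioms(1))
  then show ?thesis by (simp add: quot_lift_def y_def)
qed

lemma linear_map_comp:
  assumes "linear_map \<complex>\<^sub>F U V f" "linear_map \<complex>\<^sub>F V W g"
  shows "linear_map \<complex>\<^sub>F U W (\<lambda>x. g (f x))"
  by (rule linear_mapI)
    (use linear_mapD[OF assms(1)] linear_mapD[OF assms(2)] in simp_all)

subsection \<open>Linear functionals\<close>

definition linear_functional :: "(complex, 'v) module \<Rightarrow> ('v \<Rightarrow> complex) \<Rightarrow> bool"
  where "linear_functional V \<phi> \<longleftrightarrow>
    (\<forall>x\<in>carrier V. \<forall>y\<in>carrier V. \<phi> (x \<oplus>\<^bsub>V\<^esub> y) = \<phi> x + \<phi> y) \<and>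
    (\<forall>c. \<forall>x\<in>carrier V. \<phi> (c \<odot>\<^bsub>V\<^esub> x) = c * \<phi> x)"

lemma linear_functionalD:
  assumes "linear_functional V \<phi>"
  shows "x \<in> carrier V \<Longrightarrow> y \<in> carrier V \<Longrightarrow> \<phi> (x \<oplus>\<^bsub>V\<^esub> y) = \<phi> x + \<phi> y"
    and "x \<in> carrier V \<Longrightarrow> \<phi> (c \<odot>\<^bsub>V\<^esub> x) = c * \<phi> x"
  using assms by (auto simp: linear_functional_def)

lemma linear_functional_zero:
  assumes "vectorspace \<complex>\<^sub>F V" "linear_functional V \<phi>"
  shows "\<phi> \<zero>\<^bsub>V\<^esub> = 0"
proof -
  interpret vectorspace "\<complex>\<^sub>F :: complex ring" V by fact
  show ?thesis using linear_functionalD(2)[OF assms(2) M.zero_closed, of 0] rmult_0[of 0] by simp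
qed

lemma linear_functional_comp:
  assumes "linear_map \<complex>\<^sub>F V W f" "linear_functional W \<phi>"
  shows "linear_functional V (\<lambda>x. \<phi> (f x))"
  using linear_mapD[OF assms(1)] linear_functionalD[OF assms(2)] by (simp add: linear_functional_def)

text \<open>The coordinates with respect to a basis, which also serves as index set.\<close>

lemma fin_dim_separating_functionals:
  fixes V :: "(complex, 'v) module"
  assumes V: "vectorspace \<complex>\<^sub>F V" and fd: "vectorspace.fin_dim \<complex>\<^sub>F V"
  shows "\<exists>(\<beta> :: 'v set) \<eta>. finite \<beta> \<and> (\<forall>b\<in>\<beta>. linear_functional V (\<eta> b)) \<and>
    (\<forall>x\<in>carrier V. (\<forall>b\<in>\<beta>. \<eta> b x = 0) \<longrightarrow> x = \<zero>\<^bsub>V\<^esub>)"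
proof -
  interpret vectorspace "\<complex>\<^sub>F :: complex ring" V by fact
  obtain \<beta> where \<beta>: "finite \<beta>" "basis \<beta>" using finite_basis_exists[OF fd] by blast
  have \<beta>V: "\<beta> \<subseteq> carrier V" using \<beta>(2) by (simp add: basis_def)
  have ex1: "\<exists>!a. a \<in> \<beta> \<rightarrow>\<^sub>E UNIV \<and> lincomb a \<beta> = x" if "x \<in> carrier V" for x
    using basis_criterion[OF \<beta>(1) \<beta>V] \<beta>(2) that by simp
  define a where "a x = (THE a. a \<in> \<beta> \<rightarrow>\<^sub>E UNIV \<and> lincomb a \<beta> = x)" for x
  have a: "a x \<in> \<beta> \<rightarrow>\<^sub>E UNIV" "lincomb (a x) \<beta> = x" if "x \<in> carrier V" for x
    using theI'[OF ex1[OF that]] by (simp_all add: a_def)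
  have a_eq: "a x = c" if "x \<in> carrier V" "c \<in> \<beta> \<rightarrow>\<^sub>E UNIV" "lincomb c \<beta> = x" for x c
    unfolding a_def by (rule the1_equality[OF ex1[OF that(1)]]) (use that in simp)
  have tm: "c b \<odot>\<^bsub>V\<^esub> b \<in> carrier V" if "b \<in> \<beta>" for c b using that \<beta>V by auto
  have "linear_functional V (\<lambda>x. a x b)" if b: "b \<in> \<beta>" for b
    unfolding linear_functional_def
  proof (intro conjI ballI allI)
    fix x y assume xy: "x \<in> carrier V" "y \<in> carrier V"
    have "lincomb (\<lambda>b\<in>\<beta>. a x b + a y b) \<beta> = (\<Oplus>\<^bsub>V\<^esub>b\<in>\<beta>. a x b \<odot>\<^bsub>V\<^esub> b \<oplus>\<^bsub>V\<^esub> a y b \<odot>\<^bsub>V\<^esub> b)"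
      unfolding lincomb_def
    proof (rule finsum_cong')
      fix b assume "b \<in> \<beta>"
      then show "(\<lambda>b\<in>\<beta>. a x b + a y b) b \<odot>\<^bsub>V\<^esub> b = a x b \<odot>\<^bsub>V\<^esub> b \<oplus>\<^bsub>V\<^esub> a y b \<odot>\<^bsub>V\<^esub> b"
        using smult_l_distr[of "a x b" "a y b" b] \<beta>V by auto
    qed (use tm in auto)
    also have "\<dots> = lincomb (a x) \<beta> \<oplus>\<^bsub>V\<^esub> lincomb (a y) \<beta>"
      unfolding lincomb_def by (rule finsum_addf) (use tm in auto)
    also have "\<dots> = x \<oplus>\<^bsub>V\<^esub> y" using a xy by simp
    finally have "a (x \<oplus>\<^bsub>V\<^esub> y) = (\<lambda>b\<in>\<beta>. a x b + a y b)" using xy by (intro a_eq) auto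
    then show "a (x \<oplus>\<^bsub>V\<^esub> y) b = a x b + a y b" using b by simp
  next
    fix c x assume x: "x \<in> carrier V"
    have "lincomb (\<lambda>b\<in>\<beta>. c * a x b) \<beta> = (\<Oplus>\<^bsub>V\<^esub>b\<in>\<beta>. c \<odot>\<^bsub>V\<^esub> (a x b \<odot>\<^bsub>V\<^esub> b))"
      unfolding lincomb_def
    proof (rule finsum_cong')
      fix b assume "b \<in> \<beta>"
      then show "(\<lambda>b\<in>\<beta>. c * a x b) b \<odot>\<^bsub>V\<^esub> b = c \<odot>\<^bsub>V\<^esub> (a x b \<odot>\<^bsub>V\<^esub> b)"
        using smult_assoc1[of c "a x b" b] \<beta>V by auto
    qed (use tm \<beta>V in auto)
    also have "\<dots> = c \<odot>\<^bsub>V\<^esub> lincomb (a x) \<beta>"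
      unfolding lincomb_def by (rule finsum_smult[symmetric]) (use tm in auto)
    finally have "a (c \<odot>\<^bsub>V\<^esub> x) = (\<lambda>b\<in>\<beta>. c * a x b)" using x a by (intro a_eq) auto
    then show "a (c \<odot>\<^bsub>V\<^esub> x) b = c * a x b" using b by simp
  qed
  moreover have "x = \<zero>\<^bsub>V\<^esub>" if x: "x \<in> carrier V" and 0: "\<And>b. b \<in> \<beta> \<Longrightarrow> a x b = 0" for x
  proof -
    have "x = lincomb (a x) \<beta>" using a x by simp
    also have "\<dots> = (\<Oplus>\<^bsub>V\<^esub>b\<in>\<beta>. \<zero>\<^bsub>V\<^esub>)" unfolding lincomb_def
    proof (rule finsum_cong')
      fix b assume b: "b \<in> \<beta>"
      then have "0 \<odot>\<^bsub>V\<^esub> b = \<zero>\<^bsub>V\<^esub>" using lmult_0[of b] \<beta>V by auto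
      then show "a x b \<odot>\<^bsub>V\<^esub> b = \<zero>\<^bsub>V\<^esub>" using 0[OF b] by simp
    qed auto
    finally show ?thesis by simp
  qed
  ultimately show ?thesis using \<beta>(1) by (intro exI[of _ \<beta>] exI[of _ "\<lambda>b x. a x b"]) blast
qed

text \<open>The orbit of a nonzero vector is finite and spans an invariant subspace.\<close>

lemma irreducible_representation_fin_dim:
  assumes "group G" "finite (carrier G)" "irreducible_representation G V \<rho>"
  shows "vectorspace.fin_dim \<complex>\<^sub>F V"
proof -
  interpret group G by fact
  have rep: "representation G V \<rho>" and irr: "\<And>W. subspace \<complex>\<^sub>F W V \<Longrightarrow> (\<And>g. g \<in> carrier G \<Longrightarrow> \<rho> g ` W \<subseteq> W) \<Longrightarrow>
      W = {\<zero>\<^bsub>V\<^esub>} \<or> W = carrier V" and nz: "carrier V \<noteq> {\<zero>\<^bsub>V\<^esub>}"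
    using assms(3) unfolding irreducible_representation_def by blast+
  have V: "vectorspace \<complex>\<^sub>F V" and lin: "\<And>g. g \<in> carrier G \<Longrightarrow> linear_map \<complex>\<^sub>F V V (\<rho> g)"
    and one: "\<And>v. v \<in> carrier V \<Longrightarrow> \<rho> \<one>\<^bsub>G\<^esub> v = v"
    and mult: "\<And>g h v. g \<in> carrier G \<Longrightarrow> h \<in> carrier G \<Longrightarrow> v \<in> carrier V \<Longrightarrow> \<rho> (g \<otimes>\<^bsub>G\<^esub> h) v = \<rho> g (\<rho> h v)"
    using rep unfolding representation_def by blast+
  interpret V: vectorspace "\<complex>\<^sub>F :: complex ring" V by (rule V)
  obtain v where v: "v \<in> carrier V" "v \<noteq> \<zero>\<^bsub>V\<^esub>" using nz V.zero_closed by blast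
  define B where "B = (\<lambda>g. \<rho> g v) ` carrier G"
  define W where "W = V.span B"
  have B: "B \<subseteq> carrier V" using v linear_mapD(1)[OF lin] by (auto simp: B_def)
  have W: "subspace \<complex>\<^sub>F W V" "B \<subseteq> W" unfolding W_def using span_subspace[OF V B] by auto
  have "\<rho> g ` W \<subseteq> W" if g: "g \<in> carrier G" for g
  proof -
    define U where "U = {x \<in> carrier V. \<rho> g x \<in> W}"
    note l = linear_mapD[OF lin[OF g]]
    have "subspace \<complex>\<^sub>F U V"
      by (rule subspaceI[OF V]) (use l(1-4) subspaceD(2-)[OF W(1)] in \<open>auto simp: U_def\<close>)
    moreover have "B \<subseteq> U"
    proof
      fix x assume "x \<in> B"
      then obtain h where h: "h \<in> carrier G" "x = \<rho> h v" by (auto simp: B_def)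
      then have "\<rho> g x = \<rho> (g \<otimes>\<^bsub>G\<^esub> h) v" using mult g v by simp
      then have "\<rho> g x \<in> B" using g h(1) by (auto simp: B_def)
      then show "x \<in> U" using W(2) B \<open>x \<in> B\<close> by (auto simp: U_def)
    qed
    ultimately have "W \<subseteq> U" unfolding W_def by (rule span_least)
    then show ?thesis by (auto simp: U_def)
  qed
  moreover have "v \<in> W" using W(2) one[OF v(1)] by (force simp: B_def)
  ultimately have "W = carrier V" using irr[OF W(1)] v(2) by blast
  moreover have "finite B" using assms(2) by (simp add: B_def)
  ultimately show ?thesis using B unfolding V.fin_dim_def W_def by blast
qed

text \<open>From functionals \<open>\<xi>\<close> one can select a subfamily that has a dual family of vectors and the same
  common kernel; a subfamily \<open>I0\<close> that already has dual vectors can be kept. A further functional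
  is either redundant, or nonzero at a common zero of the selected ones; such a zero, rescaled, is
  its dual vector, and the other vectors are corrected by multiples of it.\<close>

lemma extend_dual_system:
  assumes M: "vectorspace \<complex>\<^sub>F M" and "finite D" and lin: "\<And>i. i \<in> I0 \<union> D \<Longrightarrow> linear_functional M (\<xi> i)"
    and v0: "\<And>i. i \<in> I0 \<Longrightarrow> v0 i \<in> carrier M"
    and dual0: "\<And>i j. i \<in> I0 \<Longrightarrow> j \<in> I0 \<Longrightarrow> \<xi> i (v0 j) = (if i = j then 1 else 0)"
  shows "\<exists>I v. I0 \<subseteq> I \<and> I \<subseteq> I0 \<union> D \<and> (\<forall>i\<in>I. v i \<in> carrier M) \<and>
    (\<forall>i\<in>I. \<forall>j\<in>I. \<xi> i (v j) = (if i = j then 1 else 0)) \<and>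
    (\<forall>x\<in>carrier M. (\<forall>i\<in>I. \<xi> i x = 0) \<longrightarrow> (\<forall>i\<in>I0 \<union> D. \<xi> i x = 0))"
  using assms(2,3)
proof (induction D rule: finite_induct)
  case empty
  show ?case by (rule exI[of _ I0], rule exI[of _ v0]) (use v0 dual0 in simp)
next
  case (insert k D)
  interpret vectorspace "\<complex>\<^sub>F :: complex ring" M by (rule M)
  have "\<exists>I v. I0 \<subseteq> I \<and> I \<subseteq> I0 \<union> D \<and> (\<forall>i\<in>I. v i \<in> carrier M) \<and>
    (\<forall>i\<in>I. \<forall>j\<in>I. \<xi> i (v j) = (if i = j then 1 else 0)) \<and>
    (\<forall>x\<in>carrier M. (\<forall>i\<in>I. \<xi> i x = 0) \<longrightarrow> (\<forall>i\<in>I0 \<union> D. \<xi> i x = 0))"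
    by (rule insert.IH) (use insert.prems in blast)
  then obtain I v where I: "I0 \<subseteq> I" "I \<subseteq> I0 \<union> D" "\<forall>i\<in>I. v i \<in> carrier M"
    "\<forall>i\<in>I. \<forall>j\<in>I. \<xi> i (v j) = (if i = j then 1 else 0)"
    "\<forall>x\<in>carrier M. (\<forall>i\<in>I. \<xi> i x = 0) \<longrightarrow> (\<forall>i\<in>I0 \<union> D. \<xi> i x = 0)"
    by (elim exE conjE)
  show ?case
  proof (cases "\<forall>x\<in>carrier M. (\<forall>i\<in>I. \<xi> i x = 0) \<longrightarrow> \<xi> k x = 0")
    case True
    then have "\<forall>x\<in>carrier M. (\<forall>i\<in>I. \<xi> i x = 0) \<longrightarrow> (\<forall>i\<in>I0 \<union> insert k D. \<xi> i x = 0)"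
      using I(5) by blast
    moreover have "I \<subseteq> I0 \<union> insert k D" using I(2) by blast
    ultimately show ?thesis using I(1,3,4) by (intro exI[of _ I] exI[of _ v] conjI)
  next
    case False
    then obtain x where x: "x \<in> carrier M" "\<And>i. i \<in> I \<Longrightarrow> \<xi> i x = 0" "\<xi> k x \<noteq> 0" by blast
    have kI: "k \<notin> I" using x by blast
    have L: "linear_functional M (\<xi> i)" if "i \<in> insert k I" for i using that I(2) insert.prems by auto
    note L' = linear_functionalD[OF L]
    define y where "y = inverse (\<xi> k x) \<odot>\<^bsub>M\<^esub> x"
    have y: "y \<in> carrier M" "\<And>i. i \<in> I \<Longrightarrow> \<xi> i y = 0" "\<xi> k y = 1"
      using x L' by (simp_all add: y_def)
    define w where "w i = (if i = k then y else v i \<oplus>\<^bsub>M\<^esub> (- \<xi> k (v i)) \<odot>\<^bsub>M\<^esub> y)" for i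
    have w: "w i \<in> carrier M" if "i \<in> insert k I" for i using that y I(3) by (auto simp: w_def)
    have "\<xi> i (w j) = (if i = j then 1 else 0)" if "i \<in> insert k I" "j \<in> insert k I" for i j
    proof (cases "j = k")
      case True
      then show ?thesis using that kI y by (auto simp: w_def)
    next
      case False
      then have j: "j \<in> I" using that by simp
      have vj: "v j \<in> carrier M" using I(3) j by blast
      have "\<xi> i (w j) = \<xi> i (v j) + (- \<xi> k (v j)) * \<xi> i y"
        using False L'[OF that(1)] vj y(1) by (simp add: w_def)
      then show ?thesis using that(1) False j kI y(2,3) I(4) by (cases "i = k") auto
    qed
    then have "\<forall>i\<in>insert k I. \<forall>j\<in>insert k I. \<xi> i (w j) = (if i = j then 1 else 0)" by blast
    moreover have "\<forall>x\<in>carrier M. (\<forall>i\<in>insert k I. \<xi> i x = 0) \<longrightarrow> (\<forall>i\<in>I0 \<union> insert k D. \<xi> i x = 0)"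
      using I(5) by blast
    moreover have "I0 \<subseteq> insert k I" "insert k I \<subseteq> I0 \<union> insert k D" using I(1,2) by blast+
    moreover have "\<forall>i\<in>insert k I. w i \<in> carrier M" using w by blast
    ultimately show ?thesis by (intro exI[of _ "insert k I"] exI[of _ w] conjI)
  qed
qed

section \<open>Skew derivations\<close>

text \<open>Functions on words over \<open>I\<close> are the noncommutative polynomials in letters \<open>x\<^sub>i\<close>, given by their
  coefficients. \<open>skew_der q i\<close> is the right skew derivation \<open>D\<^sub>i\<close> with
  \<open>D\<^sub>i (w x\<^sub>j) = \<delta>\<^bsub>i,j\<^esub> w + q\<^bsub>i,j\<^esub> D\<^sub>i(w) x\<^sub>j\<close>: it deletes each letter \<open>x\<^sub>i\<close> in turn, after braiding it to
  the end of the word. In terms of coefficients, it sums over all ways to insert \<open>i\<close> into a word.\<close>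

fun skew_der :: "('i \<Rightarrow> 'i \<Rightarrow> complex) \<Rightarrow> 'i \<Rightarrow> ('i list \<Rightarrow> complex) \<Rightarrow> 'i list \<Rightarrow> complex" where
  "skew_der q i f [] = f [i]"
| "skew_der q i f (j # u) =
    (\<Prod>l\<leftarrow>j # u. q i l) * f (i # j # u) + skew_der q i (\<lambda>w. f (j # w)) u"

abbreviation skew_ders :: "('i \<Rightarrow> 'i \<Rightarrow> complex) \<Rightarrow> 'i list \<Rightarrow> ('i list \<Rightarrow> complex) \<Rightarrow> 'i list \<Rightarrow> complex"
  where "skew_ders q u f \<equiv> foldr (skew_der q) u f"

abbreviation strip :: "'i \<Rightarrow> ('i list \<Rightarrow> complex) \<Rightarrow> 'i list \<Rightarrow> complex"
  where "strip j f \<equiv> (\<lambda>w. f (w @ [j]))"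

text \<open>The recursion above peels off the first letter; the Leibniz rule needs the last one.\<close>

lemma skew_der_snoc:
  "skew_der q i f (u @ [j]) = f (u @ [j, i]) + q i j * skew_der q i (strip j f) u"
  by (induction u arbitrary: f) (simp_all add: algebra_simps)

lemma skew_der_sum:
  "skew_der q i (\<lambda>v. \<Sum>w\<in>S. c w * f w v) u = (\<Sum>w\<in>S. c w * skew_der q i (f w) u)"
  by (induction u arbitrary: f)
    (simp_all add: sum_distrib_left sum.distrib algebra_simps)

lemma skew_ders_sum:
  "skew_ders q u (\<lambda>v. \<Sum>w\<in>S. c w * f w v) v = (\<Sum>w\<in>S. c w * skew_ders q u (f w) v)"
proof (induction u arbitrary: v)
  case (Cons i u)
  then have "skew_ders q u (\<lambda>v. \<Sum>w\<in>S. c w * f w v) = (\<lambda>v. \<Sum>w\<in>S. c w * skew_ders q u (f w) v)"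
    by (intro ext)
  then show ?case by (simp add: skew_der_sum)
qed simp

lemma skew_der_add: "skew_der q i (\<lambda>v. f v + g v) = (\<lambda>v. skew_der q i f v + skew_der q i g v)"
proof
  fix u show "skew_der q i (\<lambda>v. f v + g v) u = skew_der q i f u + skew_der q i g u"
    by (induction u arbitrary: f g) (simp_all add: algebra_simps)
qed

lemma skew_der_scale: "skew_der q i (\<lambda>v. c * f v) = (\<lambda>v. c * skew_der q i f v)"
proof
  fix u show "skew_der q i (\<lambda>v. c * f v) u = c * skew_der q i f u"
    by (induction u arbitrary: f) (simp_all add: algebra_simps)
qed

lemma skew_der_diff: "skew_der q i (\<lambda>v. f v - g v) = (\<lambda>v. skew_der q i f v - skew_der q i g v)"
  using skew_der_add[of q i f "\<lambda>v. (-1) * g v"] skew_der_scale[of q i "-1" g] by simp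

lemma skew_ders_scale: "skew_ders q u (\<lambda>v. c * f v) = (\<lambda>v. c * skew_ders q u f v)"
  by (induction u) (simp_all add: skew_der_scale)

lemma skew_der_cong:
  assumes "\<And>w. set w \<subseteq> I \<Longrightarrow> length w = Suc (length u) \<Longrightarrow> f w = g w" "i \<in> I" "set u \<subseteq> I"
  shows "skew_der q i f u = skew_der q i g u"
  using assms
proof (induction u arbitrary: f g)
  case (Cons j u)
  have "skew_der q i (\<lambda>w. f (j # w)) u = skew_der q i (\<lambda>w. g (j # w)) u"
    by (rule Cons.IH) (use Cons.prems in auto)
  moreover have "f (i # j # u) = g (i # j # u)" using Cons.prems by auto
  ultimately show ?case by simp
qed simp

lemma skew_ders_cong:
  assumes "\<And>w. set w \<subseteq> I \<Longrightarrow> length w = length u + length v \<Longrightarrow> f w = g w"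
    "set u \<subseteq> I" "set v \<subseteq> I"
  shows "skew_ders q u f v = skew_ders q u g v"
  using assms
proof (induction u arbitrary: v)
  case (Cons i u)
  show ?case unfolding foldr.simps comp_def
    by (rule skew_der_cong[where I = I]) (use Cons in auto)
qed simp

subsection \<open>Quantum linear spaces: long chains of derivations vanish\<close>

text \<open>If \<open>x\<^sub>i\<close> and \<open>x\<^sub>j\<close> q-commute, so do the derivations. By induction on the word: both sides satisfy
  the same recursion in the last letter, with the same coefficients once \<open>q\<^bsub>i,j\<^esub> q\<^bsub>j,i\<^esub> = 1\<close>.\<close>

lemma skew_der_commute:
  assumes "q i j * q j i = 1"
  shows "skew_der q i (skew_der q j f) = (\<lambda>u. q j i * skew_der q j (skew_der q i f) u)"
proof
  fix u
  show "skew_der q i (skew_der q j f) u = q j i * skew_der q j (skew_der q i f) u"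
  proof (induction u arbitrary: f rule: rev_induct)
    case Nil
    have "skew_der q j f [i] = f [i, j] + q j i * f [j, i]"
      "skew_der q i f [j] = f [j, i] + q i j * f [i, j]"
      using skew_der_snoc[of q _ f "[]"] by simp_all
    then show ?case using assms by (simp add: algebra_simps)
  next
    case (snoc l u)
    have 1: "strip l (skew_der q j f) = (\<lambda>w. f (w @ [l, j]) + q j l * skew_der q j (strip l f) w)"
      for j by (rule ext) (simp add: skew_der_snoc)
    have 2: "skew_der q i (skew_der q j f) (u @ [l]) =
       f (u @ [l, i, j]) + q j i * (f (u @ [l, j, i]) + q j l * skew_der q j (\<lambda>w. f (w @ [l, i])) u)
      + q i l * (skew_der q i (\<lambda>w. f (w @ [l, j])) u + q j l * skew_der q i (skew_der q j (strip l f)) u)"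
      for i j
      using skew_der_snoc[of q j f "u @ [l]" i] skew_der_snoc[of q j "strip i f" u l]
      by (simp add: skew_der_snoc 1 skew_der_add skew_der_scale)
    have 3: "q i j * (q j i * x) = x" "q j i * (q i j * x) = x" for x
      using assms by (simp_all add: mult.commute mult.left_commute flip: mult.assoc)
    have 4: "q i j * (y * (q j i * x)) = y * x" "q j i * (y * (q i j * x)) = y * x" for x y
      using 3 by (simp_all add: mult.left_commute)
    show ?case unfolding 2 snoc.IH by (simp add: 3 4 algebra_simps)
  qed
qed

text \<open>The case \<open>i = j\<close> of the commutation rule reads \<open>D\<^sub>i\<^sup>2 = - D\<^sub>i\<^sup>2\<close>.\<close>

lemma skew_der_twice:
  assumes "q i i = -1"
  shows "skew_der q i (skew_der q i f) = (\<lambda>u. 0)"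
proof -
  have "skew_der q i (skew_der q i f) u = - skew_der q i (skew_der q i f) u" for u
    by (subst skew_der_commute[of q i i]) (use assms in simp_all)
  then have "skew_der q i (skew_der q i f) u = 0" for u by (simp add: equal_neg_zero)
  then show ?thesis by (intro ext)
qed

lemma skew_ders_zero: "skew_ders q u (\<lambda>v. 0) = (\<lambda>v. 0)"
  using skew_ders_scale[of q u 0 "\<lambda>v. 0"] by simp

text \<open>Two equal letters can be moved next to each other, at the cost of a scalar.\<close>

lemma skew_ders_repeated:
  assumes comm: "\<And>i j. i \<in> I \<Longrightarrow> j \<in> I \<Longrightarrow> i \<noteq> j \<Longrightarrow> q i j * q j i = 1"
    and sq: "\<And>i. i \<in> I \<Longrightarrow> q i i = -1"
    and u: "set u \<subseteq> I" "\<not> distinct u"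
  shows "skew_ders q u f = (\<lambda>v. 0)"
proof -
  have *: "skew_der q i (skew_ders q u g) = (\<lambda>v. 0)" if "set u \<subseteq> I" "i \<in> set u" for i u g
    using that
  proof (induction u)
    case (Cons j u)
    show ?case
    proof (cases "i = j")
      case True then show ?thesis using sq Cons by (simp add: skew_der_twice)
    next
      case False
      then have "skew_der q i (skew_ders q u g) = (\<lambda>v. 0)" using Cons by simp
      then show ?thesis
        using Cons False skew_der_commute[of q i j "skew_ders q u g"] comm[of i j]
          skew_ders_zero[of q "[j]"] by auto
    qed
  qed simp
  from u show ?thesis
  proof (induction u)
    case (Cons i u)
    show ?case
    proof (cases "i \<in> set u")
      case True then show ?thesis using * Cons by simp
    next
      case False
      then have "skew_ders q u f = (\<lambda>v. 0)" using Cons by simp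
      then show ?thesis using skew_ders_zero[of q "[i]"] by simp
    qed
  qed simp
qed

subsection \<open>Nonvanishing chains of derivations\<close>

text \<open>Right multiplication by the letter \<open>x\<^sub>j\<close>.\<close>

definition append_letter :: "'i \<Rightarrow> ('i list \<Rightarrow> complex) \<Rightarrow> 'i list \<Rightarrow> complex"
  where "append_letter j f u = (if u \<noteq> [] \<and> last u = j then f (butlast u) else 0)"

definition empty_word :: "'i list \<Rightarrow> complex"
  where "empty_word u = (if u = [] then 1 else 0)"

lemma skew_der_append_letter:
  "skew_der q i (append_letter j f) =
    (\<lambda>u. (if i = j then f u else 0) + q i j * append_letter j (skew_der q i f) u)"
proof
  fix u
  show "skew_der q i (append_letter j f) u =
    (if i = j then f u else 0) + q i j * append_letter j (skew_der q i f) u"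
  proof (cases u rule: rev_cases)
    case (snoc w l)
    have "strip l (append_letter j f) = (\<lambda>w. (if l = j then 1 else 0) * f w)"
      by (auto simp: append_letter_def)
    then show ?thesis unfolding snoc skew_der_snoc
      by (auto simp: append_letter_def skew_der_scale butlast_append)
  qed (auto simp: append_letter_def)
qed

lemma append_letter_add:
  "append_letter j (\<lambda>v. f v + g v) = (\<lambda>v. append_letter j f v + append_letter j g v)"
  and append_letter_scale:
  "append_letter j (\<lambda>v. c * f v) = (\<lambda>v. c * append_letter j f v)"
  and append_letter_diff:
  "append_letter j (\<lambda>v. f v - g v) = (\<lambda>v. append_letter j f v - append_letter j g v)"
  and append_letter_uminus: "append_letter j (\<lambda>v. - f v) = (\<lambda>v. - append_letter j f v)"
  and append_letter_zero: "append_letter j (\<lambda>v. 0) = (\<lambda>v. 0)"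
  by (auto simp: append_letter_def)

lemma skew_der_zero: "skew_der q i (\<lambda>v. 0) = (\<lambda>v. 0)"
  using skew_der_scale[of q i 0 "\<lambda>v. 0"] by simp

lemma skew_der_empty_word: "skew_der q i empty_word = (\<lambda>u. 0)"
proof
  fix u :: "'a list"
  have "strip j empty_word = (\<lambda>u :: 'a list. 0)" for j by (auto simp: empty_word_def)
  then show "skew_der q i empty_word u = 0"
    by (cases u rule: rev_cases) (auto simp: skew_der_snoc skew_der_zero empty_word_def)
qed

lemma skew_der_power:
  assumes "q i i = 1"
  shows "skew_der q i ((append_letter i ^^ Suc k) empty_word) =
    (\<lambda>u. of_nat (Suc k) * (append_letter i ^^ k) empty_word u)"
proof (induction k)
  case 0
  then show ?case using assms
    by (simp add: skew_der_append_letter skew_der_empty_word append_letter_zero)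
next
  case (Suc k)
  have "skew_der q i ((append_letter i ^^ Suc (Suc k)) empty_word) = (\<lambda>u.
      (append_letter i ^^ Suc k) empty_word u +
      append_letter i (skew_der q i ((append_letter i ^^ Suc k) empty_word)) u)"
    using assms by (subst funpow.simps(2)) (simp add: skew_der_append_letter del: funpow.simps)
  also have "\<dots> = (\<lambda>u. of_nat (Suc (Suc k)) * (append_letter i ^^ Suc k) empty_word u)"
    unfolding Suc append_letter_scale by (simp add: algebra_simps)
  finally show ?case .
qed

lemma skew_ders_power:
  assumes "q i i = 1"
  shows "skew_ders q (replicate k i) ((append_letter i ^^ k) empty_word) [] = fact k"
proof -
  have "skew_ders q (replicate k i) ((append_letter i ^^ k) empty_word) = (\<lambda>u. fact k * empty_word u)"
  proof (induction k)
    case (Suc k)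
    have "skew_ders q (replicate (Suc k) i) ((append_letter i ^^ Suc k) empty_word) =
      skew_ders q (replicate k i) (skew_der q i ((append_letter i ^^ Suc k) empty_word))"
      by (simp only: replicate_append_same[symmetric] replicate.simps foldr_append foldr.simps
          comp_def id_apply)
    also have "\<dots> = (\<lambda>u. fact (Suc k) * empty_word u)"
      unfolding skew_der_power[of q, OF assms] skew_ders_scale Suc by (simp add: algebra_simps)
    finally show ?case .
  qed simp
  then show ?thesis by (simp add: empty_word_def)
qed

text \<open>Right multiplication by \<open>[[x\<^sub>i, x\<^sub>j], x\<^sub>l]\<close>, with \<open>[x\<^sub>i, x\<^sub>j] = x\<^sub>i x\<^sub>j - e x\<^sub>j x\<^sub>i\<close> and
  \<open>[y, x\<^sub>l] = y x\<^sub>l + x\<^sub>l y\<close>. The scalars \<open>e\<close> and \<open>-1\<close> are those of the braidings of \<open>x\<^sub>i\<close> with \<open>x\<^sub>j\<close>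
  and of \<open>x\<^sub>i x\<^sub>j\<close> with \<open>x\<^sub>l\<close> in the locale \<open>triangle\<close> below, so that these are braided commutators.\<close>

definition append_nested_comm :: "complex \<Rightarrow> 'i \<Rightarrow> 'i \<Rightarrow> 'i \<Rightarrow> ('i list \<Rightarrow> complex) \<Rightarrow> 'i list \<Rightarrow> complex"
  where "append_nested_comm e i j l f = (\<lambda>u.
     append_letter l (append_letter j (append_letter i f)) u
     - e * append_letter l (append_letter i (append_letter j f)) u
     + append_letter j (append_letter i (append_letter l f)) u
     - e * append_letter i (append_letter j (append_letter l f)) u)"

text \<open>Right multiplication by the braided commutator \<open>[x\<^sub>i, x\<^sub>l] = x\<^sub>i x\<^sub>l + e x\<^sub>l x\<^sub>i\<close>.\<close>

definition append_comm :: "complex \<Rightarrow> 'i \<Rightarrow> 'i \<Rightarrow> ('i list \<Rightarrow> complex) \<Rightarrow> 'i list \<Rightarrow> complex"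
  where "append_comm e i l f = (\<lambda>u.
     append_letter l (append_letter i f) u + e * append_letter i (append_letter l f) u)"

text \<open>Three vertices of a diagonal braiding with \<open>q\<^bsub>k,k\<^esub> = -1\<close> that are pairwise linked by
  \<open>q\<^bsub>k,l\<^esub> q\<^bsub>l,k\<^esub> = -1\<close>, with the same sign \<open>e\<close> in one cyclic direction. The product of the coefficients
  of each letter with \<open>x\<^sub>i x\<^sub>j x\<^sub>l\<close> is then 1.\<close>

locale triangle =
  fixes q :: "'i \<Rightarrow> 'i \<Rightarrow> complex" and e :: complex and i j l :: 'i
  assumes dist: "i \<noteq> j" "i \<noteq> l" "j \<noteq> l" and e: "e * e = 1"
    and q: "q i i = -1" "q j j = -1" "q l l = -1" "q i j = e" "q j l = e" "q l i = e"
      "q j i = -e" "q l j = -e" "q i l = -e"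
begin

lemma e2: "e * (e * x) = x" using e by (simp flip: mult.assoc)

lemmas append_simps = append_letter_uminus append_letter_add append_letter_diff append_letter_scale append_letter_zero
  skew_der_add skew_der_diff skew_der_scale

text \<open>Write \<open>z = [[x\<^sub>i, x\<^sub>j], x\<^sub>l]\<close>. Each derivation passes \<open>z\<close> with coefficient \<open>q\<^bsub>k,i\<^esub> q\<^bsub>k,j\<^esub> q\<^bsub>k,l\<^esub> = 1\<close>,
  and of the values at \<open>z\<close> itself only \<open>D\<^sub>j z = 2 e [x\<^sub>i, x\<^sub>l]\<close> is nonzero.\<close>

lemma skew_der_append_nested_comm:
  "skew_der q i (append_nested_comm e i j l f) = append_nested_comm e i j l (skew_der q i f)"
  "skew_der q l (append_nested_comm e i j l f) = append_nested_comm e i j l (skew_der q l f)"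
  "skew_der q j (append_nested_comm e i j l f) =
     (\<lambda>u. append_nested_comm e i j l (skew_der q j f) u + 2 * e * append_comm e i l f u)"
  unfolding append_nested_comm_def append_comm_def
  by (simp_all add: skew_der_append_letter append_simps q dist dist[symmetric])
    (simp_all add: append_simps fun_eq_iff e e2 algebra_simps)

lemma skew_der_append_comm:
  assumes "skew_der q l f = (\<lambda>u. 0)"
  shows "skew_der q l (append_comm e i l f) = (\<lambda>u. 2 * append_letter i f u)"
  unfolding append_comm_def
  by (simp add: skew_der_append_letter append_simps q dist dist[symmetric] assms)
    (simp add: append_simps fun_eq_iff e e2 algebra_simps)

lemma append_nested_comm_scale: "append_nested_comm e i j l (\<lambda>u. c * f u) = (\<lambda>u. c * append_nested_comm e i j l f u)"
  unfolding append_nested_comm_def by (simp add: append_simps algebra_simps)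

abbreviation "nested_comm_power k \<equiv> (append_nested_comm e i j l ^^ k) empty_word"

lemma skew_der_nested_comm_power:
  "skew_der q i (nested_comm_power k) = (\<lambda>u. 0)" "skew_der q l (nested_comm_power k) = (\<lambda>u. 0)"
proof -
  have 0: "append_nested_comm e i j l (\<lambda>u. 0) = (\<lambda>u. 0)"
    unfolding append_nested_comm_def by (simp add: append_simps)
  show "skew_der q i (nested_comm_power k) = (\<lambda>u. 0)" "skew_der q l (nested_comm_power k) = (\<lambda>u. 0)"
    by (induction k) (simp_all add: skew_der_append_nested_comm skew_der_empty_word 0)
qed

text \<open>A chain of derivations along the unique path \<open>z \<mapsto> [x\<^sub>i, x\<^sub>l] \<mapsto> x\<^sub>i \<mapsto> 1\<close>. Since \<open>D\<^sub>i\<close> and \<open>D\<^sub>l\<close> kill the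
  powers of \<open>z\<close>, the three derivations have to hit the same factor \<open>z\<close>, and each factor contributes
  \<open>4 e\<close>.\<close>

lemma skew_ders_nested_comm_power:
  "skew_ders q [i, l, j] (nested_comm_power (Suc k)) = (\<lambda>u. 4 * e * of_nat (Suc k) * nested_comm_power k u)"
proof -
  have *: "skew_ders q [i, l, j] (nested_comm_power (Suc k)) =
      (\<lambda>u. append_nested_comm e i j l (skew_ders q [i, l, j] (nested_comm_power k)) u + 4 * e * nested_comm_power k u)" for k
    by (simp add: skew_der_append_nested_comm skew_der_append_comm skew_der_nested_comm_power append_simps
        skew_der_append_letter q append_letter_zero mult.assoc)
  show ?thesis
  proof (induction k)
    case 0
    have "append_nested_comm e i j l (\<lambda>u. 0) = (\<lambda>u. 0)"
      using append_nested_comm_scale[of 0 "\<lambda>u. 0"] by simp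
    then show ?case unfolding * by (simp add: skew_der_empty_word skew_der_zero)
  next
    case (Suc k)
    show ?case unfolding *[of "Suc k"] Suc append_nested_comm_scale by (simp add: algebra_simps)
  qed
qed

lemma skew_ders_nested_comm_power_neq_0:
  "skew_ders q (concat (replicate k [i, l, j])) (nested_comm_power k) [] \<noteq> 0"
proof -
  have "\<exists>c. c \<noteq> 0 \<and> skew_ders q (concat (replicate k [i, l, j])) (nested_comm_power k) = (\<lambda>u. c * empty_word u)"
  proof (induction k)
    case 0 show ?case by (auto intro: exI[of _ 1])
  next
    case (Suc k)
    then obtain c where c: "c \<noteq> 0"
      "skew_ders q (concat (replicate k [i, l, j])) (nested_comm_power k) = (\<lambda>u. c * empty_word u)" by blast
    have "concat (replicate (Suc k) [i, l, j]) = concat (replicate k [i, l, j]) @ [i, l, j]"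
      by (simp only: replicate_append_same[symmetric] replicate.simps concat_append concat.simps
          append_Nil2)
    then have "skew_ders q (concat (replicate (Suc k) [i, l, j])) (nested_comm_power (Suc k)) =
        (\<lambda>u. (4 * e * of_nat (Suc k) * c) * empty_word u)"
      using skew_ders_nested_comm_power[of k] c(2)
      by (simp add: skew_ders_scale mult.assoc del: replicate.simps funpow.simps of_nat_Suc)
    moreover have "4 * e * of_nat (Suc k) * c \<noteq> 0"
      using c(1) e of_nat_neq_0[of k, where ?'a = complex] by (auto simp del: of_nat_Suc)
    ultimately show ?case by blast
  qed
  then show ?thesis by (auto simp: empty_word_def)
qed

end

section \<open>The free algebra\<close>

lemma free_algebra_simps:
  "t \<in> carrier (free_algebra M) \<longleftrightarrow> finite {w. t w \<noteq> 0} \<and> (\<forall>w. t w \<noteq> 0 \<longrightarrow> set w \<subseteq> carrier M)"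
  "s \<oplus>\<^bsub>free_algebra M\<^esub> t = (\<lambda>w. s w + t w)"
  "c \<odot>\<^bsub>free_algebra M\<^esub> t = (\<lambda>w. c * t w)"
  "\<zero>\<^bsub>free_algebra M\<^esub> = (\<lambda>w. 0)"
  by (simp_all add: free_algebra_def)

lemma free_algebraD:
  assumes "t \<in> carrier (free_algebra M)"
  shows "finite {w. t w \<noteq> 0}" and "t w \<noteq> 0 \<Longrightarrow> set w \<subseteq> carrier M"
  using assms by (simp_all add: free_algebra_simps(1))

lemma free_algebra_add_closed:
  assumes "s \<in> carrier (free_algebra M)" "t \<in> carrier (free_algebra M)"
  shows "(\<lambda>w. s w + t w) \<in> carrier (free_algebra M)"
proof -
  have "{w. s w + t w \<noteq> 0} \<subseteq> {w. s w \<noteq> 0} \<union> {w. t w \<noteq> 0}" by auto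
  then show ?thesis using assms unfolding free_algebra_simps(1)
    by (metis (mono_tags, lifting) add.right_neutral finite_Un finite_subset)
qed

lemma free_algebra_scale_closed:
  "t \<in> carrier (free_algebra M) \<Longrightarrow> (\<lambda>w. c * t w) \<in> carrier (free_algebra M)"
  by (auto simp: free_algebra_simps(1) elim: rev_finite_subset)

lemma free_algebra_diff_closed:
  assumes "s \<in> carrier (free_algebra M)" "t \<in> carrier (free_algebra M)"
  shows "(\<lambda>w. s w - t w) \<in> carrier (free_algebra M)"
  using free_algebra_add_closed[OF assms(1) free_algebra_scale_closed[OF assms(2), of "-1"]] by simp

lemma vectorspace_free_algebra: "vectorspace \<complex>\<^sub>F (free_algebra M)"
  by (rule complex_vs_criteria)
    (auto simp: free_algebra_add_closed free_algebra_scale_closed free_algebra_simps(2-)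
      algebra_simps, simp_all add: free_algebra_simps(1))

lemma free_algebra_minus:
  assumes "s \<in> carrier (free_algebra M)" "t \<in> carrier (free_algebra M)"
  shows "s \<ominus>\<^bsub>free_algebra M\<^esub> t = (\<lambda>w. s w - t w)"
  using a_minus_smult[OF vectorspace_free_algebra assms] by (simp add: free_algebra_simps)

lemma free_algebra_sum_closed:
  assumes "\<And>w. w \<in> S \<Longrightarrow> f w \<in> carrier (free_algebra M)"
  shows "(\<lambda>z. \<Sum>w\<in>S. c w * f w z) \<in> carrier (free_algebra M)"
  using assms
proof (induction S rule: infinite_finite_induct)
  case (insert x S)
  then show ?case
    using free_algebra_add_closed[OF free_algebra_scale_closed[of "f x" M "c x"], of
        "\<lambda>z. \<Sum>w\<in>S. c w * f w z"] by simp
qed (simp_all add: free_algebra_simps(1))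

lemma word_closed: "set w \<subseteq> carrier M \<Longrightarrow> word w \<in> carrier (free_algebra M)"
  by (simp add: word_def free_algebra_simps(1))

lemma word_support: "{u. word w u \<noteq> 0} = {w}" by (auto simp: word_def)

lemma linear_extension_closed:
  assumes "t \<in> carrier (free_algebra M)"
    and "\<And>w. set w \<subseteq> carrier M \<Longrightarrow> \<phi> w \<in> carrier (free_algebra M)"
  shows "linear_extension \<phi> t \<in> carrier (free_algebra M)"
  unfolding linear_extension_def using assms
  by (intro free_algebra_sum_closed) (use free_algebraD(2) in blast)

lemma linear_extension_superset:
  assumes "finite S" "{w. t w \<noteq> 0} \<subseteq> S"
  shows "linear_extension \<phi> t z = (\<Sum>w\<in>S. t w * \<phi> w z)"
  unfolding linear_extension_def by (rule sum.mono_neutral_left) (use assms in auto)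

lemma linear_extension_add:
  assumes "s \<in> carrier (free_algebra M)" "t \<in> carrier (free_algebra M)"
  shows "linear_extension \<phi> (\<lambda>w. s w + t w) = (\<lambda>z. linear_extension \<phi> s z + linear_extension \<phi> t z)"
proof
  fix z
  define S where "S = {w. s w \<noteq> 0} \<union> {w. t w \<noteq> 0}"
  have S: "finite S" using assms by (simp add: S_def free_algebra_simps(1))
  show "linear_extension \<phi> (\<lambda>w. s w + t w) z = linear_extension \<phi> s z + linear_extension \<phi> t z"
    by (subst (1 2 3) linear_extension_superset[OF S])
      (auto simp: S_def sum.distrib algebra_simps)
qed

lemma linear_extension_scale:
  "linear_extension \<phi> (\<lambda>w. c * t w) = (\<lambda>z. c * linear_extension \<phi> t z)"
  by (cases "c = 0") (simp_all add: linear_extension_def sum_distrib_left mult.assoc)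

lemma linear_map_linear_extension:
  assumes "\<And>w. set w \<subseteq> carrier M \<Longrightarrow> \<phi> w \<in> carrier (free_algebra M)"
  shows "linear_map \<complex>\<^sub>F (free_algebra M) (free_algebra M) (linear_extension \<phi>)"
  by (rule linear_mapI)
    (auto simp: vectorspace_free_algebra linear_extension_closed assms linear_extension_add
      linear_extension_scale free_algebra_simps(2-))

section \<open>Nichols algebras of diagonal braidings\<close>

subsection \<open>Coordinates of tensors\<close>

text \<open>The value of the tensor product of the functionals \<open>\<xi>\<close> along \<open>u\<close> at a word; functionals of degree
  \<open>k\<close> are zero on words of any other length.\<close>

fun pairing :: "('i \<Rightarrow> 'm \<Rightarrow> complex) \<Rightarrow> 'i list \<Rightarrow> 'm list \<Rightarrow> complex" where
  "pairing \<xi> [] [] = 1"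
| "pairing \<xi> (i # u) (x # w) = \<xi> i x * pairing \<xi> u w"
| "pairing \<xi> _ _ = 0"

lemma pairing_append:
  "length u = length w \<Longrightarrow> pairing \<xi> (u @ u') (w @ w') = pairing \<xi> u w * pairing \<xi> u' w'"
  by (induction \<xi> u w rule: pairing.induct) auto

lemma pairing_length: "length u \<noteq> length w \<Longrightarrow> pairing \<xi> u w = 0"
  by (induction \<xi> u w rule: pairing.induct) auto

text \<open>The linear extension of the pairing. For functionals that form a coordinate system this is the
  coefficient function of a tensor in the corresponding basis of \<open>T(M)\<close>.\<close>

definition coords ::
  "('i \<Rightarrow> 'm \<Rightarrow> complex) \<Rightarrow> ('m list \<Rightarrow> complex) \<Rightarrow> 'i list \<Rightarrow> complex"
  where "coords \<xi> t u = (\<Sum>w | t w \<noteq> 0. t w * pairing \<xi> u w)"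

lemma coords_superset:
  assumes "finite S" "{w. t w \<noteq> 0} \<subseteq> S"
  shows "coords \<xi> t u = (\<Sum>w\<in>S. t w * pairing \<xi> u w)"
  unfolding coords_def by (rule sum.mono_neutral_left) (use assms in auto)

lemma coords_scale: "coords \<xi> (\<lambda>w. c * t w) = (\<lambda>u. c * coords \<xi> t u)"
  by (cases "c = 0") (simp_all add: fun_eq_iff coords_def sum_distrib_left mult.assoc)

lemma coords_add:
  assumes "s \<in> carrier (free_algebra M)" "t \<in> carrier (free_algebra M)"
  shows "coords \<xi> (\<lambda>w. s w + t w) = (\<lambda>u. coords \<xi> s u + coords \<xi> t u)"
proof
  fix u
  define S where "S = {w. s w \<noteq> 0} \<union> {w. t w \<noteq> 0}"
  have S: "finite S" using assms by (simp add: S_def free_algebra_simps(1))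
  show "coords \<xi> (\<lambda>w. s w + t w) u = coords \<xi> s u + coords \<xi> t u"
    by (subst (1 2 3) coords_superset[OF S])
      (auto simp: S_def sum.distrib algebra_simps)
qed

lemma coords_diff:
  assumes "s \<in> carrier (free_algebra M)" "t \<in> carrier (free_algebra M)"
  shows "coords \<xi> (\<lambda>w. s w - t w) = (\<lambda>u. coords \<xi> s u - coords \<xi> t u)"
  using coords_add[OF assms(1) free_algebra_scale_closed[OF assms(2), of "-1"], of \<xi>]
    coords_scale[of \<xi> "-1" t] by (simp add: fun_eq_iff)

lemma coords_sum:
  assumes "\<And>w. w \<in> S \<Longrightarrow> f w \<in> carrier (free_algebra M)"
  shows "coords \<xi> (\<lambda>z. \<Sum>w\<in>S. c w * f w z) u = (\<Sum>w\<in>S. c w * coords \<xi> (f w) u)"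
  using assms
proof (induction S rule: infinite_finite_induct)
  case (insert x S)
  then show ?case
    using coords_add[OF free_algebra_scale_closed[of "f x" M "c x"]
        free_algebra_sum_closed[of S f M c], of \<xi>] by (simp add: coords_scale)
qed (simp_all add: coords_def)

lemma coords_word: "coords \<xi> (word w) u = pairing \<xi> u w"
  unfolding coords_def word_support by (simp add: word_def)

lemma coords_linear_extension:
  assumes "t \<in> carrier (free_algebra M)"
    and "\<And>w. set w \<subseteq> carrier M \<Longrightarrow> \<phi> w \<in> carrier (free_algebra M)"
  shows "coords \<xi> (linear_extension \<phi> t) u = (\<Sum>w | t w \<noteq> 0. t w * coords \<xi> (\<phi> w) u)"
  unfolding linear_extension_def
  by (rule coords_sum) (use assms in \<open>auto simp: free_algebra_simps(1)\<close>)

text \<open>Here \<open>\<xi>\<close> is a coordinate system of \<open>M\<close> with dual basis \<open>v\<close>. It is the functionals \<open>\<xi>\<close>, not the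
  vectors \<open>v\<close>, that are required to be eigenvectors: this is what lets the braiding be computed on
  arbitrary words, and it makes the linearity of the action and coaction automatic.\<close>

locale diagonal_braiding =
  fixes G :: "('g, 'x) monoid_scheme" and M :: "(complex, 'm) module"
    and act \<delta> :: "'g \<Rightarrow> 'm \<Rightarrow> 'm"
    and I :: "'i set" and \<xi> :: "'i \<Rightarrow> 'm \<Rightarrow> complex" and v :: "'i \<Rightarrow> 'm"
    and gr :: "'i \<Rightarrow> 'g" and q :: "'i \<Rightarrow> 'i \<Rightarrow> complex"
  assumes M: "vectorspace \<complex>\<^sub>F M" and finite_G: "finite (carrier G)" and finite_I: "finite I"
    and act_closed: "\<And>g x. g \<in> carrier G \<Longrightarrow> x \<in> carrier M \<Longrightarrow> act g x \<in> carrier M"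
    and coact_closed: "\<And>g x. g \<in> carrier G \<Longrightarrow> x \<in> carrier M \<Longrightarrow> \<delta> g x \<in> carrier M"
    and v_closed: "\<And>i. i \<in> I \<Longrightarrow> v i \<in> carrier M"
    and coord_add: "\<And>i x y. i \<in> I \<Longrightarrow> x \<in> carrier M \<Longrightarrow> y \<in> carrier M \<Longrightarrow> \<xi> i (x \<oplus>\<^bsub>M\<^esub> y) = \<xi> i x + \<xi> i y"
    and coord_smult: "\<And>i c x. i \<in> I \<Longrightarrow> x \<in> carrier M \<Longrightarrow> \<xi> i (c \<odot>\<^bsub>M\<^esub> x) = c * \<xi> i x"
    and dual: "\<And>i j. i \<in> I \<Longrightarrow> j \<in> I \<Longrightarrow> \<xi> i (v j) = (if i = j then 1 else 0)"
    and separates: "\<And>x. x \<in> carrier M \<Longrightarrow> (\<And>i. i \<in> I \<Longrightarrow> \<xi> i x = 0) \<Longrightarrow> x = \<zero>\<^bsub>M\<^esub>"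
    and gr_closed: "\<And>i. i \<in> I \<Longrightarrow> gr i \<in> carrier G"
    and coord_coact: "\<And>i g x. i \<in> I \<Longrightarrow> g \<in> carrier G \<Longrightarrow> x \<in> carrier M \<Longrightarrow>
           \<xi> i (\<delta> g x) = (if g = gr i then \<xi> i x else 0)"
    and coord_act: "\<And>i j x. i \<in> I \<Longrightarrow> j \<in> I \<Longrightarrow> x \<in> carrier M \<Longrightarrow> \<xi> j (act (gr i) x) = q i j * \<xi> j x"
begin

sublocale vectorspace "\<complex>\<^sub>F :: complex ring" M by (rule M)

abbreviation "F \<equiv> free_algebra M"
abbreviation "R \<equiv> multilinear_relations M"
abbreviation "co \<equiv> coords \<xi>"

lemma braid_word_closed: "set w \<subseteq> carrier M \<Longrightarrow> braid_word G act \<delta> k w \<in> carrier F"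
proof (cases "Suc k < length w")
  case True
  assume w: "set w \<subseteq> carrier M"
  have "act g (w ! Suc k) \<in> carrier M" "\<delta> g (w ! k) \<in> carrier M" if "g \<in> carrier G" for g
    using w True that by (auto intro!: act_closed coact_closed)
  then have "(\<lambda>z. \<Sum>g\<in>carrier G. 1 *
            word (take k w @ [act g (w ! Suc k), \<delta> g (w ! k)] @ drop (Suc (Suc k)) w) z) \<in> carrier F"
    using w by (intro free_algebra_sum_closed word_closed)
      (auto dest: in_set_takeD in_set_dropD)
  then show ?thesis using True by (simp add: braid_word_def)
qed (simp add: braid_word_def word_closed)

lemma braid_closed: "t \<in> carrier F \<Longrightarrow> braid G act \<delta> k t \<in> carrier F"
  unfolding braid_def by (intro linear_extension_closed braid_word_closed)

lemma braid_sum_closed: "t \<in> carrier F \<Longrightarrow> braid_sum G act \<delta> k t \<in> carrier F"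
  by (induction k) (auto intro: free_algebra_add_closed braid_closed)

lemma quantum_symmetrizer_closed: "t \<in> carrier F \<Longrightarrow> quantum_symmetrizer G act \<delta> k t \<in> carrier F"
  by (induction k arbitrary: t) (auto intro: braid_sum_closed)

lemma total_symmetrizer_closed: "t \<in> carrier F \<Longrightarrow> total_symmetrizer G act \<delta> t \<in> carrier F"
  unfolding total_symmetrizer_def
  by (intro linear_extension_closed quantum_symmetrizer_closed word_closed)

subsection \<open>Quantum symmetrizers in coordinates\<close>

lemma co_braid_word:
  assumes w: "set w \<subseteq> carrier M" and u: "a \<in> I" "b \<in> I" "length u1 = k"
  shows "co (braid_word G act \<delta> k w) (u1 @ [a, b] @ u2) = q b a * pairing \<xi> (u1 @ [b, a] @ u2) w"
proof (cases "length w = length (u1 @ [b, a] @ u2)")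
  case True
  define w1 w2 x y where "w1 = take k w" "w2 = drop (Suc (Suc k)) w" "x = w ! k" "y = w ! Suc k"
  have k: "Suc k < length w" using True u by simp
  have "drop k w = [x, y] @ w2"
    using k by (simp add: w1_w2_x_y_def Cons_nth_drop_Suc)
  then have w_eq: "w = w1 @ [x, y] @ w2"
    using append_take_drop_id[of k w] by (simp add: w1_w2_x_y_def)
  have len: "length w1 = k" using k by (simp add: w1_w2_x_y_def)
  have xy: "x \<in> carrier M" "y \<in> carrier M" using w unfolding w_eq by auto
  have *: "word (w1 @ [act g y, \<delta> g x] @ w2) \<in> carrier F" if "g \<in> carrier G" for g
    using w that xy act_closed coact_closed unfolding w_eq by (intro word_closed) auto
  (* The factor 1 brings the sum into the form of a linear combination, for coords_sum. *)
  have "co (braid_word G act \<delta> k w) (u1 @ [a, b] @ u2) =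
      co (\<lambda>z. \<Sum>g\<in>carrier G. 1 * word (w1 @ [act g y, \<delta> g x] @ w2) z) (u1 @ [a, b] @ u2)"
    using k by (simp add: braid_word_def w1_w2_x_y_def)
  also have "\<dots> = (\<Sum>g\<in>carrier G. 1 * co (word (w1 @ [act g y, \<delta> g x] @ w2)) (u1 @ [a, b] @ u2))"
    by (rule coords_sum[OF *])
  also have "\<dots> = (\<Sum>g\<in>carrier G. if g = gr b then
      pairing \<xi> u1 w1 * \<xi> a (act g y) * \<xi> b x * pairing \<xi> u2 w2 else 0)"
    using u len xy by (intro sum.cong) (simp_all add: coords_word pairing_append coord_coact)
  also have "\<dots> = pairing \<xi> u1 w1 * \<xi> a (act (gr b) y) * \<xi> b x * pairing \<xi> u2 w2"
    using gr_closed[OF u(2)] finite_G by simp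
  also have "\<dots> = q b a * pairing \<xi> (u1 @ [b, a] @ u2) w"
    unfolding w_eq using len u xy by (simp add: pairing_append coord_act)
  finally show ?thesis .
next
  case False
  have "co (braid_word G act \<delta> k w) (u1 @ [a, b] @ u2) = 0"
  proof (cases "Suc k < length w")
    case True
    have *: "word (take k w @ [act g (w ! Suc k), \<delta> g (w ! k)] @ drop (Suc (Suc k)) w) \<in> carrier F"
      if "g \<in> carrier G" for g
    proof -
      have "act g (w ! Suc k) \<in> carrier M" "\<delta> g (w ! k) \<in> carrier M"
        using w True that by (auto intro!: act_closed coact_closed)
      then show ?thesis using w by (intro word_closed) (auto dest: in_set_takeD in_set_dropD)
    qed
    have "co (braid_word G act \<delta> k w) (u1 @ [a, b] @ u2) =
      (\<Sum>g\<in>carrier G. 1 * co (word (take k w @ [act g (w ! Suc k), \<delta> g (w ! k)] @ drop (Suc (Suc k)) w)) (u1 @ [a, b] @ u2))"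
      using True coords_sum[OF *, of "carrier G" "\<lambda>g. g" \<xi> "\<lambda>_. 1"] by (simp add: braid_word_def)
    also have "\<dots> = 0" using False True by (intro sum.neutral) (auto simp: coords_word pairing_length)
    finally show ?thesis .
  qed (use False in \<open>simp add: braid_word_def coords_word pairing_length\<close>)
  then show ?thesis using False by (simp add: pairing_length)
qed

lemma co_braid:
  assumes "t \<in> carrier F" "a \<in> I" "b \<in> I" "length u1 = k"
  shows "co (braid G act \<delta> k t) (u1 @ [a, b] @ u2) = q b a * co t (u1 @ [b, a] @ u2)"
proof -
  have "co (braid G act \<delta> k t) (u1 @ [a, b] @ u2)
      = (\<Sum>w | t w \<noteq> 0. t w * (q b a * pairing \<xi> (u1 @ [b, a] @ u2) w))"
    unfolding braid_def
    by (subst coords_linear_extension[OF assms(1) braid_word_closed])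
      (use assms(2-) co_braid_word free_algebraD(2)[OF assms(1)] in \<open>auto intro!: sum.cong\<close>)
  then show ?thesis by (simp add: coords_def sum_distrib_left algebra_simps)
qed

text \<open>The braid sum moves each letter in turn to position \<open>k\<close>; reading off the coefficient of words with
  \<open>i\<close> at that position is therefore \<open>D\<^sub>i\<close>, acting on the first part of the word.\<close>

lemma co_braid_sum:
  assumes "t \<in> carrier F" "set u \<subseteq> I" "i \<in> I" "length u = k"
  shows "co (braid_sum G act \<delta> k t) (u @ i # s) = skew_der q i (\<lambda>w. co t (w @ s)) u"
  using assms(2-)
proof (induction k arbitrary: u s)
  case (Suc k)
  then obtain u' j where u: "u = u' @ [j]" by (metis length_Suc_conv_rev)
  have *: "co (\<lambda>z. t z + braid G act \<delta> k (braid_sum G act \<delta> k t) z) =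
      (\<lambda>u. co t u + co (braid G act \<delta> k (braid_sum G act \<delta> k t)) u)"
    by (rule coords_add[OF assms(1) braid_closed[OF braid_sum_closed[OF assms(1)]]])
  show ?case
    using Suc co_braid[OF braid_sum_closed[OF assms(1)], of j i u' _ _ s]
      Suc.IH[of u' "j # s"]
    by (simp add: * u skew_der_snoc)
qed simp

lemma co_quantum_symmetrizer:
  assumes "t \<in> carrier F" "set u \<subseteq> I" "set s \<subseteq> I" "length u = k"
  shows "co (quantum_symmetrizer G act \<delta> k t) (u @ s) = skew_ders q u (\<lambda>w. co t (w @ s)) []"
  using assms
proof (induction k arbitrary: u s t)
  case (Suc k)
  then obtain u' i where u: "u = u' @ [i]" by (metis length_Suc_conv_rev)
  have "co (quantum_symmetrizer G act \<delta> (Suc k) t) (u @ s)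
      = skew_ders q u' (\<lambda>w. co (braid_sum G act \<delta> k t) (w @ i # s)) []"
    using Suc.IH[of "braid_sum G act \<delta> k t" u' "i # s"] Suc.prems braid_sum_closed by (simp add: u)
  also have "\<dots> = skew_ders q u' (skew_der q i (\<lambda>w. co t (w @ s))) []"
    by (rule skew_ders_cong[where I = I]) (use Suc.prems in \<open>auto simp: u co_braid_sum\<close>)
  finally show ?case by (simp add: u)
qed simp

text \<open>Braidings keep the length of words. This is needed since a quantum symmetrizer of fixed index says
  nothing about coordinates at shorter words.\<close>

definition homogeneous :: "nat \<Rightarrow> ('m list \<Rightarrow> complex) \<Rightarrow> bool"
  where "homogeneous n t \<longleftrightarrow> (\<forall>w. t w \<noteq> 0 \<longrightarrow> length w = n)"

lemma homogeneous_sum: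
  assumes "\<And>w. w \<in> S \<Longrightarrow> homogeneous n (f w)"
  shows "homogeneous n (\<lambda>z. \<Sum>w\<in>S. c w * f w z)"
  using assms sum.neutral[of S] unfolding homogeneous_def by (metis (no_types, lifting) mult_zero_right)

lemma homogeneous_braid:
  assumes "homogeneous n t" shows "homogeneous n (braid G act \<delta> k t)"
  unfolding braid_def linear_extension_def
proof (rule homogeneous_sum)
  fix w assume "w \<in> {w. t w \<noteq> 0}"
  then have w: "length w = n" using assms by (simp add: homogeneous_def)
  show "homogeneous n (braid_word G act \<delta> k w)"
  proof (cases "Suc k < length w")
    case True
    have "homogeneous n (\<lambda>z. \<Sum>g\<in>carrier G. 1 *
        word (take k w @ [act g (w ! Suc k), \<delta> g (w ! k)] @ drop (Suc (Suc k)) w) z)"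
      by (rule homogeneous_sum) (use w True in \<open>auto simp: homogeneous_def word_def split: if_splits\<close>)
    then show ?thesis using True by (simp add: braid_word_def)
  qed (use w in \<open>auto simp: homogeneous_def word_def braid_word_def split: if_splits\<close>)
qed

lemma homogeneous_braid_sum: "homogeneous n t \<Longrightarrow> homogeneous n (braid_sum G act \<delta> k t)"
proof (induction k)
  case (Suc k)
  then have "homogeneous n (braid G act \<delta> k (braid_sum G act \<delta> k t))" by (intro homogeneous_braid)
  then show ?case using Suc.prems unfolding homogeneous_def braid_sum.simps
    by (metis add.right_neutral add.left_neutral)
qed simp

lemma homogeneous_quantum_symmetrizer:
  "homogeneous n t \<Longrightarrow> homogeneous n (quantum_symmetrizer G act \<delta> k t)"
  by (induction k arbitrary: t) (simp_all add: homogeneous_braid_sum)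

lemma co_homogeneous: "homogeneous n t \<Longrightarrow> length u \<noteq> n \<Longrightarrow> co t u = 0"
  unfolding coords_def homogeneous_def by (intro sum.neutral) (auto simp: pairing_length)

lemma co_total_symmetrizer:
  assumes t: "t \<in> carrier F" and u: "set u \<subseteq> I"
  shows "co (total_symmetrizer G act \<delta> t) u = skew_ders q u (co t) []"
proof -
  have 1: "co (quantum_symmetrizer G act \<delta> (length w) (word w)) u = skew_ders q u (co (word w)) []"
    if w: "set w \<subseteq> carrier M" for w
  proof (cases "length w = length u")
    case True
    then show ?thesis using co_quantum_symmetrizer[of "word w" u "[]"] u w by (simp add: word_closed)
  next
    case False
    have h: "homogeneous (length w) (word w)" by (auto simp: homogeneous_def word_def split: if_splits)
    have "skew_ders q u (co (word w)) [] = skew_ders q u (\<lambda>v. 0) []"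
      by (rule skew_ders_cong[where I = I]) (use u False in \<open>auto simp: coords_word pairing_length\<close>)
    also have "\<dots> = 0" by (simp add: skew_ders_zero)
    finally show ?thesis
      using co_homogeneous[OF homogeneous_quantum_symmetrizer[OF h], of u] False by simp
  qed
  have "co (total_symmetrizer G act \<delta> t) u =
      (\<Sum>w | t w \<noteq> 0. t w * skew_ders q u (co (word w)) [])"
    unfolding total_symmetrizer_def
    by (subst coords_linear_extension[OF t])
      (use 1 free_algebraD(2)[OF t] in \<open>auto intro!: sum.cong quantum_symmetrizer_closed word_closed\<close>)
  also have "\<dots> = skew_ders q u (\<lambda>u. \<Sum>w | t w \<noteq> 0. t w * co (word w) u) []"
    by (simp add: skew_ders_sum)
  also have "(\<lambda>u. \<Sum>w | t w \<noteq> 0. t w * co (word w) u) = co t"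
    by (intro ext) (simp add: coords_def coords_word[unfolded coords_def])
  finally show ?thesis .
qed

subsection \<open>The relations of the tensor algebra\<close>

text \<open>The spanning set of the multilinear relations, with the operations of the free algebra written out.\<close>

definition generators :: "('m list \<Rightarrow> complex) set"
  where "generators =
    {(\<lambda>z. word (u @ [x \<oplus>\<^bsub>M\<^esub> y] @ w) z - (word (u @ [x] @ w) z + word (u @ [y] @ w) z)) | u w x y.
       set u \<subseteq> carrier M \<and> set w \<subseteq> carrier M \<and> x \<in> carrier M \<and> y \<in> carrier M} \<union>
    {(\<lambda>z. word (u @ [c \<odot>\<^bsub>M\<^esub> x] @ w) z - c * word (u @ [x] @ w) z) | u w c x.
       set u \<subseteq> carrier M \<and> set w \<subseteq> carrier M \<and> x \<in> carrier M}"

lemma relations_span: "R = LinearCombinations.module.span \<complex>\<^sub>F F generators"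
proof -
  have 1: "word (u @ [x \<oplus>\<^bsub>M\<^esub> y] @ w) \<ominus>\<^bsub>F\<^esub> (word (u @ [x] @ w) \<oplus>\<^bsub>F\<^esub> word (u @ [y] @ w)) =
      (\<lambda>z. word (u @ [x \<oplus>\<^bsub>M\<^esub> y] @ w) z - (word (u @ [x] @ w) z + word (u @ [y] @ w) z))"
    if "set u \<subseteq> carrier M \<and> set w \<subseteq> carrier M \<and> x \<in> carrier M \<and> y \<in> carrier M" for u w x y
    using that by (subst free_algebra_minus) (simp_all add: word_closed free_algebra_add_closed free_algebra_simps(2-))
  have 2: "word (u @ [c \<odot>\<^bsub>M\<^esub> x] @ w) \<ominus>\<^bsub>F\<^esub> (c \<odot>\<^bsub>F\<^esub> word (u @ [x] @ w)) =
      (\<lambda>z. word (u @ [c \<odot>\<^bsub>M\<^esub> x] @ w) z - c * word (u @ [x] @ w) z)"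
    if "set u \<subseteq> carrier M \<and> set w \<subseteq> carrier M \<and> x \<in> carrier M" for u w c x
    using that by (subst free_algebra_minus) (simp_all add: word_closed free_algebra_scale_closed free_algebra_simps(2-))
  show ?thesis
    unfolding multilinear_relations_def generators_def by (simp only: 1 2 cong: rev_conj_cong)
qed

lemma generators_subset:
  assumes add: "\<And>u w x y. set u \<subseteq> carrier M \<Longrightarrow> set w \<subseteq> carrier M \<Longrightarrow> x \<in> carrier M \<Longrightarrow> y \<in> carrier M \<Longrightarrow>
      (\<lambda>z. word (u @ [x \<oplus>\<^bsub>M\<^esub> y] @ w) z - (word (u @ [x] @ w) z + word (u @ [y] @ w) z)) \<in> W"
    and smult: "\<And>u w c x. set u \<subseteq> carrier M \<Longrightarrow> set w \<subseteq> carrier M \<Longrightarrow> x \<in> carrier M \<Longrightarrow>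
      (\<lambda>z. word (u @ [c \<odot>\<^bsub>M\<^esub> x] @ w) z - c * word (u @ [x] @ w) z) \<in> W"
  shows "generators \<subseteq> W"
proof
  fix s assume "s \<in> generators"
  then show "s \<in> W" unfolding generators_def Un_iff mem_Collect_eq
  proof (elim disjE exE conjE)
    fix u w x y
    assume "s = (\<lambda>z. word (u @ [x \<oplus>\<^bsub>M\<^esub> y] @ w) z - (word (u @ [x] @ w) z + word (u @ [y] @ w) z))"
      and *: "set u \<subseteq> carrier M" "set w \<subseteq> carrier M" "x \<in> carrier M" "y \<in> carrier M"
    then show ?thesis using add[OF *] by (simp only:)
  next
    fix u w c x
    assume "s = (\<lambda>z. word (u @ [c \<odot>\<^bsub>M\<^esub> x] @ w) z - c * word (u @ [x] @ w) z)"
      and *: "set u \<subseteq> carrier M" "set w \<subseteq> carrier M" "x \<in> carrier M"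
    then show ?thesis using smult[OF *] by (simp only:)
  qed
qed

lemma generators_closed: "generators \<subseteq> carrier F"
  by (rule generators_subset)
    (rule free_algebra_diff_closed free_algebra_add_closed free_algebra_scale_closed word_closed | simp)+

lemma relations_subspace: "subspace \<complex>\<^sub>F R F"
  unfolding relations_span
  by (rule span_subspace[OF vectorspace_free_algebra generators_closed])

lemma generators_relations: "generators \<subseteq> R"
  unfolding relations_span
  by (rule span_subspace[OF vectorspace_free_algebra generators_closed])

lemma relation_add:
  assumes "set u \<subseteq> carrier M" "set w \<subseteq> carrier M" "x \<in> carrier M" "y \<in> carrier M"
  shows "(\<lambda>z. word (u @ [x \<oplus>\<^bsub>M\<^esub> y] @ w) z - (word (u @ [x] @ w) z + word (u @ [y] @ w) z)) \<in> R"
  by (rule subsetD[OF generators_relations], unfold generators_def, rule UnI1) (use assms in blast)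

lemma relation_smult:
  assumes "set u \<subseteq> carrier M" "set w \<subseteq> carrier M" "x \<in> carrier M"
  shows "(\<lambda>z. word (u @ [c \<odot>\<^bsub>M\<^esub> x] @ w) z - c * word (u @ [x] @ w) z) \<in> R"
  by (rule subsetD[OF generators_relations], unfold generators_def, rule UnI2) (use assms in blast)

lemma relations_closed:
  shows "r \<in> R \<Longrightarrow> r \<in> carrier F" "(\<lambda>z. 0) \<in> R"
    and "r \<in> R \<Longrightarrow> s \<in> R \<Longrightarrow> (\<lambda>z. r z + s z) \<in> R"
    and "r \<in> R \<Longrightarrow> (\<lambda>z. c * r z) \<in> R"
  using subspaceD[OF relations_subspace] by (auto simp: free_algebra_simps(2-))

lemma relations_sum: "(\<And>w. w \<in> S \<Longrightarrow> f w \<in> R) \<Longrightarrow> (\<lambda>z. \<Sum>w\<in>S. c w * f w z) \<in> R"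
proof (induction S rule: infinite_finite_induct)
  case (insert x S)
  then show ?case using relations_closed(3)[OF relations_closed(4)[of "f x" "c x"], of
        "\<lambda>z. \<Sum>w\<in>S. c w * f w z"] by simp
qed (use relations_closed(2) in simp_all)

lemma coord_zero: "i \<in> I \<Longrightarrow> \<xi> i \<zero>\<^bsub>M\<^esub> = 0"
  using coord_smult[of i "\<zero>\<^bsub>M\<^esub>" 0] by (simp add: lmult_0)

lemma pairing_add:
  assumes "set u \<subseteq> I" "x \<in> carrier M" "y \<in> carrier M"
  shows "pairing \<xi> u (a @ (x \<oplus>\<^bsub>M\<^esub> y) # b) = pairing \<xi> u (a @ x # b) + pairing \<xi> u (a @ y # b)"
  using assms(1)
proof (induction a arbitrary: u)
  case Nil then show ?case by (cases u) (auto simp: coord_add assms algebra_simps)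
next
  case (Cons c a) then show ?case by (cases u) (auto simp: algebra_simps)
qed

lemma pairing_smult:
  assumes "set u \<subseteq> I" "x \<in> carrier M"
  shows "pairing \<xi> u (a @ (c \<odot>\<^bsub>M\<^esub> x) # b) = c * pairing \<xi> u (a @ x # b)"
  using assms(1)
proof (induction a arbitrary: u)
  case Nil then show ?case by (cases u) (auto simp: coord_smult assms algebra_simps)
next
  case (Cons c a) then show ?case by (cases u) (auto simp: algebra_simps)
qed

lemma co_relations:
  assumes "r \<in> R" "set u \<subseteq> I"
  shows "co r u = 0"
proof -
  define W where "W = {t \<in> carrier F. \<forall>u. set u \<subseteq> I \<longrightarrow> co t u = 0}"
  have "subspace \<complex>\<^sub>F W F"
    by (rule subspaceI)
      (auto simp: W_def vectorspace_free_algebra free_algebra_simps(2-) coords_add coords_scale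
        free_algebra_add_closed free_algebra_scale_closed, simp_all add: coords_def free_algebra_simps(1))
  moreover have "generators \<subseteq> W"
  proof (rule generators_subset)
    fix a w x y assume *: "set a \<subseteq> carrier M" "set w \<subseteq> carrier M" "x \<in> carrier M" "y \<in> carrier M"
    let ?s = "\<lambda>z. word (a @ [x \<oplus>\<^bsub>M\<^esub> y] @ w) z - (word (a @ [x] @ w) z + word (a @ [y] @ w) z)"
    have "co ?s u = 0" if "set u \<subseteq> I" for u using * that
      by (subst coords_diff[of _ M])
        (simp_all add: word_closed free_algebra_add_closed coords_add[of _ M] coords_word pairing_add)
    moreover have "?s \<in> carrier F" using *
      by (intro free_algebra_diff_closed free_algebra_add_closed word_closed) simp_all
    ultimately show "?s \<in> W" by (simp only: W_def mem_Collect_eq) simp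
  next
    fix a w c x assume *: "set a \<subseteq> carrier M" "set w \<subseteq> carrier M" "x \<in> carrier M"
    let ?s = "\<lambda>z. word (a @ [c \<odot>\<^bsub>M\<^esub> x] @ w) z - c * word (a @ [x] @ w) z"
    have "co ?s u = 0" if "set u \<subseteq> I" for u using * that
      by (subst coords_diff[of _ M])
        (simp_all add: word_closed free_algebra_scale_closed coords_scale coords_word pairing_smult)
    moreover have "?s \<in> carrier F" using *
      by (intro free_algebra_diff_closed free_algebra_scale_closed word_closed) simp_all
    ultimately show "?s \<in> W" by (simp only: W_def mem_Collect_eq) simp
  qed
  ultimately have "R \<subseteq> W" unfolding relations_span by (rule span_least)
  then show ?thesis using assms by (auto simp: W_def)
qed

lemma coord_ext:
  assumes "x \<in> carrier M" "y \<in> carrier M" "\<And>i. i \<in> I \<Longrightarrow> \<xi> i x = \<xi> i y"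
  shows "x = y"
proof -
  have "x \<ominus>\<^bsub>M\<^esub> y = \<zero>\<^bsub>M\<^esub>"
    by (rule separates)
      (use assms in \<open>simp_all add: a_minus_smult[OF M] coord_add coord_smult\<close>)
  then show ?thesis using assms by simp
qed

text \<open>The sum \<open>\<Sum>i. \<xi>\<^sub>i(x) v\<^sub>i\<close> in \<open>M\<close> is built one summand at a time, together with the corresponding
  congruence; the final vector has the coordinates of \<open>x\<close> and so equals \<open>x\<close>.\<close>

lemma word_letter_expand:
  assumes x: "x \<in> carrier M" and P: "set P \<subseteq> carrier M" and w: "set w \<subseteq> carrier M"
  shows "(\<lambda>z. word (P @ [x] @ w) z - (\<Sum>i\<in>I. \<xi> i x * word (P @ [v i] @ w) z)) \<in> R"
proof -
  have "\<exists>y\<in>carrier M. (\<forall>i\<in>I. \<xi> i y = (if i \<in> J then \<xi> i x else 0)) \<and>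
      (\<lambda>z. word (P @ [y] @ w) z - (\<Sum>i\<in>J. \<xi> i x * word (P @ [v i] @ w) z)) \<in> R"
    if "finite J" "J \<subseteq> I" for J
    using that
  proof (induction J rule: finite_induct)
    case empty
    have "(\<lambda>z. word (P @ [0 \<odot>\<^bsub>M\<^esub> x] @ w) z - 0 * word (P @ [x] @ w) z) \<in> R"
      using relation_smult P w x by blast
    moreover have "0 \<odot>\<^bsub>M\<^esub> x = \<zero>\<^bsub>M\<^esub>" using lmult_0[OF x] by simp
    ultimately show ?case by (auto intro!: bexI[of _ "\<zero>\<^bsub>M\<^esub>"] simp: coord_zero)
  next
    case (insert j J)
    then obtain y where y: "y \<in> carrier M" "\<forall>i\<in>I. \<xi> i y = (if i \<in> J then \<xi> i x else 0)"
      "(\<lambda>z. word (P @ [y] @ w) z - (\<Sum>i\<in>J. \<xi> i x * word (P @ [v i] @ w) z)) \<in> R" by auto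
    define y' where "y' = \<xi> j x \<odot>\<^bsub>M\<^esub> v j"
    have j: "j \<in> I" using insert by simp
    have y': "y' \<in> carrier M" using v_closed[OF j] by (simp add: y'_def)
    have 1: "(\<lambda>z. word (P @ [y' \<oplus>\<^bsub>M\<^esub> y] @ w) z - (word (P @ [y'] @ w) z + word (P @ [y] @ w) z)) \<in> R"
      using relation_add P w y' y(1) by blast
    have 2: "(\<lambda>z. word (P @ [y'] @ w) z - \<xi> j x * word (P @ [v j] @ w) z) \<in> R"
      unfolding y'_def using relation_smult P w v_closed[OF j] by blast
    have "(\<lambda>z. word (P @ [y' \<oplus>\<^bsub>M\<^esub> y] @ w) z - (\<Sum>i\<in>insert j J. \<xi> i x * word (P @ [v i] @ w) z)) \<in> R"
      using relations_closed(3)[OF relations_closed(3)[OF 1 2] y(3)] insert by (simp add: algebra_simps)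
    moreover have "\<xi> i (y' \<oplus>\<^bsub>M\<^esub> y) = (if i \<in> insert j J then \<xi> i x else 0)" if "i \<in> I" for i
      using that j y y' insert v_closed[OF j] by (auto simp: coord_add coord_smult dual y'_def)
    ultimately show ?case using y' y(1) by (intro bexI[of _ "y' \<oplus>\<^bsub>M\<^esub> y"]) auto
  qed
  from this[OF finite_I] obtain y where y: "y \<in> carrier M" "\<forall>i\<in>I. \<xi> i y = \<xi> i x"
      "(\<lambda>z. word (P @ [y] @ w) z - (\<Sum>i\<in>I. \<xi> i x * word (P @ [v i] @ w) z)) \<in> R" by auto
  then have "y = x" using coord_ext x by blast
  then show ?thesis using y(3) by simp
qed

definition words_of_length :: "nat \<Rightarrow> 'i list set"
  where "words_of_length n = {u. set u \<subseteq> I \<and> length u = n}"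

lemma words_of_length_Suc: "words_of_length (Suc n) = (\<lambda>(i, u). i # u) ` (I \<times> words_of_length n)"
  by (auto simp: words_of_length_def length_Suc_conv image_iff)

lemma sum_words_of_length_Suc:
  "(\<Sum>u\<in>words_of_length (Suc n). f u) = (\<Sum>i\<in>I. \<Sum>u\<in>words_of_length n. f (i # u))"
proof -
  have "inj_on (\<lambda>(i, u). i # u) (I \<times> words_of_length n)" by (auto simp: inj_on_def)
  then show ?thesis unfolding words_of_length_Suc
    by (subst sum.reindex) (simp_all add: sum.cartesian_product case_prod_unfold)
qed

lemma word_expand:
  assumes "set w \<subseteq> carrier M" "set p \<subseteq> I"
  shows "(\<lambda>z. word (map v p @ w) z -
    (\<Sum>u\<in>words_of_length (length w). pairing \<xi> u w * word (map v (p @ u)) z)) \<in> R"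
  using assms
proof (induction w arbitrary: p)
  case Nil
  have "words_of_length 0 = {[]}" by (auto simp: words_of_length_def)
  then show ?case using relations_closed(2) by simp
next
  case (Cons x w)
  have vp: "set (map v p) \<subseteq> carrier M" using Cons.prems(2) v_closed by auto
  have 1: "(\<lambda>z. word (map v p @ x # w) z - (\<Sum>i\<in>I. \<xi> i x * word (map v p @ v i # w) z)) \<in> R"
    using word_letter_expand[OF _ vp, of x w] Cons.prems by simp
  have 2: "(\<lambda>z. \<Sum>i\<in>I. \<xi> i x * (word (map v (p @ [i]) @ w) z -
     (\<Sum>u\<in>words_of_length (length w). pairing \<xi> u w * word (map v ((p @ [i]) @ u)) z))) \<in> R"
    by (rule relations_sum, rule Cons.IH) (use Cons.prems in auto)
  show ?case
    using relations_closed(3)[OF 1 2]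
    by (simp add: sum_words_of_length_Suc sum_subtractf sum_distrib_left algebra_simps)
qed

definition words_upto :: "nat \<Rightarrow> 'i list set"
  where "words_upto N = {u. set u \<subseteq> I \<and> length u \<le> N}"

lemma finite_words_upto: "finite (words_upto N)"
  unfolding words_upto_def by (rule finite_lists_length_le[OF finite_I])

lemma expand:
  assumes t: "t \<in> carrier F" and N: "\<And>w. t w \<noteq> 0 \<Longrightarrow> length w \<le> N"
  shows "(\<lambda>z. t z - (\<Sum>u\<in>words_upto N. co t u * word (map v u) z)) \<in> R"
proof -
  let ?S = "{w. t w \<noteq> 0}"
  have w: "(\<Sum>u\<in>words_of_length (length w). pairing \<xi> u w * word (map v u) z) =
     (\<Sum>u\<in>words_upto N. pairing \<xi> u w * word (map v u) z)" if "w \<in> ?S" for w z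
    using N that
    by (intro sum.mono_neutral_left finite_words_upto)
      (auto simp: words_of_length_def words_upto_def pairing_length)
  have "(\<lambda>z. \<Sum>w\<in>?S. t w * (word ([] @ w) z -
      (\<Sum>u\<in>words_of_length (length w). pairing \<xi> u w * word (map v ([] @ u)) z))) \<in> R"
    by (rule relations_sum) (use word_expand[of _ "[]"] free_algebraD(2)[OF t] in auto)
  also have "(\<lambda>z. \<Sum>w\<in>?S. t w * (word ([] @ w) z -
      (\<Sum>u\<in>words_of_length (length w). pairing \<xi> u w * word (map v ([] @ u)) z)))
    = (\<lambda>z. (\<Sum>w\<in>?S. t w * word w z) - (\<Sum>w\<in>?S. \<Sum>u\<in>words_upto N. t w * pairing \<xi> u w * word (map v u) z))"
    by (simp add: w right_diff_distrib sum_subtractf sum_distrib_left mult.assoc)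
  also have "\<dots> = (\<lambda>z. t z - (\<Sum>u\<in>words_upto N. co t u * word (map v u) z))"
  proof
    fix z
    have "(\<Sum>w\<in>?S. t w * word w z) = (\<Sum>w\<in>?S. if w = z then t w else 0)"
      by (intro sum.cong) (auto simp: word_def)
    also have "\<dots> = t z" using free_algebraD(1)[OF t] by simp
    finally show "(\<Sum>w\<in>?S. t w * word w z) - (\<Sum>w\<in>?S. \<Sum>u\<in>words_upto N. t w * pairing \<xi> u w * word (map v u) z)
        = t z - (\<Sum>u\<in>words_upto N. co t u * word (map v u) z)"
      by (subst sum.swap) (simp add: coords_def sum_distrib_right)
  qed
  finally show ?thesis .
qed

lemma support_bound: "t \<in> carrier F \<Longrightarrow> \<exists>N. \<forall>w. t w \<noteq> 0 \<longrightarrow> length w \<le> N"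
  using finite_maxlen[OF free_algebraD(1)] by (metis (mono_tags) less_or_eq_imp_le mem_Collect_eq)

text \<open>Modulo the relations, every element is the combination of words in \<open>v\<close> whose coefficients are its
  coordinates.\<close>

theorem relations_iff:
  assumes "t \<in> carrier F"
  shows "t \<in> R \<longleftrightarrow> (\<forall>u. set u \<subseteq> I \<longrightarrow> co t u = 0)"
proof
  assume *: "\<forall>u. set u \<subseteq> I \<longrightarrow> co t u = 0"
  obtain N where "\<forall>w. t w \<noteq> 0 \<longrightarrow> length w \<le> N" using support_bound[OF assms] by blast
  then have "(\<lambda>z. t z - (\<Sum>u\<in>words_upto N. co t u * word (map v u) z)) \<in> R"
    using expand[OF assms] by blast
  moreover have "(\<Sum>u\<in>words_upto N. co t u * word (map v u) z) = 0" for z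
    using * by (intro sum.neutral) (auto simp: words_upto_def)
  ultimately show "t \<in> R" by simp
qed (use co_relations in blast)

subsection \<open>The Nichols algebra in coordinates\<close>

abbreviation "\<Phi> \<equiv> total_symmetrizer G act \<delta>"
abbreviation "T \<equiv> tensor_algebra M"
abbreviation "J \<equiv> nichols_ideal G M act \<delta>"
abbreviation "Nich \<equiv> nichols_algebra G M act \<delta>"

text \<open>The coordinate of \<open>\<Phi> t\<close> at \<open>u\<close>, by \<open>co_total_symmetrizer\<close>.\<close>

definition symm_coord :: "('m list \<Rightarrow> complex) \<Rightarrow> 'i list \<Rightarrow> complex"
  where "symm_coord t u = skew_ders q u (co t) []"

lemma linear_symmetrizer: "linear_map \<complex>\<^sub>F F F \<Phi>"
  unfolding total_symmetrizer_def
  by (intro linear_map_linear_extension quantum_symmetrizer_closed word_closed)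

lemma symmetrizer_relations_iff:
  assumes "t \<in> carrier F" shows "\<Phi> t \<in> R \<longleftrightarrow> (\<forall>u. set u \<subseteq> I \<longrightarrow> symm_coord t u = 0)"
  using relations_iff[OF total_symmetrizer_closed[OF assms]] co_total_symmetrizer[OF assms]
  by (simp add: symm_coord_def)

lemma symmetrizer_relations: "t \<in> R \<Longrightarrow> \<Phi> t \<in> R"
proof -
  assume t: "t \<in> R"
  have "symm_coord t u = 0" if "set u \<subseteq> I" for u
  proof -
    have "symm_coord t u = skew_ders q u (\<lambda>v. 0) []" unfolding symm_coord_def
      by (rule skew_ders_cong[where I = I]) (use that t co_relations in auto)
    then show ?thesis by (simp add: skew_ders_zero)
  qed
  then show "\<Phi> t \<in> R" using symmetrizer_relations_iff relations_closed(1)[OF t] by blast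
qed

lemma tensor_algebra_quot: "T = quot_module F R" by (simp add: tensor_algebra_def)

lemmas T_facts = linear_map_quot[OF relations_subspace, folded tensor_algebra_quot]
  linear_map_quot_map[OF relations_subspace linear_symmetrizer symmetrizer_relations,
      folded tensor_algebra_quot]

lemma coset_in_nichols_ideal_iff:
  assumes "t \<in> carrier F"
  shows "R +>\<^bsub>F\<^esub> t \<in> J \<longleftrightarrow> (\<forall>u. set u \<subseteq> I \<longrightarrow> symm_coord t u = 0)"
proof -
  have "R +>\<^bsub>F\<^esub> t \<in> carrier T" using linear_mapD(1)[OF T_facts(1)] assms by blast
  moreover have "quot_map F R \<Phi> (R +>\<^bsub>F\<^esub> t) = R +>\<^bsub>F\<^esub> \<Phi> t"
    by (rule quot_map_coset[OF relations_subspace assms linear_symmetrizer symmetrizer_relations])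
  ultimately show ?thesis
    using quot_coset_zero_iff[OF relations_subspace total_symmetrizer_closed[OF assms]]
      symmetrizer_relations_iff[OF assms]
    by (simp add: nichols_ideal_def a_kernel_def' tensor_algebra_quot)
qed

lemma ideal_subspace: "subspace \<complex>\<^sub>F J T"
proof -
  interpret Q: linear_map "\<complex>\<^sub>F :: complex ring" T T "quot_map F R \<Phi>" by (rule T_facts(2))
  have "J = Q.ker" by (auto simp: nichols_ideal_def a_kernel_def' Q.ker_def)
  then show ?thesis using Q.kerT_is_subspace by simp
qed

text \<open>The projection from the free algebra, through both quotients. Two elements have the same image iff
  their symmetrized coordinates agree (\<open>nich_class_eq_iff\<close>).\<close>

definition nich_class where "nich_class t = J +>\<^bsub>T\<^esub> (R +>\<^bsub>F\<^esub> t)"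

lemma nichols_quot: "Nich = quot_module T J" by (simp add: nichols_algebra_def)

lemma nich_vectorspace: "vectorspace \<complex>\<^sub>F Nich"
  unfolding nichols_quot by (rule vectorspace_quot[OF ideal_subspace])

lemma nich_linear: "linear_map \<complex>\<^sub>F F Nich nich_class"
  using linear_mapD[OF T_facts(1)] linear_mapD[OF linear_map_quot[OF ideal_subspace]]
  by (intro linear_mapI) (simp_all add: nich_class_def nichols_quot vectorspace_free_algebra)

lemma nich_carrier: "carrier Nich = nich_class ` carrier F"
proof -
  have "carrier Nich = (\<lambda>X. J +>\<^bsub>T\<^esub> X) ` carrier T"
    unfolding nichols_quot by (rule carrier_quot_module[OF ideal_subspace])
  also have "carrier T = (\<lambda>t. R +>\<^bsub>F\<^esub> t) ` carrier F"
    unfolding tensor_algebra_quot by (rule carrier_quot_module[OF relations_subspace])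
  finally show ?thesis by (simp add: image_image nich_class_def)
qed

lemma symm_coord_add: "s \<in> carrier F \<Longrightarrow> t \<in> carrier F \<Longrightarrow> symm_coord (\<lambda>z. s z + t z) u = symm_coord s u + symm_coord t u"
proof -
  have "skew_ders q u (\<lambda>v. f v + g v) = (\<lambda>w. skew_ders q u f w + skew_ders q u g w)" for f g
    by (induction u) (simp_all add: skew_der_add)
  then show "s \<in> carrier F \<Longrightarrow> t \<in> carrier F \<Longrightarrow> symm_coord (\<lambda>z. s z + t z) u = symm_coord s u + symm_coord t u"
    by (simp add: symm_coord_def coords_add)
qed

lemma symm_coord_scale: "symm_coord (\<lambda>z. c * t z) u = c * symm_coord t u"
  by (simp add: symm_coord_def coords_scale skew_ders_scale)

lemma nich_class_eq_iff:
  assumes "s \<in> carrier F" "t \<in> carrier F"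
  shows "nich_class s = nich_class t \<longleftrightarrow> (\<forall>u. set u \<subseteq> I \<longrightarrow> symm_coord s u = symm_coord t u)"
proof -
  interpret L: linear_map "\<complex>\<^sub>F :: complex ring" F T "\<lambda>t. R +>\<^bsub>F\<^esub> t" by (rule T_facts(1))
  have d: "(\<lambda>z. s z - t z) \<in> carrier F"
    using free_algebra_add_closed[OF assms(1) free_algebra_scale_closed[OF assms(2), of "-1"]] by simp
  have "symm_coord (\<lambda>z. s z - t z) u = symm_coord s u - symm_coord t u" for u
    using symm_coord_add[OF assms(1) free_algebra_scale_closed[OF assms(2), of "-1"], of u] symm_coord_scale[of "-1" t u]
    by simp
  moreover have "R +>\<^bsub>F\<^esub> (\<lambda>z. s z - t z) = (R +>\<^bsub>F\<^esub> s) \<ominus>\<^bsub>T\<^esub> (R +>\<^bsub>F\<^esub> t)"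
    using L.f_minus[OF assms] by (simp add: free_algebra_minus[OF assms])
  ultimately show ?thesis
    using quot_coset_eq_iff[OF ideal_subspace, of "R +>\<^bsub>F\<^esub> s" "R +>\<^bsub>F\<^esub> t"] coset_in_nichols_ideal_iff[OF d]
      assms by (simp add: nich_class_def)
qed

lemma symm_coord_cong:
  assumes "\<And>w. set w \<subseteq> I \<Longrightarrow> length w = length u \<Longrightarrow> co s w = co t w" "set u \<subseteq> I"
  shows "symm_coord s u = symm_coord t u"
  unfolding symm_coord_def by (rule skew_ders_cong[where I = I]) (use assms in auto)

lemma co_word_v:
  assumes "set w \<subseteq> I" "set u \<subseteq> I"
  shows "co (word (map v w)) u = (if u = w then 1 else 0)"
proof -
  have "pairing \<xi> u (map v w) = (if u = w then 1 else 0)"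
    using assms
  proof (induction u arbitrary: w)
    case Nil show ?case by (cases w) auto
  next
    case (Cons i u) then show ?case by (cases w) (auto simp: dual)
  qed
  then show ?thesis by (simp add: coords_word)
qed

text \<open>The Nichols algebra is spanned by the words in \<open>v\<close> of length at most \<open>N\<close>: an element and its
  truncation to these words have the same symmetrized coordinates, at short words by
  homogeneity and at long words by hypothesis.\<close>

theorem fin_dim_if_symm_coord_vanishes:
  assumes "\<And>u f. set u \<subseteq> I \<Longrightarrow> length u > N \<Longrightarrow> skew_ders q u f [] = 0"
  shows "vectorspace.fin_dim \<complex>\<^sub>F Nich"
proof (rule fin_dimI[OF nich_vectorspace])
  let ?w = "\<lambda>u. word (map v u)"
  have w: "?w u \<in> carrier F" if "u \<in> words_upto N" for u
    using that v_closed by (intro word_closed) (auto simp: words_upto_def)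
  show "finite ((\<lambda>u. nich_class (?w u)) ` words_upto N)" using finite_words_upto by simp
  show "(\<lambda>u. nich_class (?w u)) ` words_upto N \<subseteq> carrier Nich"
    using w by (auto simp: nich_carrier)
  fix W assume W: "subspace \<complex>\<^sub>F W Nich" "(\<lambda>u. nich_class (?w u)) ` words_upto N \<subseteq> W"
  have sum_in: "nich_class (\<lambda>z. \<Sum>u\<in>S. c u * ?w u z) \<in> W" if "finite S" "S \<subseteq> words_upto N" for S c
    using that
  proof (induction S rule: finite_induct)
    case empty
    have "nich_class (\<lambda>z. 0) = \<zero>\<^bsub>Nich\<^esub>" using linear_mapD(4)[OF nich_linear] by (simp add: free_algebra_simps)
    then show ?case using subspaceD(3)[OF W(1)] by simp
  next
    case (insert x S)
    have x: "?w x \<in> carrier F" using insert.prems w by simp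
    have S: "(\<lambda>z. \<Sum>u\<in>S. c u * ?w u z) \<in> carrier F"
      by (rule free_algebra_sum_closed) (use insert.prems w in auto)
    have "nich_class (\<lambda>z. c x * ?w x z + (\<Sum>u\<in>S. c u * ?w u z)) =
       c x \<odot>\<^bsub>Nich\<^esub> nich_class (?w x) \<oplus>\<^bsub>Nich\<^esub> nich_class (\<lambda>z. \<Sum>u\<in>S. c u * ?w u z)"
      using linear_mapD(2)[OF nich_linear free_algebra_scale_closed[OF x] S]
        linear_mapD(3)[OF nich_linear x] by (simp add: free_algebra_simps(2,3))
    also have "\<dots> \<in> W" using subspaceD(4,5)[OF W(1)] W(2) insert by auto
    finally show ?case using insert by simp
  qed
  show "carrier Nich \<subseteq> W"
  proof
    fix X assume "X \<in> carrier Nich"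
    then obtain t where t: "t \<in> carrier F" "X = nich_class t" by (auto simp: nich_carrier)
    let ?s = "\<lambda>z. \<Sum>u\<in>words_upto N. co t u * ?w u z"
    have s: "?s \<in> carrier F" by (rule free_algebra_sum_closed[OF w])
    have "symm_coord t u = symm_coord ?s u" if u: "set u \<subseteq> I" for u
    proof (cases "length u \<le> N")
      case True
      show ?thesis
      proof (rule symm_coord_cong[OF _ u])
        fix x assume x: "set x \<subseteq> I" "length x = length u"
        have "co ?s x = (\<Sum>u\<in>words_upto N. co t u * co (?w u) x)" by (rule coords_sum[OF w])
        also have "\<dots> = (\<Sum>u\<in>words_upto N. if u = x then co t u else 0)"
          using x by (intro sum.cong) (auto simp: words_upto_def co_word_v)
        also have "\<dots> = co t x" using x True finite_words_upto by (simp add: words_upto_def)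
        finally show "co t x = co ?s x" by simp
      qed
    next
      case False then show ?thesis using assms u by (simp add: symm_coord_def)
    qed
    then have "X = nich_class ?s" using nich_class_eq_iff[OF t(1) s] t(2) by simp
    then show "X \<in> W" using sum_in[OF finite_words_upto] by simp
  qed
qed

lemma symm_coord_long:
  assumes "\<And>w. t w \<noteq> 0 \<Longrightarrow> length w < length u" "set u \<subseteq> I"
  shows "symm_coord t u = 0"
proof -
  have "co t w = 0" if "length w = length u" for w
    using assms(1) that unfolding coords_def
    by (intro sum.neutral) (metis (mono_tags) less_irrefl mem_Collect_eq mult_zero_right pairing_length)
  then have "symm_coord t u = skew_ders q u (\<lambda>v. 0) []" unfolding symm_coord_def
    by (intro skew_ders_cong[where I = I]) (use assms in auto)
  then show ?thesis by (simp add: skew_ders_zero)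
qed

text \<open>A finite generating set has representatives of bounded length. By homogeneity their span has no
  nonzero symmetrized coordinate at longer words.\<close>

theorem not_fin_dim_if_symm_coord_nonzero:
  assumes "\<And>N. \<exists>u t. set u \<subseteq> I \<and> length u > N \<and> t \<in> carrier F \<and> symm_coord t u \<noteq> 0"
  shows "\<not> vectorspace.fin_dim \<complex>\<^sub>F Nich"
proof
  assume "vectorspace.fin_dim \<complex>\<^sub>F Nich"
  then obtain B where B: "finite B" "B \<subseteq> carrier Nich"
    "\<And>W. subspace \<complex>\<^sub>F W Nich \<Longrightarrow> B \<subseteq> W \<Longrightarrow> carrier Nich \<subseteq> W"
    using fin_dimE[OF nich_vectorspace] by metis
  define W where "W N = nich_class ` {t \<in> carrier F. \<forall>w. t w \<noteq> 0 \<longrightarrow> length w \<le> N}" for N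
  have W: "subspace \<complex>\<^sub>F (W N) Nich" for N
  proof (rule subspaceI[OF nich_vectorspace])
    show "W N \<subseteq> carrier Nich" by (auto simp: W_def nich_carrier)
    have "nich_class (\<lambda>z. 0) \<in> W N"
      unfolding W_def by (rule imageI) (simp add: free_algebra_simps(1))
    then show "\<zero>\<^bsub>Nich\<^esub> \<in> W N" using linear_mapD(4)[OF nich_linear] by (simp add: free_algebra_simps)
  next
    fix x y assume "x \<in> W N" "y \<in> W N"
    then obtain s t where st: "s \<in> carrier F" "\<forall>w. s w \<noteq> 0 \<longrightarrow> length w \<le> N" "x = nich_class s"
      "t \<in> carrier F" "\<forall>w. t w \<noteq> 0 \<longrightarrow> length w \<le> N" "y = nich_class t" unfolding W_def by blast
    have "length w \<le> N" if "s w + t w \<noteq> 0" for w using st(2,5) that by (metis add_0)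
    then have "nich_class (\<lambda>w. s w + t w) \<in> W N"
      unfolding W_def using free_algebra_add_closed[OF st(1,4)] by (intro imageI) simp
    then show "x \<oplus>\<^bsub>Nich\<^esub> y \<in> W N"
      using linear_mapD(2)[OF nich_linear st(1,4)] st(3,6) by (simp add: free_algebra_simps(2))
  next
    fix c x assume "x \<in> W N"
    then obtain s where st: "s \<in> carrier F" "\<forall>w. s w \<noteq> 0 \<longrightarrow> length w \<le> N" "x = nich_class s"
      unfolding W_def by blast
    have "nich_class (\<lambda>w. c * s w) \<in> W N"
      unfolding W_def using free_algebra_scale_closed[OF st(1)] st(2) by (intro imageI) simp
    then show "c \<odot>\<^bsub>Nich\<^esub> x \<in> W N"
      using linear_mapD(3)[OF nich_linear st(1), of c] st(3) by (simp add: free_algebra_simps(3))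
  qed
  have mono: "W N \<subseteq> W N'" if "N \<le> N'" for N N'
    unfolding W_def using that le_trans by (intro image_mono) blast
  have "\<exists>N. B \<subseteq> W N" using B(1,2)
  proof (induction B rule: finite_induct)
    case (insert x B)
    then obtain N t where N: "B \<subseteq> W N" "t \<in> carrier F" "x = nich_class t"
      unfolding nich_carrier by blast
    obtain N' where "\<forall>w. t w \<noteq> 0 \<longrightarrow> length w \<le> N'" using support_bound[OF N(2)] by blast
    then have "x \<in> W N'" unfolding N(3) W_def using N(2) by (intro imageI) simp
    then have "insert x B \<subseteq> W (max N N')" using N(1) mono[of N "max N N'"] mono[of N' "max N N'"] by auto
    then show ?case by blast
  qed simp
  then obtain N where "carrier Nich \<subseteq> W N" using B(3)[OF W] by blast
  moreover obtain u t where u: "set u \<subseteq> I" "length u > N" "t \<in> carrier F" "symm_coord t u \<noteq> 0"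
    using assms by blast
  ultimately obtain s where s: "s \<in> carrier F" "\<forall>w. s w \<noteq> 0 \<longrightarrow> length w \<le> N" "nich_class t = nich_class s"
    unfolding W_def nich_carrier by blast
  have "symm_coord s u = 0" by (rule symm_coord_long) (use s(2) u(1,2) le_less_trans in blast)+
  then show False using nich_class_eq_iff[OF u(3) s(1)] s(3) u by simp
qed

text \<open>The polynomials whose derivations were computed above must occur as coordinate functions of actual
  elements of the free algebra; right multiplication by \<open>x\<^sub>i\<close> is realized by appending the letter \<open>v\<^sub>i\<close>.\<close>

definition realizable :: "('i list \<Rightarrow> complex) \<Rightarrow> bool"
  where "realizable f \<longleftrightarrow> (\<exists>t\<in>carrier F. \<forall>u. set u \<subseteq> I \<longrightarrow> co t u = f u)"

lemma realizableI: "t \<in> carrier F \<Longrightarrow> (\<And>u. set u \<subseteq> I \<Longrightarrow> co t u = f u) \<Longrightarrow> realizable f"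
  unfolding realizable_def by blast

lemma realizableE:
  assumes "realizable f"
  obtains t where "t \<in> carrier F" "\<And>u. set u \<subseteq> I \<Longrightarrow> co t u = f u"
  using assms unfolding realizable_def by blast

lemma realizable_add:
  assumes "realizable f" "realizable g" shows "realizable (\<lambda>u. f u + g u)"
proof -
  obtain s where s: "s \<in> carrier F" "\<And>u. set u \<subseteq> I \<Longrightarrow> co s u = f u"
    using realizableE[OF assms(1)] by blast
  obtain t where t: "t \<in> carrier F" "\<And>u. set u \<subseteq> I \<Longrightarrow> co t u = g u"
    using realizableE[OF assms(2)] by blast
  show ?thesis
    by (rule realizableI[OF free_algebra_add_closed[OF s(1) t(1)]])
      (simp add: coords_add[OF s(1) t(1)] s t)
qed

lemma realizable_scale:
  assumes "realizable f" shows "realizable (\<lambda>u. c * f u)"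
proof -
  obtain t where *: "t \<in> carrier F" "\<And>u. set u \<subseteq> I \<Longrightarrow> co t u = f u"
    using realizableE[OF assms] by blast
  show ?thesis by (rule realizableI[OF free_algebra_scale_closed[OF *(1), of c]]) (simp add: coords_scale *)
qed

lemma realizable_diff: "realizable f \<Longrightarrow> realizable g \<Longrightarrow> realizable (\<lambda>u. f u - g u)"
  using realizable_add[of f "\<lambda>u. -1 * g u"] realizable_scale[of g "-1"] by simp

lemma realizable_empty_word: "realizable empty_word"
  by (rule realizableI[of "word []"])
    (use co_word_v[of "[]"] in \<open>simp_all add: word_closed empty_word_def\<close>)

lemma realizable_append_letter:
  assumes "i \<in> I" "realizable f" shows "realizable (append_letter i f)"
proof -
  obtain t where t: "t \<in> carrier F" "\<And>u. set u \<subseteq> I \<Longrightarrow> co t u = f u"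
    using realizableE[OF assms(2)] by blast
  have w: "word (w @ [v i]) \<in> carrier F" if "set w \<subseteq> carrier M" for w
    using that v_closed[OF assms(1)] by (intro word_closed) auto
  have "co (linear_extension (\<lambda>w. word (w @ [v i])) t) u = append_letter i f u" if u: "set u \<subseteq> I" for u
  proof -
    have *: "co (linear_extension (\<lambda>w. word (w @ [v i])) t) u = (\<Sum>w | t w \<noteq> 0. t w * pairing \<xi> u (w @ [v i]))"
      by (subst coords_linear_extension[OF t(1) w]) (simp_all add: coords_word)
    show ?thesis
    proof (cases u rule: rev_cases)
      case Nil
      have "pairing \<xi> u (w @ [v i]) = 0" for w using Nil by (intro pairing_length) simp
      then show ?thesis using Nil * by (simp add: append_letter_def)
    next
      case (snoc x j)
      have "pairing \<xi> u (w @ [v i]) = pairing \<xi> x w * (if i = j then 1 else 0)" for w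
        using snoc u assms(1) pairing_append[of x w \<xi> "[j]" "[v i]"] pairing_length[of x w \<xi>]
          pairing_length[of "x @ [j]" "w @ [v i]" \<xi>]
        by (cases "length x = length w") (auto simp: dual)
      then show ?thesis using * snoc u t(2)[of x]
        by (auto simp: append_letter_def coords_def mult.assoc[symmetric] sum_distrib_right[symmetric])
    qed
  qed
  moreover have "linear_extension (\<lambda>w. word (w @ [v i])) t \<in> carrier F"
    by (rule linear_extension_closed[OF t(1) w])
  ultimately show ?thesis by (intro realizableI)
qed

lemma symm_coord_realizable:
  assumes "realizable f" "set u \<subseteq> I"
  obtains t where "t \<in> carrier F" "symm_coord t u = skew_ders q u f []"
proof -
  obtain t where t: "t \<in> carrier F" "\<And>u. set u \<subseteq> I \<Longrightarrow> co t u = f u"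
    using realizableE[OF assms(1)] by blast
  have "symm_coord t u = skew_ders q u f []"
    unfolding symm_coord_def by (rule skew_ders_cong[where I = I]) (use t assms in simp_all)
  then show ?thesis using that t by blast
qed

subsection \<open>Finite- and infinite-dimensional cases\<close>

text \<open>A word longer than the number of letters has a repeated letter.\<close>

theorem fin_dim_nichols_if_quantum_linear_space:
  assumes comm: "\<And>i j. i \<in> I \<Longrightarrow> j \<in> I \<Longrightarrow> i \<noteq> j \<Longrightarrow> q i j * q j i = 1"
    and sq: "\<And>i. i \<in> I \<Longrightarrow> q i i = -1"
  shows "vectorspace.fin_dim \<complex>\<^sub>F Nich"
proof (rule fin_dim_if_symm_coord_vanishes)
  fix u and f :: "'i list \<Rightarrow> complex"
  assume u: "set u \<subseteq> I" "length u > card I"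
  then have "\<not> distinct u" using card_mono[OF finite_I u(1)] distinct_card[of u] by auto
  then show "skew_ders q u f [] = 0" using skew_ders_repeated[where I = I and q = q] u comm sq by metis
qed

text \<open>The powers of \<open>x\<^sub>i\<close> do not vanish, as \<open>D\<^sub>i\<^sup>k x\<^sub>i\<^sup>k = k!\<close>.\<close>

theorem not_fin_dim_nichols_if_eq_1:
  assumes i: "i \<in> I" and "q i i = 1"
  shows "\<not> vectorspace.fin_dim \<complex>\<^sub>F Nich"
proof (rule not_fin_dim_if_symm_coord_nonzero)
  fix N
  have "realizable ((append_letter i ^^ k) empty_word)" for k
    by (induction k) (auto intro: realizable_empty_word realizable_append_letter i)
  moreover have u: "set (replicate (Suc N) i) \<subseteq> I" using i by auto
  ultimately obtain t where "t \<in> carrier F" "symm_coord t (replicate (Suc N) i) = fact (Suc N)"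
    using symm_coord_realizable skew_ders_power[of q, OF assms(2)] by metis
  then show "\<exists>u t. set u \<subseteq> I \<and> length u > N \<and> t \<in> carrier F \<and> symm_coord t u \<noteq> 0"
    using u by (metis fact_nonzero length_replicate lessI)
qed

text \<open>The powers of \<open>[[x\<^sub>i, x\<^sub>j], x\<^sub>l]\<close> do not vanish.\<close>

theorem not_fin_dim_nichols_if_triangle:
  assumes I: "i \<in> I" "j \<in> I" "l \<in> I" and "triangle q e i j l"
  shows "\<not> vectorspace.fin_dim \<complex>\<^sub>F Nich"
proof (rule not_fin_dim_if_symm_coord_nonzero)
  interpret triangle q e i j l by fact
  fix N
  have "realizable (append_nested_comm e i j l f)" if "realizable f" for f
    unfolding append_nested_comm_def
    by (intro realizable_add realizable_diff realizable_scale realizable_append_letter I that)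
  then have "realizable (nested_comm_power k)" for k
    by (induction k) (simp_all add: realizable_empty_word)
  moreover define u where "u = concat (replicate (Suc N) [i, l, j])"
  moreover have u: "set u \<subseteq> I" using I by (auto simp: u_def)
  ultimately obtain t where "t \<in> carrier F" "symm_coord t u \<noteq> 0"
    using symm_coord_realizable skew_ders_nested_comm_power_neq_0 by metis
  moreover have "length u > N" by (simp add: u_def length_concat sum_list_replicate)
  ultimately show "\<exists>u t. set u \<subseteq> I \<and> length u > N \<and> t \<in> carrier F \<and> symm_coord t u \<noteq> 0"
    using u by blast
qed

end

section \<open>Induced representations\<close>

lemma finsum_constant:
  assumes V: "vectorspace \<complex>\<^sub>F V" and "finite S" and x: "x \<in> carrier V"
  shows "(\<Oplus>\<^bsub>V\<^esub>h\<in>S. x) = of_nat (card S) \<odot>\<^bsub>V\<^esub> x"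
proof -
  interpret vectorspace "\<complex>\<^sub>F :: complex ring" V by fact
  show ?thesis using assms(2)
  proof (induction S rule: finite_induct)
    case empty show ?case using lmult_0[OF x] by simp
  next
    case (insert h S)
    have "(1 + of_nat (card S)) \<odot>\<^bsub>V\<^esub> x = x \<oplus>\<^bsub>V\<^esub> of_nat (card S) \<odot>\<^bsub>V\<^esub> x"
      using smult_l_distr[OF _ _ x, of 1 "of_nat (card S)"] smult_one[OF x] by simp
    then show ?case using insert x by simp
  qed
qed

lemma linear_map_finsum:
  assumes V: "vectorspace \<complex>\<^sub>F V" and W: "vectorspace \<complex>\<^sub>F W"
    and f: "\<And>h. h \<in> S \<Longrightarrow> linear_map \<complex>\<^sub>F V W (f h)"
  shows "linear_map \<complex>\<^sub>F V W (\<lambda>x. \<Oplus>\<^bsub>W\<^esub>h\<in>S. f h x)"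
proof -
  interpret W: vectorspace "\<complex>\<^sub>F :: complex ring" W by fact
  note D = linear_mapD[OF f]
  show ?thesis
  proof (rule linear_mapI[OF V W])
    fix x y assume xy: "x \<in> carrier V" "y \<in> carrier V"
    show "(\<Oplus>\<^bsub>W\<^esub>h\<in>S. f h (x \<oplus>\<^bsub>V\<^esub> y)) = (\<Oplus>\<^bsub>W\<^esub>h\<in>S. f h x) \<oplus>\<^bsub>W\<^esub> (\<Oplus>\<^bsub>W\<^esub>h\<in>S. f h y)"
    proof -
      have "(\<Oplus>\<^bsub>W\<^esub>h\<in>S. f h (x \<oplus>\<^bsub>V\<^esub> y)) = (\<Oplus>\<^bsub>W\<^esub>h\<in>S. f h x \<oplus>\<^bsub>W\<^esub> f h y)"
        using D xy by (intro W.finsum_cong') auto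
      also have "\<dots> = (\<Oplus>\<^bsub>W\<^esub>h\<in>S. f h x) \<oplus>\<^bsub>W\<^esub> (\<Oplus>\<^bsub>W\<^esub>h\<in>S. f h y)"
        using D xy by (intro W.finsum_addf) auto
      finally show ?thesis .
    qed
  next
    fix c x assume x: "x \<in> carrier V"
    show "(\<Oplus>\<^bsub>W\<^esub>h\<in>S. f h (c \<odot>\<^bsub>V\<^esub> x)) = c \<odot>\<^bsub>W\<^esub> (\<Oplus>\<^bsub>W\<^esub>h\<in>S. f h x)"
      using D x W.finsum_smult[of c "\<lambda>h. f h x" S] by (auto intro!: W.finsum_cong')
  qed (use D in \<open>auto intro!: W.finsum_closed\<close>)
qed

lemma linear_map_of_finsum:
  assumes L: "linear_map \<complex>\<^sub>F V W \<phi>" and "finite S" and "\<And>x. x \<in> S \<Longrightarrow> g x \<in> carrier V"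
  shows "\<phi> (\<Oplus>\<^bsub>V\<^esub>x\<in>S. g x) = (\<Oplus>\<^bsub>W\<^esub>x\<in>S. \<phi> (g x))"
proof -
  interpret V: vectorspace "\<complex>\<^sub>F :: complex ring" V by (rule linear_mapD(5)[OF L])
  interpret W: vectorspace "\<complex>\<^sub>F :: complex ring" W by (rule linear_mapD(6)[OF L])
  show ?thesis using assms(2,3)
  proof (induction S rule: finite_induct)
    case empty show ?case using linear_mapD(4)[OF L] by simp
  next
    case (insert x S)
    have "(\<Oplus>\<^bsub>V\<^esub>x\<in>insert x S. g x) = g x \<oplus>\<^bsub>V\<^esub> (\<Oplus>\<^bsub>V\<^esub>x\<in>S. g x)"
      using insert by (intro V.finsum_insert) auto
    moreover have "(\<Oplus>\<^bsub>W\<^esub>x\<in>insert x S. \<phi> (g x)) = \<phi> (g x) \<oplus>\<^bsub>W\<^esub> (\<Oplus>\<^bsub>W\<^esub>x\<in>S. \<phi> (g x))"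
      using insert linear_mapD(1)[OF L] by (intro W.finsum_insert) auto
    moreover have "(\<Oplus>\<^bsub>V\<^esub>x\<in>S. g x) \<in> carrier V" using insert by (intro V.finsum_closed) auto
    ultimately show ?case using insert linear_mapD(2)[OF L] by simp
  qed
qed

locale induced = group G for G :: "('g, 'x) monoid_scheme" (structure) +
  fixes H :: "'g set" and V :: "(complex, 'v) module" and \<rho> :: "'g \<Rightarrow> 'v \<Rightarrow> 'v"
  assumes fin: "finite (carrier G)" and H: "subgroup H G"
    and rep: "representation (G\<lparr>carrier := H\<rparr>) V \<rho>"
begin

sublocale V: vectorspace "\<complex>\<^sub>F :: complex ring" V
  using rep by (simp add: representation_def)

lemma rho:
  "h \<in> H \<Longrightarrow> linear_map \<complex>\<^sub>F V V (\<rho> h)" "v \<in> carrier V \<Longrightarrow> \<rho> \<one> v = v"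
  "h \<in> H \<Longrightarrow> k \<in> H \<Longrightarrow> v \<in> carrier V \<Longrightarrow> \<rho> (h \<otimes> k) v = \<rho> h (\<rho> k v)"
  using rep by (auto simp: representation_def)

lemmas rho_simps = linear_mapD(1-4)[OF rho(1)]

lemma V: "vectorspace \<complex>\<^sub>F V" by unfold_locales

lemma H_closed: "h \<in> H \<Longrightarrow> h \<in> carrier G" using subgroup.subset[OF H] by blast

lemma finite_H: "finite H" using fin subgroup.subset[OF H] by (rule rev_finite_subset)

abbreviation "TG \<equiv> tensor_group_algebra G V"
abbreviation "B \<equiv> balanced_relations G H V \<rho>"
abbreviation "Ind \<equiv> induced_module G H V \<rho>"

lemma TG_simps:
  "f \<in> carrier TG \<longleftrightarrow> (\<forall>g\<in>carrier G. f g \<in> carrier V) \<and> (\<forall>g. g \<notin> carrier G \<longrightarrow> f g = \<zero>\<^bsub>V\<^esub>)"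
  "f \<oplus>\<^bsub>TG\<^esub> f' = (\<lambda>g. f g \<oplus>\<^bsub>V\<^esub> f' g)" "c \<odot>\<^bsub>TG\<^esub> f = (\<lambda>g. c \<odot>\<^bsub>V\<^esub> f g)" "\<zero>\<^bsub>TG\<^esub> = (\<lambda>g. \<zero>\<^bsub>V\<^esub>)"
proof -
  have "finite {g. f g \<noteq> \<zero>\<^bsub>V\<^esub>}" if "\<forall>g. g \<notin> carrier G \<longrightarrow> f g = \<zero>\<^bsub>V\<^esub>"
    by (rule finite_subset[OF _ fin]) (use that in auto)
  then show "f \<in> carrier TG \<longleftrightarrow> (\<forall>g\<in>carrier G. f g \<in> carrier V) \<and> (\<forall>g. g \<notin> carrier G \<longrightarrow> f g = \<zero>\<^bsub>V\<^esub>)"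
    by (auto simp: tensor_group_algebra_def)
qed (simp_all add: tensor_group_algebra_def)

lemma TG_value: "f \<in> carrier TG \<Longrightarrow> f g \<in> carrier V"
  by (cases "g \<in> carrier G") (auto simp: TG_simps)

lemma TG_outside: "f \<in> carrier TG \<Longrightarrow> g \<notin> carrier G \<Longrightarrow> f g = \<zero>\<^bsub>V\<^esub>"
  by (auto simp: TG_simps)

lemma vectorspace_TG: "vectorspace \<complex>\<^sub>F TG"
proof -
  note 1 = V.smult_assoc1[simplified] V.smult_l_distr[simplified] V.smult_r_distr[simplified]
    V.smult_one[simplified] V.lmult_0[simplified]
  show ?thesis
    by (rule complex_vs_criteria; (intro ext)?; (simp add: TG_simps(2-) TG_value V.a_comm V.a_assoc V.a_lcomm 1)?)
      (auto simp: TG_simps)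
qed

lemma TG_finsum:
  assumes "\<And>h. h \<in> S \<Longrightarrow> F h \<in> carrier TG"
  shows "(\<Oplus>\<^bsub>TG\<^esub>h\<in>S. F h) g = (\<Oplus>\<^bsub>V\<^esub>h\<in>S. F h g)"
proof -
  interpret T: vectorspace "\<complex>\<^sub>F :: complex ring" TG by (rule vectorspace_TG)
  show ?thesis using assms
  proof (induction S rule: infinite_finite_induct)
    case (insert h S)
    then have "(\<Oplus>\<^bsub>TG\<^esub>h\<in>insert h S. F h) = F h \<oplus>\<^bsub>TG\<^esub> (\<Oplus>\<^bsub>TG\<^esub>h\<in>S. F h)"
      by (intro T.finsum_insert) auto
    moreover have "(\<Oplus>\<^bsub>V\<^esub>h\<in>insert h S. F h g) = F h g \<oplus>\<^bsub>V\<^esub> (\<Oplus>\<^bsub>V\<^esub>h\<in>S. F h g)"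
      using insert by (intro V.finsum_insert) (auto intro: TG_value)
    ultimately show ?case using insert by (simp add: TG_simps(2))
  qed (simp_all add: TG_simps(4))
qed

lemma pure_tensor_closed: "g \<in> carrier G \<Longrightarrow> v \<in> carrier V \<Longrightarrow> pure_tensor V g v \<in> carrier TG"
  by (auto simp: TG_simps pure_tensor_def)

lemma TG_decompose:
  assumes f: "f \<in> carrier TG"
  shows "f = (\<Oplus>\<^bsub>TG\<^esub>x\<in>carrier G. pure_tensor V x (f x))"
proof
  fix g
  have "(\<Oplus>\<^bsub>TG\<^esub>x\<in>carrier G. pure_tensor V x (f x)) g = (\<Oplus>\<^bsub>V\<^esub>x\<in>carrier G. pure_tensor V x (f x) g)"
    using f by (intro TG_finsum pure_tensor_closed TG_value)
  also have "\<dots> = (\<Oplus>\<^bsub>V\<^esub>x\<in>carrier G. if g = x then f x else \<zero>\<^bsub>V\<^esub>)"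
    using f by (intro V.finsum_cong') (auto simp: pure_tensor_def TG_value)
  also have "\<dots> = f g"
  proof (cases "g \<in> carrier G")
    case True then show ?thesis using V.finsum_singleton[OF True fin, of f] f TG_value by auto
  next
    case False
    then have "(\<Oplus>\<^bsub>V\<^esub>x\<in>carrier G. if g = x then f x else \<zero>\<^bsub>V\<^esub>) = (\<Oplus>\<^bsub>V\<^esub>x\<in>carrier G. \<zero>\<^bsub>V\<^esub>)"
      by (intro V.finsum_cong') auto
    then show ?thesis using False f by (simp add: TG_outside)
  qed
  finally show "f g = (\<Oplus>\<^bsub>TG\<^esub>x\<in>carrier G. pure_tensor V x (f x)) g" by simp
qed

lemma linear_map_pure_tensor_eq:
  assumes "linear_map \<complex>\<^sub>F TG W \<phi>" "linear_map \<complex>\<^sub>F TG W \<psi>"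
    and eq: "\<And>x v. x \<in> carrier G \<Longrightarrow> v \<in> carrier V \<Longrightarrow> \<phi> (pure_tensor V x v) = \<psi> (pure_tensor V x v)"
    and f: "f \<in> carrier TG"
  shows "\<phi> f = \<psi> f"
proof -
  interpret W: vectorspace "\<complex>\<^sub>F :: complex ring" W by (rule linear_mapD(6)[OF assms(1)])
  have p: "pure_tensor V x (f x) \<in> carrier TG" if "x \<in> carrier G" for x
    using f that pure_tensor_closed TG_value by auto
  have "(\<Oplus>\<^bsub>W\<^esub>x\<in>carrier G. \<phi> (pure_tensor V x (f x))) = (\<Oplus>\<^bsub>W\<^esub>x\<in>carrier G. \<psi> (pure_tensor V x (f x)))"
    using eq TG_value[OF f] p linear_mapD(1)[OF assms(2)] by (intro W.finsum_cong') auto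
  then show ?thesis
    using TG_decompose[OF f] linear_map_of_finsum[OF assms(1) fin, where g = "\<lambda>x. pure_tensor V x (f x)"]
      linear_map_of_finsum[OF assms(2) fin, where g = "\<lambda>x. pure_tensor V x (f x)"] p
    by simp
qed

text \<open>Evaluation of \<open>f = \<Sum>g. g \<otimes> f(g)\<close> at the coset \<open>y H\<close>: by balancing, \<open>y h \<otimes> v = y \<otimes> \<rho>(h) v\<close>, so this
  collects the coefficient of \<open>y\<close>.\<close>

definition orbit_sum :: "'g \<Rightarrow> ('g \<Rightarrow> 'v) \<Rightarrow> 'v"
  where "orbit_sum y f = (\<Oplus>\<^bsub>V\<^esub>h\<in>H. \<rho> h (f (y \<otimes> h)))"

lemma linear_orbit_sum: "linear_map \<complex>\<^sub>F TG V (orbit_sum y)"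
  unfolding orbit_sum_def
proof (rule linear_map_finsum[OF vectorspace_TG V])
  fix h assume h: "h \<in> H"
  have "linear_map \<complex>\<^sub>F TG V (\<lambda>f. f (y \<otimes> h))"
    by (rule linear_mapI) (auto simp: vectorspace_TG V TG_value TG_simps(2,3))
  from linear_map_comp[OF this rho(1)[OF h]] show "linear_map \<complex>\<^sub>F TG V (\<lambda>f. \<rho> h (f (y \<otimes> h)))" .
qed

lemma orbit_sum_pure_tensor:
  assumes y: "y \<in> carrier G" and x: "x \<in> carrier G" and v: "v \<in> carrier V"
  shows "orbit_sum y (pure_tensor V x v) = (if inv y \<otimes> x \<in> H then \<rho> (inv y \<otimes> x) v else \<zero>\<^bsub>V\<^esub>)"
proof -
  have eq: "y \<otimes> h = x \<longleftrightarrow> inv y \<otimes> x = h" if "h \<in> H" for h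
    using inv_solve_left[of h y x] H_closed[OF that] x y by auto
  have "orbit_sum y (pure_tensor V x v) = (\<Oplus>\<^bsub>V\<^esub>h\<in>H. if inv y \<otimes> x = h then \<rho> h v else \<zero>\<^bsub>V\<^esub>)"
    unfolding orbit_sum_def using v rho_simps
    by (intro V.finsum_cong') (auto simp: pure_tensor_def eq)
  also have "\<dots> = (if inv y \<otimes> x \<in> H then \<rho> (inv y \<otimes> x) v else \<zero>\<^bsub>V\<^esub>)"
  proof (cases "inv y \<otimes> x \<in> H")
    case True then show ?thesis
      using V.finsum_singleton[OF True finite_H, of "\<lambda>h. \<rho> h v"] v rho_simps by auto
  next
    case False
    then have "(\<Oplus>\<^bsub>V\<^esub>h\<in>H. if inv y \<otimes> x = h then \<rho> h v else \<zero>\<^bsub>V\<^esub>) = (\<Oplus>\<^bsub>V\<^esub>h\<in>H. \<zero>\<^bsub>V\<^esub>)"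
      by (intro V.finsum_cong') auto
    then show ?thesis using False by simp
  qed
  finally show ?thesis .
qed

lemma balanced_generators_closed:
  "{pure_tensor V (g \<otimes> h) v \<ominus>\<^bsub>TG\<^esub> pure_tensor V g (\<rho> h v) | g h v.
      g \<in> carrier G \<and> h \<in> H \<and> v \<in> carrier V} \<subseteq> carrier TG"
proof -
  interpret T: vectorspace "\<complex>\<^sub>F :: complex ring" TG by (rule vectorspace_TG)
  show ?thesis using pure_tensor_closed H_closed rho_simps by (auto intro!: T.minus_closed)
qed

lemma B_subspace: "subspace \<complex>\<^sub>F B TG"
  unfolding balanced_relations_def
  by (rule span_subspace[OF vectorspace_TG balanced_generators_closed])

lemma B_closed: "f \<in> B \<Longrightarrow> f \<in> carrier TG" using subspaceD(2)[OF B_subspace] by blast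

lemma balanced_relation:
  assumes "g \<in> carrier G" "h \<in> H" "v \<in> carrier V"
  shows "pure_tensor V (g \<otimes> h) v \<ominus>\<^bsub>TG\<^esub> pure_tensor V g (\<rho> h v) \<in> B"
  unfolding balanced_relations_def
  by (rule subsetD[OF span_subspace(2)[OF vectorspace_TG balanced_generators_closed]]) (use assms in blast)

lemma orbit_sum_balanced:
  assumes "f \<in> B" "y \<in> carrier G"
  shows "orbit_sum y f = \<zero>\<^bsub>V\<^esub>"
proof -
  interpret L: linear_map "\<complex>\<^sub>F :: complex ring" TG V "orbit_sum y" by (rule linear_orbit_sum)
  have "B \<subseteq> L.ker"
    unfolding balanced_relations_def
  proof (rule span_least[OF L.kerT_is_subspace], clarify)
    fix g h v assume *: "g \<in> carrier G" "h \<in> H" "v \<in> carrier V"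
    note c = * H_closed[OF *(2)]
    have "inv y \<otimes> (g \<otimes> h) \<in> H \<longleftrightarrow> inv y \<otimes> g \<in> H"
    proof
      assume a: "inv y \<otimes> (g \<otimes> h) \<in> H"
      have "inv y \<otimes> g = inv y \<otimes> (g \<otimes> h) \<otimes> inv h"
        using c assms(2) by (simp add: m_assoc)
      then show "inv y \<otimes> g \<in> H"
        using subgroup.m_closed[OF H a subgroup.m_inv_closed[OF H *(2)]] by simp
    next
      assume "inv y \<otimes> g \<in> H"
      then show "inv y \<otimes> (g \<otimes> h) \<in> H"
        using subgroup.m_closed[OF H _ *(2)] c assms(2) by (simp add: m_assoc[symmetric])
    qed
    moreover have "\<rho> (inv y \<otimes> (g \<otimes> h)) v = \<rho> (inv y \<otimes> g) (\<rho> h v)" if "inv y \<otimes> g \<in> H"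
      using rho(3)[OF that *(2,3)] c assms(2) by (simp add: m_assoc[symmetric])
    ultimately have "orbit_sum y (pure_tensor V (g \<otimes> h) v) = orbit_sum y (pure_tensor V g (\<rho> h v))"
      using c assms(2) rho_simps by (auto simp: orbit_sum_pure_tensor)
    then have "orbit_sum y (pure_tensor V (g \<otimes> h) v \<ominus>\<^bsub>TG\<^esub> pure_tensor V g (\<rho> h v)) = \<zero>\<^bsub>V\<^esub>"
      using c pure_tensor_closed rho_simps(1)[OF *(2,3)] by (simp add: L.f_minus)
    then show "pure_tensor V (g \<otimes> h) v \<ominus>\<^bsub>TG\<^esub> pure_tensor V g (\<rho> h v) \<in> L.ker"
      using c pure_tensor_closed rho_simps(1)[OF *(2,3)] by (simp add: L.ker_def)
  qed
  then show ?thesis using assms(1) by (auto simp: L.ker_def)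
qed

text \<open>The substitution \<open>x \<otimes> v \<mapsto> x h \<otimes> \<rho>(h\<^sup>-\<^sup>1) v\<close>, which does not change classes.\<close>

definition translate :: "'g \<Rightarrow> ('g \<Rightarrow> 'v) \<Rightarrow> 'g \<Rightarrow> 'v"
  where "translate h f = (\<lambda>y. if y \<in> carrier G then \<rho> (inv h) (f (y \<otimes> inv h)) else \<zero>\<^bsub>V\<^esub>)"

lemma inv_H: "h \<in> H \<Longrightarrow> inv h \<in> H" by (rule subgroup.m_inv_closed[OF H])

lemma linear_translate:
  assumes "h \<in> H" shows "linear_map \<complex>\<^sub>F TG TG (translate h)"
proof (rule linear_mapI[OF vectorspace_TG vectorspace_TG])
  note r = rho_simps[OF inv_H[OF assms]]
  fix f assume f: "f \<in> carrier TG"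
  show "translate h f \<in> carrier TG" using f r by (auto simp: translate_def TG_simps(1) TG_value)
  fix c
  have "c \<odot>\<^bsub>V\<^esub> \<zero>\<^bsub>V\<^esub> = \<zero>\<^bsub>V\<^esub>" using V.rmult_0[of c] by simp
  then show "translate h (c \<odot>\<^bsub>TG\<^esub> f) = c \<odot>\<^bsub>TG\<^esub> translate h f"
    using f r by (auto simp: translate_def TG_simps(3) TG_value)
  fix g assume g: "g \<in> carrier TG"
  show "translate h (f \<oplus>\<^bsub>TG\<^esub> g) = translate h f \<oplus>\<^bsub>TG\<^esub> translate h g"
    using f g r by (auto simp: translate_def TG_simps(2) TG_value)
qed

lemma translate_pure_tensor:
  assumes "h \<in> H" "x \<in> carrier G" "v \<in> carrier V"
  shows "translate h (pure_tensor V x v) = pure_tensor V (x \<otimes> h) (\<rho> (inv h) v)"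
proof
  fix y
  have "y \<otimes> inv h = x \<longleftrightarrow> y = x \<otimes> h" if "y \<in> carrier G"
    using inv_solve_right'[of x y h] that assms H_closed[of h] by auto
  moreover have "x \<otimes> h \<in> carrier G" using assms H_closed by simp
  ultimately show "translate h (pure_tensor V x v) y = pure_tensor V (x \<otimes> h) (\<rho> (inv h) v) y"
    using rho_simps[OF inv_H[OF assms(1)]] by (auto simp: translate_def pure_tensor_def)
qed

abbreviation cls :: "('g \<Rightarrow> 'v) \<Rightarrow> ('g \<Rightarrow> 'v) set"
  where "cls f \<equiv> B +>\<^bsub>TG\<^esub> f"

lemma linear_cls: "linear_map \<complex>\<^sub>F TG Ind cls"
  unfolding induced_module_def by (rule linear_map_quot[OF B_subspace])

lemma cls_translate:
  assumes h: "h \<in> H" and f: "f \<in> carrier TG"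
  shows "cls (translate h f) = cls f"
proof (rule linear_map_pure_tensor_eq[OF linear_map_comp[OF linear_translate[OF h] linear_cls] linear_cls _ f])
  fix x v assume x: "x \<in> carrier G" "v \<in> carrier V"
  have xh: "x \<otimes> h \<in> carrier G" "inv h \<in> H" using x H_closed h inv_H by auto
  have "pure_tensor V x v \<ominus>\<^bsub>TG\<^esub> pure_tensor V (x \<otimes> h) (\<rho> (inv h) v) \<in> B"
    using balanced_relation[OF xh x(2)] x H_closed[OF h] by (simp add: m_assoc)
  then have "cls (pure_tensor V x v) = cls (pure_tensor V (x \<otimes> h) (\<rho> (inv h) v))"
    using quot_coset_eq_iff[OF B_subspace] pure_tensor_closed x xh rho_simps by simp
  then show "cls (translate h (pure_tensor V x v)) = cls (pure_tensor V x v)"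
    by (simp add: translate_pure_tensor[OF h x])
qed

text \<open>For the converse, average: \<open>f\<close> is congruent to \<open>translate h f\<close> for all \<open>h\<close> in \<open>H\<close>, hence \<open>|H| f\<close> to the
  sum of all of them, whose value at \<open>y\<close> is the orbit sum of \<open>f\<close> at \<open>y\<close>. Finally divide by \<open>|H|\<close>.\<close>

theorem balanced_iff_orbit_sums_zero:
  assumes f: "f \<in> carrier TG"
  shows "f \<in> B \<longleftrightarrow> (\<forall>y\<in>carrier G. orbit_sum y f = \<zero>\<^bsub>V\<^esub>)"
proof
  assume *: "\<forall>y\<in>carrier G. orbit_sum y f = \<zero>\<^bsub>V\<^esub>"
  interpret I: vectorspace "\<complex>\<^sub>F :: complex ring" Ind by (rule linear_mapD(6)[OF linear_cls])
  note cf = linear_mapD(1)[OF linear_cls f]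
  have tr: "translate h f \<in> carrier TG" if "h \<in> H" for h using linear_mapD(1)[OF linear_translate[OF that] f] .
  have "(\<Oplus>\<^bsub>TG\<^esub>h\<in>H. translate h f) = \<zero>\<^bsub>TG\<^esub>"
  proof
    fix y
    have "(\<Oplus>\<^bsub>TG\<^esub>h\<in>H. translate h f) y = (\<Oplus>\<^bsub>V\<^esub>h\<in>H. translate h f y)"
      by (rule TG_finsum[OF tr])
    also have "\<dots> = \<zero>\<^bsub>V\<^esub>"
    proof (cases "y \<in> carrier G")
      case True
      have "(\<Oplus>\<^bsub>V\<^esub>h\<in>H. translate h f y) = (\<Oplus>\<^bsub>V\<^esub>h\<in>H. \<rho> (inv h) (f (y \<otimes> inv h)))"
        using True f rho_simps inv_H by (intro V.finsum_cong') (auto simp: translate_def TG_value)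
      also have "\<dots> = (\<Oplus>\<^bsub>V\<^esub>h\<in>(\<lambda>h. inv h) ` H. \<rho> h (f (y \<otimes> h)))"
      proof (rule V.finsum_reindex[symmetric])
        show "inj_on (\<lambda>h. inv h) H" by (rule inj_onI) (metis H_closed inv_inv)
      qed (use inv_H f rho_simps TG_value in auto)
      also have "(\<lambda>h. inv h) ` H = H"
        using inv_H H_closed by (auto simp: image_iff) (metis inv_inv)
      finally show ?thesis using * True by (simp add: orbit_sum_def)
    qed (simp add: translate_def)
    finally show "(\<Oplus>\<^bsub>TG\<^esub>h\<in>H. translate h f) y = \<zero>\<^bsub>TG\<^esub> y" by (simp add: TG_simps(4))
  qed
  then have "\<zero>\<^bsub>Ind\<^esub> = cls (\<Oplus>\<^bsub>TG\<^esub>h\<in>H. translate h f)"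
    using linear_mapD(4)[OF linear_cls] by simp
  also have "\<dots> = (\<Oplus>\<^bsub>Ind\<^esub>h\<in>H. cls (translate h f))"
    by (rule linear_map_of_finsum[OF linear_cls finite_H tr])
  also have "\<dots> = (\<Oplus>\<^bsub>Ind\<^esub>h\<in>H. cls f)"
    using cls_translate f cf by (intro I.finsum_cong') auto
  also have "\<dots> = of_nat (card H) \<odot>\<^bsub>Ind\<^esub> cls f"
    by (rule finsum_constant[OF I.vectorspace_axioms finite_H cf])
  finally have 0: "of_nat (card H) \<odot>\<^bsub>Ind\<^esub> cls f = \<zero>\<^bsub>Ind\<^esub>" by simp
  have n: "(of_nat (card H) :: complex) \<noteq> 0"
    using finite_H subgroup.one_closed[OF H] by auto
  have "cls f = (inverse (of_nat (card H)) * of_nat (card H)) \<odot>\<^bsub>Ind\<^esub> cls f"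
    using n I.smult_one[OF cf] by simp
  also have "\<dots> = inverse (of_nat (card H)) \<odot>\<^bsub>Ind\<^esub> (of_nat (card H) \<odot>\<^bsub>Ind\<^esub> cls f)"
    using I.smult_assoc1[OF _ _ cf] by simp
  also have "\<dots> = \<zero>\<^bsub>Ind\<^esub>" unfolding 0 using I.rmult_0 by simp
  finally show "f \<in> B"
    using quot_coset_zero_iff[OF B_subspace f] by (simp add: induced_module_def)
qed (use orbit_sum_balanced in blast)

text \<open>The linear maps that the orbit sums induce on the induced module; they jointly determine an
  element.\<close>

definition component :: "'g \<Rightarrow> ('g \<Rightarrow> 'v) set \<Rightarrow> 'v"
  where "component y = quot_lift (orbit_sum y)"

lemma component_cls: "y \<in> carrier G \<Longrightarrow> f \<in> carrier TG \<Longrightarrow> component y (cls f) = orbit_sum y f"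
  unfolding component_def by (rule quot_lift_coset[OF B_subspace _ linear_orbit_sum]) (auto simp: orbit_sum_balanced)

lemma Ind_carrier: "carrier Ind = cls ` carrier TG"
  unfolding induced_module_def by (rule carrier_quot_module[OF B_subspace])

lemma vectorspace_Ind: "vectorspace \<complex>\<^sub>F Ind"
  unfolding induced_module_def by (rule vectorspace_quot[OF B_subspace])

lemma linear_component: "y \<in> carrier G \<Longrightarrow> linear_map \<complex>\<^sub>F Ind V (component y)"
proof (rule linear_mapI[OF vectorspace_Ind V])
  assume y: "y \<in> carrier G"
  note e = linear_mapD(1-3)[OF linear_orbit_sum[of y]]
  note c = linear_mapD(2,3)[OF linear_cls, symmetric]
  interpret T: vectorspace "\<complex>\<^sub>F :: complex ring" TG by (rule vectorspace_TG)
  have s: "c \<odot>\<^bsub>TG\<^esub> f \<in> carrier TG" if "f \<in> carrier TG" for c f using T.smult_closed[OF _ that] by simp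
  show "x \<in> carrier Ind \<Longrightarrow> component y x \<in> carrier V" for x
    unfolding Ind_carrier using y e by (auto simp: component_cls)
  show "x \<in> carrier Ind \<Longrightarrow> x' \<in> carrier Ind \<Longrightarrow> component y (x \<oplus>\<^bsub>Ind\<^esub> x') = component y x \<oplus>\<^bsub>V\<^esub> component y x'" for x x'
    unfolding Ind_carrier using y e by (auto simp: component_cls c)
  show "x \<in> carrier Ind \<Longrightarrow> component y (k \<odot>\<^bsub>Ind\<^esub> x) = k \<odot>\<^bsub>V\<^esub> component y x" for x k
    unfolding Ind_carrier using y e by (auto simp: component_cls c s)
qed

lemma component_separates:
  assumes "X \<in> carrier Ind" "\<And>y. y \<in> carrier G \<Longrightarrow> component y X = \<zero>\<^bsub>V\<^esub>"
  shows "X = \<zero>\<^bsub>Ind\<^esub>"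
proof -
  obtain f where f: "f \<in> carrier TG" "X = cls f" using assms(1) unfolding Ind_carrier by blast
  then have "f \<in> B" using assms(2) balanced_iff_orbit_sums_zero[OF f(1)] by (simp add: component_cls)
  then show ?thesis using quot_coset_zero_iff[OF B_subspace f(1)] f(2) by (simp add: induced_module_def)
qed

lemma component_ext:
  assumes "X \<in> carrier Ind" "Y \<in> carrier Ind" "\<And>y. y \<in> carrier G \<Longrightarrow> component y X = component y Y"
  shows "X = Y"
proof -
  interpret vectorspace "\<complex>\<^sub>F :: complex ring" Ind by (rule vectorspace_Ind)
  have "X \<ominus>\<^bsub>Ind\<^esub> Y = \<zero>\<^bsub>Ind\<^esub>"
  proof (rule component_separates)
    fix y assume y: "y \<in> carrier G"
    interpret L: linear_map "\<complex>\<^sub>F :: complex ring" Ind V "component y" by (rule linear_component[OF y])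
    show "component y (X \<ominus>\<^bsub>Ind\<^esub> Y) = \<zero>\<^bsub>V\<^esub>" using assms y L.f_im by simp
  qed (use assms in simp)
  then show ?thesis using assms by simp
qed

lemma component_surj:
  assumes "y \<in> carrier G" "v \<in> carrier V"
  obtains X where "X \<in> carrier Ind" "component y X = v"
proof
  have "inv y \<otimes> y \<in> H" using assms subgroup.one_closed[OF H] by simp
  then show "component y (cls (pure_tensor V y v)) = v"
    using assms by (simp add: component_cls pure_tensor_closed orbit_sum_pure_tensor rho(2))
  show "cls (pure_tensor V y v) \<in> carrier Ind" using assms pure_tensor_closed unfolding Ind_carrier by blast
qed

lemma orbit_sum_mult:
  assumes "y \<in> carrier G" "h \<in> H" "f \<in> carrier TG"
  shows "orbit_sum (y \<otimes> h) f = \<rho> (inv h) (orbit_sum y f)"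
proof -
  interpret L: linear_map "\<complex>\<^sub>F :: complex ring" V V "\<rho> (inv h)" by (rule rho(1)[OF inv_H[OF assms(2)]])
  have "\<rho> (inv h) (orbit_sum y f) = orbit_sum (y \<otimes> h) f"
  proof (rule linear_map_pure_tensor_eq[OF linear_map_comp[OF linear_orbit_sum rho(1)[OF inv_H[OF assms(2)]]]
        linear_orbit_sum _ assms(3)])
    fix x v assume x: "x \<in> carrier G" "v \<in> carrier V"
    note c = x assms(1) H_closed[OF assms(2)]
    have eq: "inv (y \<otimes> h) \<otimes> x = inv h \<otimes> (inv y \<otimes> x)" using c by (simp add: inv_mult_group m_assoc)
    have "inv h \<otimes> (inv y \<otimes> x) \<in> H \<longleftrightarrow> inv y \<otimes> x \<in> H"
    proof
      assume a: "inv h \<otimes> (inv y \<otimes> x) \<in> H"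
      have "inv y \<otimes> x = h \<otimes> (inv h \<otimes> (inv y \<otimes> x))"
        using c by (simp add: m_assoc[symmetric])
      then show "inv y \<otimes> x \<in> H" using subgroup.m_closed[OF H assms(2) a] by simp
    qed (rule subgroup.m_closed[OF H inv_H[OF assms(2)]])
    then show "\<rho> (inv h) (orbit_sum y (pure_tensor V x v)) = orbit_sum (y \<otimes> h) (pure_tensor V x v)"
      using c rho(3)[OF inv_H[OF assms(2)]] by (auto simp: orbit_sum_pure_tensor eq)
  qed
  then show ?thesis by simp
qed

lemma component_mult:
  assumes "y \<in> carrier G" "h \<in> H" "X \<in> carrier Ind"
  shows "component (y \<otimes> h) X = \<rho> (inv h) (component y X)"
  using assms orbit_sum_mult H_closed unfolding Ind_carrier by (auto simp: component_cls)

definition shift :: "'g \<Rightarrow> ('g \<Rightarrow> 'v) \<Rightarrow> 'g \<Rightarrow> 'v"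
  where "shift x f = (\<lambda>g. if g \<in> carrier G then f (inv x \<otimes> g) else \<zero>\<^bsub>V\<^esub>)"

lemma smult_zero: "c \<odot>\<^bsub>V\<^esub> \<zero>\<^bsub>V\<^esub> = \<zero>\<^bsub>V\<^esub>" using V.rmult_0[of c] by simp

lemma linear_shift: "linear_map \<complex>\<^sub>F TG TG (shift x)"
  by (rule linear_mapI[OF vectorspace_TG vectorspace_TG])
    (auto simp: shift_def TG_simps(2-) TG_value smult_zero, auto simp: TG_simps(1) TG_value)

lemma orbit_sum_shift:
  assumes "x \<in> carrier G" "y \<in> carrier G" "f \<in> carrier TG"
  shows "orbit_sum y (shift x f) = orbit_sum (inv x \<otimes> y) f"
  unfolding orbit_sum_def using assms H_closed rho_simps
  by (intro V.finsum_cong') (auto simp: shift_def m_assoc TG_value)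

lemma quot_map_Ind:
  assumes \<phi>: "linear_map \<complex>\<^sub>F TG TG \<phi>" and N: "\<And>f. f \<in> B \<Longrightarrow> \<phi> f \<in> B"
  shows "linear_map \<complex>\<^sub>F Ind Ind (quot_map TG B \<phi>)"
    and "f \<in> carrier TG \<Longrightarrow> quot_map TG B \<phi> (cls f) = cls (\<phi> f)"
  using linear_map_quot_map[OF B_subspace \<phi> N] quot_map_coset[OF B_subspace _ \<phi> N]
  by (simp_all add: induced_module_def)

lemma shift_B: "x \<in> carrier G \<Longrightarrow> f \<in> B \<Longrightarrow> shift x f \<in> B"
  using balanced_iff_orbit_sums_zero[OF linear_mapD(1)[OF linear_shift B_closed]]
  by (simp add: orbit_sum_shift B_closed orbit_sum_balanced)

abbreviation "ind_act \<equiv> induced_action G H V \<rho>"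

lemma ind_act_shift: "ind_act x = quot_map TG B (shift x)"
  by (simp add: induced_action_def shift_def[abs_def])

lemma linear_ind_act: "x \<in> carrier G \<Longrightarrow> linear_map \<complex>\<^sub>F Ind Ind (ind_act x)"
  unfolding ind_act_shift by (rule quot_map_Ind[OF linear_shift shift_B])

lemma component_ind_act:
  assumes "x \<in> carrier G" "y \<in> carrier G" "X \<in> carrier Ind"
  shows "component y (ind_act x X) = component (inv x \<otimes> y) X"
proof -
  obtain f where f: "f \<in> carrier TG" "X = cls f" using assms(3) unfolding Ind_carrier by blast
  then show ?thesis
    using assms quot_map_Ind(2)[OF linear_shift shift_B[OF assms(1)] f(1)] linear_mapD(1)[OF linear_shift f(1)]
    by (simp add: ind_act_shift component_cls orbit_sum_shift)
qed

theorem representation_induced: "representation G Ind ind_act"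
  unfolding representation_def
proof (intro conjI ballI)
  show "ind_act \<one> X = X" if "X \<in> carrier Ind" for X
    by (rule component_ext) (use that linear_mapD(1)[OF linear_ind_act] in \<open>auto simp: component_ind_act\<close>)
  show "ind_act (g \<otimes> h) X = ind_act g (ind_act h X)"
    if "g \<in> carrier G" "h \<in> carrier G" "X \<in> carrier Ind" for g h X
    by (rule component_ext)
      (use that linear_mapD(1)[OF linear_ind_act] in \<open>auto simp: component_ind_act inv_mult_group m_assoc\<close>)
qed (auto simp: vectorspace_Ind linear_ind_act)

text \<open>The coaction of a Yetter-Drinfeld module. The degree \<open>y s y\<^sup>-\<^sup>1\<close> is constant on cosets of the
  centralizer, so a component either survives unchanged or vanishes.\<close>

context
  fixes s assumes s: "s \<in> carrier G" and H_cent: "H = centralizer G s"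
begin

definition restrict_class :: "'g \<Rightarrow> ('g \<Rightarrow> 'v) \<Rightarrow> 'g \<Rightarrow> 'v"
  where "restrict_class t f = (\<lambda>h. if h \<in> carrier G \<and> h \<otimes> s \<otimes> inv h = t then f h else \<zero>\<^bsub>V\<^esub>)"

lemma linear_restrict_class: "linear_map \<complex>\<^sub>F TG TG (restrict_class t)"
  by (rule linear_mapI[OF vectorspace_TG vectorspace_TG])
    (auto simp: restrict_class_def TG_simps(2-) TG_value smult_zero, auto simp: TG_simps(1) TG_value)

lemma orbit_sum_restrict_class:
  assumes "y \<in> carrier G" "f \<in> carrier TG"
  shows "orbit_sum y (restrict_class t f) = (if y \<otimes> s \<otimes> inv y = t then orbit_sum y f else \<zero>\<^bsub>V\<^esub>)"
proof -
  have *: "(y \<otimes> h) \<otimes> s \<otimes> inv (y \<otimes> h) = y \<otimes> s \<otimes> inv y" if "h \<in> H" for h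
  proof -
    have h: "h \<in> carrier G" "h \<otimes> s = s \<otimes> h" using that by (auto simp: H_cent centralizer_def)
    have "(y \<otimes> h) \<otimes> s \<otimes> inv (y \<otimes> h) = y \<otimes> (h \<otimes> s) \<otimes> inv h \<otimes> inv y"
      using h(1) assms s by (simp add: inv_mult_group m_assoc)
    also have "\<dots> = y \<otimes> s \<otimes> inv y" unfolding h(2) using h(1) assms s by (simp add: m_assoc)
    finally show ?thesis .
  qed
  show ?thesis
  proof (cases "y \<otimes> s \<otimes> inv y = t")
    case True
    then show ?thesis unfolding orbit_sum_def using * assms rho_simps H_closed
      by (auto intro!: V.finsum_cong' simp: restrict_class_def TG_value)
  next
    case False
    then have "orbit_sum y (restrict_class t f) = (\<Oplus>\<^bsub>V\<^esub>h\<in>H. \<zero>\<^bsub>V\<^esub>)" unfolding orbit_sum_def using * rho_simps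
      by (auto intro!: V.finsum_cong' simp: restrict_class_def)
    then show ?thesis using False by simp
  qed
qed

lemma restrict_class_B: "f \<in> B \<Longrightarrow> restrict_class t f \<in> B"
  using balanced_iff_orbit_sums_zero[OF linear_mapD(1)[OF linear_restrict_class B_closed]]
  by (simp add: orbit_sum_restrict_class B_closed orbit_sum_balanced)

lemma yd_coaction_eq: "yd_coaction G s V \<rho> t = quot_map TG B (restrict_class t)"
  by (simp add: yd_coaction_def restrict_class_def[abs_def] H_cent)

lemma linear_yd_coaction: "linear_map \<complex>\<^sub>F Ind Ind (yd_coaction G s V \<rho> t)"
  unfolding yd_coaction_eq by (rule quot_map_Ind[OF linear_restrict_class restrict_class_B])

lemma component_yd_coaction:
  assumes "y \<in> carrier G" "X \<in> carrier Ind"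
  shows "component y (yd_coaction G s V \<rho> t X) = (if y \<otimes> s \<otimes> inv y = t then component y X else \<zero>\<^bsub>V\<^esub>)"
proof -
  obtain f where f: "f \<in> carrier TG" "X = cls f" using assms(2) unfolding Ind_carrier by blast
  then show ?thesis
    using assms quot_map_Ind(2)[OF linear_restrict_class restrict_class_B f(1)]
      linear_mapD(1)[OF linear_restrict_class f(1)]
    by (simp add: yd_coaction_eq component_cls orbit_sum_restrict_class)
qed

end

end

section \<open>Yetter-Drinfeld modules with diagonal braiding\<close>

text \<open>The module \<open>M(O\<^sub>s, \<theta>)\<close>, where \<open>\<theta>\<close> is induced to the centralizer of \<open>s\<close> from a subgroup \<open>H'\<close> that contains all
  conjugates of \<open>s\<close>, on which these act by scalars. For a class in an abelian normal subgroup \<open>A\<close>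
  and a representation induced from an extension of a character of \<open>A\<close>, this is always so.\<close>

locale class_induced = group G for G :: "('g, 'x) monoid_scheme" (structure) +
  fixes s :: 'g and H' :: "'g set" and V :: "(complex, 'v) module" and \<rho> :: "'g \<Rightarrow> 'v \<Rightarrow> 'v"
    and braid_coeff :: "'g \<Rightarrow> 'g \<Rightarrow> complex"
  assumes fin: "finite (carrier G)" and s: "s \<in> carrier G"
    and H': "subgroup H' (centralizer_group G s)"
    and rep': "representation (G\<lparr>carrier := H'\<rparr>) V \<rho>"
    and V_fin_dim: "vectorspace.fin_dim \<complex>\<^sub>F V" and V_nonzero: "carrier V \<noteq> {\<zero>\<^bsub>V\<^esub>}"
    and conj_H': "\<And>k k'. k \<in> carrier G \<Longrightarrow> k' \<in> carrier G \<Longrightarrow> inv k' \<otimes> (k \<otimes> s \<otimes> inv k) \<otimes> k' \<in> H'"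
    and conj_scalar: "\<And>k k' v. k \<in> carrier G \<Longrightarrow> k' \<in> carrier G \<Longrightarrow> v \<in> carrier V \<Longrightarrow>
        \<rho> (inv k' \<otimes> (k \<otimes> s \<otimes> inv k) \<otimes> k') v = braid_coeff k k' \<odot>\<^bsub>V\<^esub> v"
begin

abbreviation "H \<equiv> centralizer G s"

lemma centralizer_subgroup: "subgroup H G"
proof (rule subgroupI)
  show "H \<noteq> {}" using s by (auto simp: centralizer_def intro: exI[of _ \<one>])
  fix a b assume a: "a \<in> H" and b: "b \<in> H"
  have a': "a \<in> carrier G" "a \<otimes> s = s \<otimes> a" and b': "b \<in> carrier G" "b \<otimes> s = s \<otimes> b"
    using a b by (auto simp: centralizer_def)
  have "inv a \<otimes> s = inv a \<otimes> (s \<otimes> a \<otimes> inv a)" using a' s by (simp add: m_assoc)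
  also have "\<dots> = inv a \<otimes> (a \<otimes> s \<otimes> inv a)" by (simp only: a'(2))
  also have "\<dots> = s \<otimes> inv a" using a'(1) s by (simp add: m_assoc[symmetric])
  finally show "inv a \<in> H" using a' by (simp add: centralizer_def)
  have "a \<otimes> b \<otimes> s = a \<otimes> (b \<otimes> s)" using a' b' s by (simp add: m_assoc)
  also have "\<dots> = a \<otimes> s \<otimes> b" unfolding b'(2) using a'(1) b'(1) s by (simp add: m_assoc)
  also have "\<dots> = s \<otimes> (a \<otimes> b)" unfolding a'(2) using a'(1) b'(1) s by (simp add: m_assoc)
  finally show "a \<otimes> b \<in> H" using a' b' by (simp add: centralizer_def)
qed (auto simp: centralizer_def)

sublocale inner: induced "centralizer_group G s" H' V \<rho>
proof -
  have "group (centralizer_group G s)" by (rule subgroup.subgroup_is_group[OF centralizer_subgroup is_group])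
  then show "induced (centralizer_group G s) H' V \<rho>"
    unfolding induced_def induced_axioms_def
    using H' rep' finite_subset[OF subgroup.subset[OF centralizer_subgroup] fin] by simp
qed

sublocale outer: induced G H inner.Ind inner.ind_act
  by (intro induced.intro induced_axioms.intro is_group fin centralizer_subgroup
      inner.representation_induced)

lemma inv_H: "h \<in> H \<Longrightarrow> inv\<^bsub>centralizer_group G s\<^esub> h = inv h"
  by (rule m_inv_consistent[OF centralizer_subgroup])

lemma H'_H: "h \<in> H' \<Longrightarrow> h \<in> H" using subgroup.subset[OF H'] by auto

text \<open>The composite of the components of both inductions. It suffices to take the inner one at 1, because
  the other ones are obtained from other \<open>k\<close> in the same coset of the centralizer.\<close>

abbreviation "evaluate k X \<equiv> inner.component \<one> (outer.component k X)"

lemma one_H: "\<one> \<in> H" by (rule subgroup.one_closed[OF centralizer_subgroup])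

lemma linear_evaluate: "k \<in> carrier G \<Longrightarrow> linear_map \<complex>\<^sub>F outer.Ind V (evaluate k)"
  using linear_map_comp[OF outer.linear_component inner.linear_component] one_H by simp

lemma evaluate_separates:
  assumes X: "X \<in> carrier outer.Ind" and 0: "\<And>k. k \<in> carrier G \<Longrightarrow> evaluate k X = \<zero>\<^bsub>V\<^esub>"
  shows "X = \<zero>\<^bsub>outer.Ind\<^esub>"
proof (rule outer.component_separates[OF X])
  fix k assume k: "k \<in> carrier G"
  have Z: "outer.component k X \<in> carrier inner.Ind" using linear_mapD(1)[OF outer.linear_component[OF k] X] .
  show "outer.component k X = \<zero>\<^bsub>inner.Ind\<^esub>"
  proof (rule inner.component_separates[OF Z])
    fix y assume "y \<in> carrier (centralizer_group G s)"
    then have y: "y \<in> H" "inv y \<in> H" "y \<in> carrier G"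
      using subgroup.m_inv_closed[OF centralizer_subgroup] subgroup.subset[OF centralizer_subgroup] by auto
    have "evaluate (k \<otimes> y) X = inner.component \<one> (inner.ind_act (inv y) (outer.component k X))"
      by (simp add: outer.component_mult[OF k y(1) X])
    also have "\<dots> = inner.component y (outer.component k X)"
      using inner.component_ind_act[of "inv y" \<one>, OF _ _ Z] y one_H by (simp add: inv_H)
    finally show "inner.component y (outer.component k X) = \<zero>\<^bsub>V\<^esub>" using 0[of "k \<otimes> y"] k y by simp
  qed
qed

lemma evaluate_surj:
  assumes "k \<in> carrier G" "u \<in> carrier V"
  obtains X where "X \<in> carrier outer.Ind" "evaluate k X = u"
proof -
  obtain Z where Z: "Z \<in> carrier inner.Ind" "inner.component \<one> Z = u"
    using inner.component_surj[of \<one> u] assms one_H by auto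
  then show ?thesis using outer.component_surj[OF assms(1) Z(1)] that by metis
qed

abbreviation "grade k \<equiv> k \<otimes> s \<otimes> inv k"

text \<open>Move \<open>g = k s k\<^sup>-\<^sup>1\<close> past \<open>k'\<close>: as \<open>g\<^sup>-\<^sup>1 k' = k' h\<^sup>-\<^sup>1\<close> with \<open>h = k'\<^sup>-\<^sup>1 g k'\<close> in \<open>H'\<close>, the action
  becomes that of \<open>h\<close> on \<open>V\<close>, which is a scalar.\<close>

lemma evaluate_act:
  assumes k: "k \<in> carrier G" and k': "k' \<in> carrier G" and X: "X \<in> carrier outer.Ind"
  shows "evaluate k' (outer.ind_act (grade k) X) = braid_coeff k k' \<odot>\<^bsub>V\<^esub> evaluate k' X"
proof -
  define h where "h = inv k' \<otimes> grade k \<otimes> k'"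
  have h: "h \<in> H'" "h \<in> H" "h \<in> carrier G" "inv h \<in> H" "inv h \<in> H'"
  proof -
    show "h \<in> H'" unfolding h_def by (rule conj_H'[OF k k'])
    then show "h \<in> H" "h \<in> carrier G" "inv h \<in> H"
      using H'_H subgroup.subset[OF centralizer_subgroup] subgroup.m_inv_closed[OF centralizer_subgroup] by auto
    then show "inv h \<in> H'" using inner.inv_H[OF \<open>h \<in> H'\<close>] by (simp add: inv_H)
  qed
  have g: "grade k \<in> carrier G" using k s by simp
  have "inv (grade k) \<otimes> k' = k' \<otimes> inv h"
    unfolding h_def using g k' by (simp add: inv_mult_group m_assoc[symmetric])
  then have "evaluate k' (outer.ind_act (grade k) X) = evaluate (k' \<otimes> inv h) X"
    by (simp add: outer.component_ind_act[OF g k' X])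
  also have "\<dots> = inner.component \<one> (inner.ind_act h (outer.component k' X))"
    using outer.component_mult[OF k' h(4) X] h by simp
  also have "\<dots> = inner.component (inv h) (outer.component k' X)"
    using inner.component_ind_act[of h \<one>] linear_mapD(1)[OF outer.linear_component[OF k'] X] h one_H
    by (simp add: inv_H)
  also have "\<dots> = \<rho> h (evaluate k' X)"
    using inner.component_mult[of \<one> "inv h"] linear_mapD(1)[OF outer.linear_component[OF k'] X] h one_H
    by (simp add: inv_H)
  also have "\<dots> = braid_coeff k k' \<odot>\<^bsub>V\<^esub> evaluate k' X"
    unfolding h_def using conj_scalar[OF k k'] linear_mapD(1)[OF linear_evaluate[OF k'] X] by simp
  finally show ?thesis .
qed

lemma evaluate_coaction:
  assumes "k \<in> carrier G" "X \<in> carrier outer.Ind"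
  shows "evaluate k (yd_coaction G s inner.Ind inner.ind_act t X) =
    (if grade k = t then evaluate k X else \<zero>\<^bsub>V\<^esub>)"
proof -
  have "inner.component \<one> \<zero>\<^bsub>inner.Ind\<^esub> = \<zero>\<^bsub>V\<^esub>"
    by (rule linear_mapD(4)[OF inner.linear_component]) (simp add: one_H)
  then show ?thesis unfolding outer.component_yd_coaction[OF s refl assms]
    by (simp only: if_distrib if_cancel split: if_split) simp
qed

abbreviation "Nich \<equiv> nichols_algebra_of_class G s inner.Ind inner.ind_act"

text \<open>The coordinates are the functionals \<open>\<eta>\<^sub>b \<circ> evaluate k\<close>, with \<open>\<eta>\<close> separating points of \<open>V\<close>. This family
  is redundant, so a coordinate system is selected from it. For elements \<open>k\<close> with different degrees
  and a fixed \<open>\<eta>\<^sub>e\<close> the functionals are independent, as the coaction separates them; they can all be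
  kept, which is how a triangle is placed inside a coordinate system.\<close>

lemma nichols_diagonal:
  assumes K: "K \<subseteq> carrier G" and inj: "inj_on grade K"
  obtains I and \<xi> :: "'g \<times> 'v \<Rightarrow> _" and v e
  where "diagonal_braiding G outer.Ind outer.ind_act (yd_coaction G s inner.Ind inner.ind_act)
      I \<xi> v (\<lambda>(k, _). grade k) (\<lambda>(k, _) (k', _). braid_coeff k k')"
    "I \<subseteq> carrier G \<times> UNIV" "K \<times> {e} \<subseteq> I"
proof -
  from fin_dim_separating_functionals[OF inner.V V_fin_dim]
  obtain \<beta> :: "'v set" and \<eta> where \<beta>: "finite \<beta>" "\<forall>b\<in>\<beta>. linear_functional V (\<eta> b)"
    "\<forall>x\<in>carrier V. (\<forall>b\<in>\<beta>. \<eta> b x = 0) \<longrightarrow> x = \<zero>\<^bsub>V\<^esub>"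
    by (elim exE conjE)
  note \<eta> = bspec[OF \<beta>(2)]
  obtain e u where e: "e \<in> \<beta>" "u \<in> carrier V" "\<eta> e u = 1"
  proof -
    obtain x where x: "x \<in> carrier V" "x \<noteq> \<zero>\<^bsub>V\<^esub>" using V_nonzero inner.V.M.zero_closed by blast
    then obtain b where b: "b \<in> \<beta>" "\<eta> b x \<noteq> 0" using \<beta>(3) by blast
    show ?thesis
      using that[OF b(1), of "inverse (\<eta> b x) \<odot>\<^bsub>V\<^esub> x"] x(1) b linear_functionalD(2)[OF \<eta>[OF b(1)] x(1)]
      by simp
  qed
  define \<xi> where "\<xi> = (\<lambda>(k, b) X. \<eta> b (evaluate k X))"
  let ?\<delta> = "yd_coaction G s inner.Ind inner.ind_act"
  have lin\<delta>: "linear_map \<complex>\<^sub>F outer.Ind outer.Ind (?\<delta> t)" for t by (rule outer.linear_yd_coaction[OF s refl])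
  have lin: "linear_functional outer.Ind (\<xi> i)" if "i \<in> carrier G \<times> \<beta>" for i
    using that linear_functional_comp[OF linear_evaluate \<eta>] by (auto simp: \<xi>_def)
  have co: "\<xi> i (?\<delta> t X) = (if t = grade (fst i) then \<xi> i X else 0)"
    if "i \<in> carrier G \<times> \<beta>" "X \<in> carrier outer.Ind" for i t X
    using that linear_functional_zero[OF inner.V \<eta>] by (auto simp: \<xi>_def evaluate_coaction)
  have "\<exists>X. X \<in> carrier outer.Ind \<and> evaluate k X = u" if k: "k \<in> carrier G" for k
    by (rule evaluate_surj[OF k e(2)]) blast
  then obtain X where X: "\<And>k. k \<in> carrier G \<Longrightarrow> X k \<in> carrier outer.Ind"
      "\<And>k. k \<in> carrier G \<Longrightarrow> evaluate k (X k) = u"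
    using bchoice[of "carrier G" "\<lambda>k X. X \<in> carrier outer.Ind \<and> evaluate k X = u"] by blast
  define v0 where "v0 = (\<lambda>(k, b :: 'v). ?\<delta> (grade k) (X k))"
  let ?I0 = "K \<times> {e}"
  have "\<exists>I v. ?I0 \<subseteq> I \<and> I \<subseteq> ?I0 \<union> carrier G \<times> \<beta> \<and> (\<forall>i\<in>I. v i \<in> carrier outer.Ind) \<and>
    (\<forall>i\<in>I. \<forall>j\<in>I. \<xi> i (v j) = (if i = j then 1 else 0)) \<and>
    (\<forall>x\<in>carrier outer.Ind. (\<forall>i\<in>I. \<xi> i x = 0) \<longrightarrow> (\<forall>i\<in>?I0 \<union> carrier G \<times> \<beta>. \<xi> i x = 0))"
  proof (rule extend_dual_system[OF outer.vectorspace_Ind])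
    show "finite (carrier G \<times> \<beta>)" using fin \<beta>(1) by simp
    show "linear_functional outer.Ind (\<xi> i)" if "i \<in> ?I0 \<union> carrier G \<times> \<beta>" for i
      using that K e(1) by (intro lin) auto
    show "v0 i \<in> carrier outer.Ind" if "i \<in> ?I0" for i
      using that K X(1) linear_mapD(1)[OF lin\<delta>] by (auto simp: v0_def)
    show "\<xi> i (v0 j) = (if i = j then 1 else 0)" if ij: "i \<in> ?I0" "j \<in> ?I0" for i j
    proof -
      obtain k k' where k: "k \<in> K" "k' \<in> K" "i = (k, e)" "j = (k', e)" using ij by auto
      have kG: "k \<in> carrier G" "k' \<in> carrier G" using k K by auto
      have "\<xi> i (v0 j) = (if grade k' = grade k then \<xi> i (X k') else 0)"
        using co[of i "X k'"] kG e(1) X(1) k by (simp add: v0_def)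
      also have "\<dots> = (if i = j then 1 else 0)"
        using inj_onD[OF inj _ k(1,2)] k(3,4) X(2) kG e(3) by (auto simp: \<xi>_def)
      finally show ?thesis .
    qed
  qed
  then obtain I v where I: "?I0 \<subseteq> I" "I \<subseteq> ?I0 \<union> carrier G \<times> \<beta>" "\<forall>i\<in>I. v i \<in> carrier outer.Ind"
    "\<forall>i\<in>I. \<forall>j\<in>I. \<xi> i (v j) = (if i = j then 1 else 0)"
    "\<forall>x\<in>carrier outer.Ind. (\<forall>i\<in>I. \<xi> i x = 0) \<longrightarrow> (\<forall>i\<in>?I0 \<union> carrier G \<times> \<beta>. \<xi> i x = 0)"
    by (elim exE conjE)
  have I': "I \<subseteq> carrier G \<times> \<beta>" using I(2) K e(1) by auto
  have "diagonal_braiding G outer.Ind outer.ind_act ?\<delta> I \<xi> v (\<lambda>(k, _). grade k) (\<lambda>(k, _) (k', _). braid_coeff k k')"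
  proof (rule diagonal_braiding.intro)
    show "vectorspace \<complex>\<^sub>F outer.Ind" by (rule outer.vectorspace_Ind)
    show "finite (carrier G)" by (rule fin)
    show "finite I" using I' fin \<beta>(1) finite_subset by blast
    show "outer.ind_act g x \<in> carrier outer.Ind" if "g \<in> carrier G" "x \<in> carrier outer.Ind" for g x
      using linear_mapD(1)[OF outer.linear_ind_act] that by blast
    show "?\<delta> g x \<in> carrier outer.Ind" if "x \<in> carrier outer.Ind" for g x
      using linear_mapD(1)[OF lin\<delta>] that by blast
    show "x = \<zero>\<^bsub>outer.Ind\<^esub>" if x: "x \<in> carrier outer.Ind" and 0: "\<And>i. i \<in> I \<Longrightarrow> \<xi> i x = 0" for x
    proof (rule evaluate_separates[OF x])
      fix k assume k: "k \<in> carrier G"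
      have "\<forall>i\<in>?I0 \<union> carrier G \<times> \<beta>. \<xi> i x = 0" using I(5) x 0 by blast
      then have "\<eta> b (evaluate k x) = 0" if "b \<in> \<beta>" for b
        using k that by (force simp: \<xi>_def)
      then show "evaluate k x = \<zero>\<^bsub>V\<^esub>"
        using \<beta>(3) linear_mapD(1)[OF linear_evaluate[OF k] x] by blast
    qed
    show "\<xi> j (outer.ind_act (case i of (k, _) \<Rightarrow> grade k) x) =
       (case i of (k, _) \<Rightarrow> \<lambda>(k', _). braid_coeff k k') j * \<xi> j x"
      if "i \<in> I" "j \<in> I" "x \<in> carrier outer.Ind" for i j x
    proof -
      obtain k b k' b' where *: "i = (k, b)" "j = (k', b')" by fastforce
      then have "k \<in> carrier G" "k' \<in> carrier G" "b' \<in> \<beta>" using that I' by auto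
      then show ?thesis
        using linear_functionalD(2)[OF \<eta>] linear_mapD(1)[OF linear_evaluate that(3)] that(3)
        by (simp add: * \<xi>_def evaluate_act)
    qed
    show "(case i of (k, _) \<Rightarrow> grade k) \<in> carrier G" if "i \<in> I" for i using that I' s by auto
    show "\<xi> i (?\<delta> g x) = (if g = (case i of (k, _) \<Rightarrow> grade k) then \<xi> i x else 0)"
      if "i \<in> I" "x \<in> carrier outer.Ind" for i g x
      using co[of i x g] that I' by (auto simp: case_prod_unfold)
    show "\<xi> i (x \<oplus>\<^bsub>outer.Ind\<^esub> y) = \<xi> i x + \<xi> i y"
      if "i \<in> I" "x \<in> carrier outer.Ind" "y \<in> carrier outer.Ind" for i x y
      using linear_functionalD(1)[OF lin] that I' by blast
    show "\<xi> i (c \<odot>\<^bsub>outer.Ind\<^esub> x) = c * \<xi> i x" if "i \<in> I" "x \<in> carrier outer.Ind" for i c x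
      using linear_functionalD(2)[OF lin] that I' by blast
    show "v i \<in> carrier outer.Ind" if "i \<in> I" for i using I(3) that by blast
    show "\<xi> i (v j) = (if i = j then 1 else 0)" if "i \<in> I" "j \<in> I" for i j using I(4) that by blast
  qed
  moreover have "I \<subseteq> carrier G \<times> UNIV" using I' by blast
  ultimately show ?thesis by (rule that[OF _ _ I(1)])
qed

lemma Nich_eq: "Nich = nichols_algebra G outer.Ind outer.ind_act (yd_coaction G s inner.Ind inner.ind_act)"
  by (simp add: nichols_algebra_of_class_def yd_module_def yd_action_def[abs_def])

theorem fin_dim_class_nichols:
  assumes "\<And>k. k \<in> carrier G \<Longrightarrow> braid_coeff k k = -1"
    and "\<And>k k'. k \<in> carrier G \<Longrightarrow> k' \<in> carrier G \<Longrightarrow> braid_coeff k k' * braid_coeff k' k = 1"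
  shows "vectorspace.fin_dim \<complex>\<^sub>F Nich"
proof -
  obtain I and \<xi> :: "'g \<times> 'v \<Rightarrow> _" and v e where D: "diagonal_braiding G outer.Ind outer.ind_act
      (yd_coaction G s inner.Ind inner.ind_act)
      I \<xi> v (\<lambda>(k, _). grade k) (\<lambda>(k, _) (k', _). braid_coeff k k')" "I \<subseteq> carrier G \<times> UNIV"
    by (rule nichols_diagonal[of "{}"]) simp_all
  have I: "fst i \<in> carrier G" if "i \<in> I" for i using D(2) that by auto
  show ?thesis unfolding Nich_eq
    by (rule diagonal_braiding.fin_dim_nichols_if_quantum_linear_space[OF D(1)]) (simp_all add: case_prod_unfold assms I)
qed

theorem not_fin_dim_class_nichols_if_eq_1:
  assumes "braid_coeff \<one> \<one> = 1"
  shows "\<not> vectorspace.fin_dim \<complex>\<^sub>F Nich"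
proof -
  obtain I and \<xi> :: "'g \<times> 'v \<Rightarrow> _" and v e where D: "diagonal_braiding G outer.Ind outer.ind_act
      (yd_coaction G s inner.Ind inner.ind_act)
      I \<xi> v (\<lambda>(k, _). grade k) (\<lambda>(k, _) (k', _). braid_coeff k k')" "{\<one>} \<times> {e} \<subseteq> I"
    by (rule nichols_diagonal[of "{\<one>}"]) simp_all
  show ?thesis unfolding Nich_eq
    by (rule diagonal_braiding.not_fin_dim_nichols_if_eq_1[OF D(1), of "(\<one>, e)"]) (use D(2) assms in auto)
qed

theorem not_fin_dim_class_nichols_if_triangle:
  assumes k: "i \<in> carrier G" "j \<in> carrier G" "l \<in> carrier G"
    and dist: "grade i \<noteq> grade j" "grade i \<noteq> grade l" "grade j \<noteq> grade l"
    and tri: "triangle braid_coeff c i j l"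
  shows "\<not> vectorspace.fin_dim \<complex>\<^sub>F Nich"
proof -
  have inj: "inj_on grade {i, j, l}" using dist dist[symmetric] by (auto simp: inj_on_def)
  obtain I and \<xi> :: "'g \<times> 'v \<Rightarrow> _" and v e where D: "diagonal_braiding G outer.Ind outer.ind_act
      (yd_coaction G s inner.Ind inner.ind_act)
      I \<xi> v (\<lambda>(k, _). grade k) (\<lambda>(k, _) (k', _). braid_coeff k k')" "{i, j, l} \<times> {e} \<subseteq> I"
    by (rule nichols_diagonal[OF _ inj]) (use k in simp_all)
  have "triangle (\<lambda>(k, _) (k', _). braid_coeff k k') c (i, e) (j, e) (l, e)"
    using tri by (simp add: triangle_def)
  then show ?thesis unfolding Nich_eq
    by (intro diagonal_braiding.not_fin_dim_nichols_if_triangle[OF D(1)]) (use D(2) in auto)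
qed

end

section \<open>The groups \<open>A \<rtimes> S\<^sub>n\<close>\<close>

text \<open>The default rules rewrite sums and products of bits to bitwise operations, for which the ring laws
  are not available, and 1 to \<open>Suc 0\<close> in \<open>{1..n}\<close>.\<close>

declare add_bit_eq_xor [simp del] mult_bit_eq_and [simp del] One_nat_def [simp del]

lemma bit_add_self: "x + x = (0 :: bit)"
  by (cases "x = 0") auto

lemma bit_of_nat: "(of_nat m :: bit) = (if even m then 0 else 1)"
  by (induction m) auto

lemma perm_act_id: "perm_act id x = x"
  by (simp add: perm_act_def)

lemma perm_act_comp:
  assumes "p permutes S" "r permutes T"
  shows "perm_act (p \<circ> r) x = perm_act p (perm_act r x)"
proof -
  have "inv' (p \<circ> r) = inv' r \<circ> inv' p"
    using assms by (intro o_inv_distrib permutes_bij)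
  then show ?thesis by (simp add: perm_act_def)
qed

lemma perm_act_inv:
  assumes "p permutes S"
  shows "perm_act (inv' p) (perm_act p x) = x" "perm_act p (perm_act (inv' p) x) = x"
  using perm_act_comp[OF permutes_inv[OF assms] assms, of x] perm_act_comp[OF assms permutes_inv[OF assms], of x]
  by (simp_all add: permutes_inv_o[OF assms] perm_act_id)

lemma perm_act_add: "perm_act p (\<lambda>i. x i + y i) = (\<lambda>i. perm_act p x i + perm_act p y i)"
  by (simp add: perm_act_def)

definition sign_bit :: "bit \<Rightarrow> complex" where "sign_bit z = (if z = 0 then 1 else -1)"

lemma sign_bit_add: "sign_bit (x + y) = sign_bit x * sign_bit y"
  by (cases "x = 0"; cases "y = 0") (auto simp: sign_bit_def)

locale stable_subgroup =
  fixes n :: nat and A :: "(nat \<Rightarrow> bit) set"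
  assumes A: "subgroup A (bit_group n)"
    and stable: "\<And>h x. h \<in> carrier (sym_group n) \<Longrightarrow> x \<in> A \<Longrightarrow> perm_act h x \<in> A"
begin

abbreviation "G \<equiv> semidirect n A"

lemma A_simps:
  "x \<in> A \<Longrightarrow> y \<in> A \<Longrightarrow> (\<lambda>i. x i + y i) \<in> A" "(\<lambda>i. 0) \<in> A" "A \<subseteq> carrier (bit_group n)"
  using subgroup.m_closed[OF A] subgroup.one_closed[OF A] subgroup.subset[OF A]
  by (simp_all add: bit_group_def)

lemma stable': "p permutes {1..n} \<Longrightarrow> x \<in> A \<Longrightarrow> perm_act p x \<in> A"
  using stable by (simp add: sym_group_carrier)

lemma G_simps:
  "k \<in> carrier G \<longleftrightarrow> fst k \<in> A \<and> snd k permutes {1..n}"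
  "(x, p) \<otimes>\<^bsub>G\<^esub> (y, r) = (\<lambda>i. x i + perm_act p y i, p \<circ> r)" "\<one>\<^bsub>G\<^esub> = (\<lambda>i. 0, id)"
  by (auto simp: semidirect_def bit_group_def sym_group_def mem_Times_iff)

lemma finite_A: "finite A"
proof (rule finite_subset[OF A_simps(3)])
  have "carrier (bit_group n) \<subseteq> (\<lambda>S i. if i \<in> S then 1 else 0) ` Pow {1..n}"
  proof
    fix x assume x: "x \<in> carrier (bit_group n)"
    have "x = (\<lambda>i. if i \<in> {i. x i = 1} then 1 else 0)" by (auto simp: fun_eq_iff)
    moreover have "{i. x i = 1} \<subseteq> {1..n}" using x by (force simp: bit_group_def)
    ultimately show "x \<in> (\<lambda>S i. if i \<in> S then 1 else 0) ` Pow {1..n}" by blast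
  qed
  then show "finite (carrier (bit_group n))" by (rule finite_subset) simp
qed

lemma finite_G: "finite (carrier G)"
proof -
  have "carrier G = A \<times> {p. p permutes {1..n}}" by (auto simp: G_simps)
  then show ?thesis using finite_A finite_permutations[of "{1..n}"] by simp
qed

lemma group_G: "group G"
proof (rule groupI)
  fix k k' assume "k \<in> carrier G" "k' \<in> carrier G"
  then show "k \<otimes>\<^bsub>G\<^esub> k' \<in> carrier G"
    by (cases k; cases k') (auto simp: G_simps intro: A_simps stable' permutes_compose)
next
  fix k k' k'' assume *: "k \<in> carrier G" "k' \<in> carrier G" "k'' \<in> carrier G"
  obtain x p y r z t where k: "k = (x, p)" "k' = (y, r)" "k'' = (z, t)" by (metis surj_pair)
  have "perm_act (p \<circ> r) z = perm_act p (perm_act r z)"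
    using * k by (intro perm_act_comp) (auto simp: G_simps)
  then show "k \<otimes>\<^bsub>G\<^esub> k' \<otimes>\<^bsub>G\<^esub> k'' = k \<otimes>\<^bsub>G\<^esub> (k' \<otimes>\<^bsub>G\<^esub> k'')"
    by (simp add: k G_simps perm_act_add add.assoc comp_assoc)
next
  fix k assume k: "k \<in> carrier G"
  show "\<one>\<^bsub>G\<^esub> \<otimes>\<^bsub>G\<^esub> k = k" by (cases k) (simp add: G_simps perm_act_id)
  obtain x p where xp: "k = (x, p)" by (cases k)
  have p: "p permutes {1..n}" "x \<in> A" using k xp by (auto simp: G_simps)
  have "(perm_act (inv' p) x, inv' p) \<otimes>\<^bsub>G\<^esub> k = \<one>\<^bsub>G\<^esub>"
    using permutes_inv_o[OF p(1)] by (simp add: xp G_simps bit_add_self)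
  moreover have "(perm_act (inv' p) x, inv' p) \<in> carrier G"
    using p stable' by (simp add: G_simps permutes_inv)
  ultimately show "\<exists>y\<in>carrier G. y \<otimes>\<^bsub>G\<^esub> k = \<one>\<^bsub>G\<^esub>" by blast
qed (auto simp: G_simps A_simps permutes_id)

sublocale G: group G by (rule group_G)

lemma inv_G: "x \<in> A \<Longrightarrow> p permutes {1..n} \<Longrightarrow> inv\<^bsub>G\<^esub> (x, p) = (perm_act (inv' p) x, inv' p)"
  by (rule G.inv_equality)
    (auto simp: G_simps bit_add_self permutes_inv_o stable' permutes_inv)

lemma conj_translation:
  assumes "k \<in> carrier G" "c \<in> A"
  shows "k \<otimes>\<^bsub>G\<^esub> (c, id) \<otimes>\<^bsub>G\<^esub> inv\<^bsub>G\<^esub> k = (perm_act (snd k) c, id)"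
    and "inv\<^bsub>G\<^esub> k \<otimes>\<^bsub>G\<^esub> (c, id) \<otimes>\<^bsub>G\<^esub> k = (perm_act (inv' (snd k)) c, id)"
proof -
  obtain x p where k: "k = (x, p)" by (cases k)
  have xp: "x \<in> A" "p permutes {1..n}" using assms k by (auto simp: G_simps)
  have c: "(d, id) \<in> carrier G" if "d \<in> A" for d using that by (simp add: G_simps permutes_id)
  have eq: "k \<otimes>\<^bsub>G\<^esub> (d, id) = (perm_act p d, id) \<otimes>\<^bsub>G\<^esub> k" for d
    by (simp add: k G_simps perm_act_id add.commute)
  show "k \<otimes>\<^bsub>G\<^esub> (c, id) \<otimes>\<^bsub>G\<^esub> inv\<^bsub>G\<^esub> k = (perm_act (snd k) c, id)"
    using eq[of c] c[OF stable'[OF xp(2) assms(2)]] assms(1) by (simp add: k G.m_assoc)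
  have "inv\<^bsub>G\<^esub> k \<otimes>\<^bsub>G\<^esub> (c, id) \<otimes>\<^bsub>G\<^esub> k = inv\<^bsub>G\<^esub> k \<otimes>\<^bsub>G\<^esub> (k \<otimes>\<^bsub>G\<^esub> (perm_act (inv' p) c, id))"
    using eq[of "perm_act (inv' p) c"] perm_act_inv[OF xp(2)] c[OF assms(2)] assms(1)
    by (simp add: G.m_assoc)
  also have "\<dots> = (perm_act (inv' p) c, id)"
    using c[OF stable'[OF permutes_inv[OF xp(2)] assms(2)]] assms(1) by (simp add: G.m_assoc[symmetric])
  finally show "inv\<^bsub>G\<^esub> k \<otimes>\<^bsub>G\<^esub> (c, id) \<otimes>\<^bsub>G\<^esub> k = (perm_act (inv' (snd k)) c, id)" by (simp add: k)
qed

end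

locale class_data = stable_subgroup n A for n A +
  fixes a b :: "nat \<Rightarrow> bit" and \<chi> and V :: "(complex, 'v) module" and \<mu>
  assumes a: "a \<in> A" and \<chi>: "\<chi> = bit_character n A b"
    and irr: "irreducible_representation ((sym_group n)\<lparr>carrier := char_stabilizer n A a \<chi>\<rparr>) V \<mu>"
begin

abbreviation "stab \<equiv> char_stabilizer n A a \<chi>"

lemma chi_sign: "x \<in> A \<Longrightarrow> \<chi> x = sign_bit (\<Sum>i\<in>{1..n}. x i * b i)"
  by (simp add: \<chi> bit_character_def sign_bit_def)

lemma chi_add: "x \<in> A \<Longrightarrow> y \<in> A \<Longrightarrow> \<chi> (\<lambda>i. x i + y i) = \<chi> x * \<chi> y"
  by (simp add: chi_sign A_simps distrib_right sum.distrib sign_bit_add)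

lemma char_act_iff:
  assumes p: "p permutes {1..n}"
  shows "char_act A p \<chi> = \<chi> \<longleftrightarrow> (\<forall>x\<in>A. \<chi> (perm_act p x) = \<chi> x)"
proof
  have *: "char_act A p \<chi> x = \<chi> (perm_act (inv' p) x)" if "x \<in> A" for x
    using that by (simp add: char_act_def)
  assume "char_act A p \<chi> = \<chi>"
  then show "\<forall>x\<in>A. \<chi> (perm_act p x) = \<chi> x"
    using *[OF stable'[OF p]] perm_act_inv[OF p] by metis
next
  assume "\<forall>x\<in>A. \<chi> (perm_act p x) = \<chi> x"
  then have "\<chi> (perm_act (inv' p) x) = \<chi> x" if "x \<in> A" for x
    using that stable'[OF permutes_inv[OF p]] perm_act_inv[OF p] by metis
  then show "char_act A p \<chi> = \<chi>"
    by (auto simp: char_act_def \<chi> bit_character_def fun_eq_iff restrict_def)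
qed

lemma stab_iff:
  "p \<in> stab \<longleftrightarrow> p permutes {1..n} \<and> perm_act p a = a \<and> (\<forall>x\<in>A. \<chi> (perm_act p x) = \<chi> x)"
  using char_act_iff
  by (auto simp: char_stabilizer_def elem_stabilizer_def stabilizer_def sym_group_carrier)

lemma stab_closed:
  "id \<in> stab" "p \<in> stab \<Longrightarrow> r \<in> stab \<Longrightarrow> p \<circ> r \<in> stab" "p \<in> stab \<Longrightarrow> inv' p \<in> stab"
proof -
  show "id \<in> stab" by (simp add: stab_iff perm_act_id permutes_id)
  assume "p \<in> stab"
  then have p: "p permutes {1..n}" "perm_act p a = a" "\<And>x. x \<in> A \<Longrightarrow> \<chi> (perm_act p x) = \<chi> x"
    by (auto simp: stab_iff)
  show "inv' p \<in> stab"
    unfolding stab_iff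
  proof (intro conjI ballI)
    show "inv' p permutes {1..n}" by (rule permutes_inv[OF p(1)])
    show "perm_act (inv' p) a = a" using perm_act_inv[OF p(1), of a] p(2) by simp
    show "\<chi> (perm_act (inv' p) x) = \<chi> x" if "x \<in> A" for x
      using p(3)[OF stable'[OF permutes_inv[OF p(1)] that]] perm_act_inv[OF p(1), of x] by simp
  qed
  show "r \<in> stab \<Longrightarrow> p \<circ> r \<in> stab"
    using p stable' by (auto simp: stab_iff perm_act_comp[of p "{1..n}" r "{1..n}"] permutes_compose)
qed

lemma a_id_closed: "(a, id) \<in> carrier G"
  using a by (simp add: G_simps permutes_id)

lemma subgroup_stab: "subgroup (A \<times> stab) (centralizer_group G (a, id))"
proof -
  have cent: "centralizer G (a, id) = A \<times> elem_stabilizer n a"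
    by (rule centralizer_semidirect[OF A_simps(3) a])
  have es: "p \<in> elem_stabilizer n a \<longleftrightarrow> p permutes {1..n} \<and> perm_act p a = a" for p
    by (simp add: elem_stabilizer_def stabilizer_def sym_group_carrier)
  have "subgroup (A \<times> stab) G"
  proof (rule G.subgroupI)
    fix k k' assume "k \<in> A \<times> stab" "k' \<in> A \<times> stab"
    then obtain x p y r where k: "k = (x, p)" "x \<in> A" "p \<in> stab" "k' = (y, r)" "y \<in> A" "r \<in> stab" by auto
    then have p: "p permutes {1..n}" by (simp add: stab_iff)
    show "inv\<^bsub>G\<^esub> k \<in> A \<times> stab"
      using k p stab_closed(3) stable'[OF permutes_inv[OF p]] by (simp add: inv_G)
    show "k \<otimes>\<^bsub>G\<^esub> k' \<in> A \<times> stab"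
      using k p stab_closed(2) stable'[OF p] A_simps(1) by (simp add: G_simps)
  next
    show "A \<times> stab \<noteq> {}" using a stab_closed(1) by blast
  qed (auto simp: G_simps stab_iff)
  moreover have "subgroup (A \<times> elem_stabilizer n a) G"
  proof (rule G.subgroupI)
    fix k k' assume "k \<in> A \<times> elem_stabilizer n a" "k' \<in> A \<times> elem_stabilizer n a"
    then obtain x p y r where k: "k = (x, p)" "x \<in> A" "p permutes {1..n}" "perm_act p a = a"
      "k' = (y, r)" "y \<in> A" "r permutes {1..n}" "perm_act r a = a" by (auto simp: es)
    show "inv\<^bsub>G\<^esub> k \<in> A \<times> elem_stabilizer n a"
      using k perm_act_inv[OF k(3), of a] by (auto simp: inv_G es permutes_inv intro: stable')
    show "k \<otimes>\<^bsub>G\<^esub> k' \<in> A \<times> elem_stabilizer n a"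
      using k perm_act_comp[OF k(3,7), of a] by (auto simp: G_simps es permutes_compose intro: A_simps stable')
  next
    have "id \<in> elem_stabilizer n a" by (simp add: es permutes_id perm_act_id)
    then show "A \<times> elem_stabilizer n a \<noteq> {}" using a by blast
  qed (auto simp: G_simps es)
  ultimately show ?thesis unfolding cent
    by (rule G.subgroup_incl) (auto simp: stab_iff es)
qed

lemma mu_simps:
  "representation ((sym_group n)\<lparr>carrier := stab\<rparr>) V \<mu>" "carrier V \<noteq> {\<zero>\<^bsub>V\<^esub>}"
  "vectorspace \<complex>\<^sub>F V" "p \<in> stab \<Longrightarrow> linear_map \<complex>\<^sub>F V V (\<mu> p)"
  "v \<in> carrier V \<Longrightarrow> \<mu> id v = v"
  "p \<in> stab \<Longrightarrow> r \<in> stab \<Longrightarrow> v \<in> carrier V \<Longrightarrow> \<mu> (p \<circ> r) v = \<mu> p (\<mu> r v)"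
proof -
  show *: "representation ((sym_group n)\<lparr>carrier := stab\<rparr>) V \<mu>" and "carrier V \<noteq> {\<zero>\<^bsub>V\<^esub>}"
    using irr by (auto simp: irreducible_representation_def)
  show "vectorspace \<complex>\<^sub>F V" "p \<in> stab \<Longrightarrow> linear_map \<complex>\<^sub>F V V (\<mu> p)"
    "v \<in> carrier V \<Longrightarrow> \<mu> id v = v"
    "p \<in> stab \<Longrightarrow> r \<in> stab \<Longrightarrow> v \<in> carrier V \<Longrightarrow> \<mu> (p \<circ> r) v = \<mu> p (\<mu> r v)"
    using * by (auto simp: representation_def sym_group_def)
qed

lemma representation_char_tensor:
  "representation (G\<lparr>carrier := A \<times> stab\<rparr>) V (char_tensor \<chi> V \<mu>)"
proof -
  interpret V: vectorspace "\<complex>\<^sub>F :: complex ring" V by (rule mu_simps(3))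
  have one: "\<chi> (\<lambda>i. 0) = 1" by (simp add: chi_sign A_simps sign_bit_def)
  show ?thesis
    unfolding representation_def
  proof (intro conjI ballI)
    show "linear_map \<complex>\<^sub>F V V (char_tensor \<chi> V \<mu> k)" if kA: "k \<in> carrier (G\<lparr>carrier := A \<times> stab\<rparr>)" for k
    proof -
      obtain x p where k: "k = (x, p)" "p \<in> stab" using kA by auto
      note l = linear_mapD(1-3)[OF mu_simps(4)[OF k(2)]]
      show ?thesis
      proof (rule linear_mapI[OF mu_simps(3) mu_simps(3)])
        fix c v assume v: "v \<in> carrier V"
        show "char_tensor \<chi> V \<mu> k (c \<odot>\<^bsub>V\<^esub> v) = c \<odot>\<^bsub>V\<^esub> char_tensor \<chi> V \<mu> k v"
          using V.smult_assoc1[of "\<chi> x" c "\<mu> p v"] V.smult_assoc1[of c "\<chi> x" "\<mu> p v"] l v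
          by (simp add: char_tensor_def k mult.commute)
      qed (use l V.smult_r_distr[of "\<chi> x"] in \<open>auto simp: char_tensor_def k\<close>)
    qed
    show "char_tensor \<chi> V \<mu> \<one>\<^bsub>G\<lparr>carrier := A \<times> stab\<rparr>\<^esub> v = v" if "v \<in> carrier V" for v
      using V.smult_one[OF that] mu_simps(5)[OF that] by (simp add: char_tensor_def G_simps one)
    show "char_tensor \<chi> V \<mu> (k \<otimes>\<^bsub>G\<lparr>carrier := A \<times> stab\<rparr>\<^esub> k') v =
        char_tensor \<chi> V \<mu> k (char_tensor \<chi> V \<mu> k' v)"
      if k: "k \<in> carrier (G\<lparr>carrier := A \<times> stab\<rparr>)" "k' \<in> carrier (G\<lparr>carrier := A \<times> stab\<rparr>)" and v: "v \<in> carrier V" for k k' v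
    proof -
      obtain x p y r where *: "k = (x, p)" "x \<in> A" "p \<in> stab" "k' = (y, r)" "y \<in> A" "r \<in> stab"
        using k by auto
      have p: "p permutes {1..n}" "\<chi> (perm_act p y) = \<chi> y" using * by (auto simp: stab_iff)
      have "\<chi> (\<lambda>i. x i + perm_act p y i) = \<chi> x * \<chi> y"
        using chi_add[OF *(2) stable'[OF p(1) *(5)]] p(2) by simp
      then show ?thesis
        using * v linear_mapD(1,3)[OF mu_simps(4)[OF *(3)]] linear_mapD(1)[OF mu_simps(4)[OF *(6)] v] mu_simps(6)[OF *(3,6) v]
          V.smult_assoc1[of "\<chi> x" "\<chi> y" "\<mu> p (\<mu> r v)"]
        by (simp add: char_tensor_def G_simps)
    qed
  qed (rule mu_simps(3))
qed

section \<open>The braiding signs and the three cases\<close>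

text \<open>The exponent of \<open>\<chi>(p \<sqdot> a)\<close>, in \<open>\<int>/2\<close>. It governs the braiding of the vectors attached to \<open>k\<close> and \<open>k'\<close>
  with \<open>p = \<pi>'\<^sup>-\<^sup>1 \<pi>\<close>.\<close>

definition twist :: "(nat \<Rightarrow> nat) \<Rightarrow> bit"
  where "twist p = (\<Sum>i\<in>{1..n}. perm_act p a i * b i)"

abbreviation "braid_coeff k k' \<equiv> sign_bit (twist (inv' (snd k') \<circ> snd k))"

lemma chi_conj:
  assumes "k \<in> carrier G" "k' \<in> carrier G"
  shows "inv\<^bsub>G\<^esub> k' \<otimes>\<^bsub>G\<^esub> (k \<otimes>\<^bsub>G\<^esub> (a, id) \<otimes>\<^bsub>G\<^esub> inv\<^bsub>G\<^esub> k) \<otimes>\<^bsub>G\<^esub> k' = (perm_act (inv' (snd k') \<circ> snd k) a, id)"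
    and "perm_act (inv' (snd k') \<circ> snd k) a \<in> A"
    and "\<chi> (perm_act (inv' (snd k') \<circ> snd k) a) = braid_coeff k k'"
proof -
  have p: "snd k permutes {1..n}" "inv' (snd k') permutes {1..n}"
    using assms by (auto simp: G_simps permutes_inv)
  show 1: "perm_act (inv' (snd k') \<circ> snd k) a \<in> A"
    using p a stable' by (simp add: perm_act_comp[OF p(2,1)])
  show "inv\<^bsub>G\<^esub> k' \<otimes>\<^bsub>G\<^esub> (k \<otimes>\<^bsub>G\<^esub> (a, id) \<otimes>\<^bsub>G\<^esub> inv\<^bsub>G\<^esub> k) \<otimes>\<^bsub>G\<^esub> k' = (perm_act (inv' (snd k') \<circ> snd k) a, id)"
    using conj_translation(1)[OF assms(1) a] conj_translation(2)[OF assms(2) stable'[OF p(1) a]]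
    by (simp add: perm_act_comp[OF p(2,1)])
  show "\<chi> (perm_act (inv' (snd k') \<circ> snd k) a) = braid_coeff k k'"
    using chi_sign[OF 1] by (simp add: twist_def)
qed

lemma class_induced: "class_induced G (a, id) (A \<times> stab) V (char_tensor \<chi> V \<mu>) braid_coeff"
proof (intro class_induced.intro class_induced_axioms.intro)
  have sub: "subgroup stab (sym_group n)"
  proof (rule group.subgroupI[OF sym_group_is_group])
    fix p r assume "p \<in> stab" "r \<in> stab"
    then show "inv\<^bsub>sym_group n\<^esub> p \<in> stab" "p \<otimes>\<^bsub>sym_group n\<^esub> r \<in> stab"
      using stab_closed by (auto simp: sym_group_mult sym_group_carrier stab_iff)
  next
    show "stab \<noteq> {}" using stab_closed(1) by blast
  qed (auto simp: stab_iff sym_group_carrier)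
  have "finite stab" by (rule finite_subset[OF _ finite_permutations[of "{1..n}"]]) (auto simp: stab_iff)
  then show "vectorspace.fin_dim \<complex>\<^sub>F V"
    using irreducible_representation_fin_dim[OF subgroup.subgroup_is_group[OF sub sym_group_is_group] _ irr]
    by simp
  show "inv\<^bsub>G\<^esub> k' \<otimes>\<^bsub>G\<^esub> (k \<otimes>\<^bsub>G\<^esub> (a, id) \<otimes>\<^bsub>G\<^esub> inv\<^bsub>G\<^esub> k) \<otimes>\<^bsub>G\<^esub> k' \<in> A \<times> stab"
    if "k \<in> carrier G" "k' \<in> carrier G" for k k'
    using chi_conj[OF that] stab_closed(1) by simp
  show "char_tensor \<chi> V \<mu> (inv\<^bsub>G\<^esub> k' \<otimes>\<^bsub>G\<^esub> (k \<otimes>\<^bsub>G\<^esub> (a, id) \<otimes>\<^bsub>G\<^esub> inv\<^bsub>G\<^esub> k) \<otimes>\<^bsub>G\<^esub> k') v = braid_coeff k k' \<odot>\<^bsub>V\<^esub> v"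
    if "k \<in> carrier G" "k' \<in> carrier G" "v \<in> carrier V" for k k' v
    using chi_conj[OF that(1,2)] mu_simps(5)[OF that(3)] by (simp add: char_tensor_def)
qed (auto simp: group_G finite_G a_id_closed subgroup_stab representation_char_tensor mu_simps)

abbreviation "Nich \<equiv> nichols_algebra_of_class G (a, id) (theta_module n A a \<chi> V \<mu>) (theta n A a \<chi> V \<mu>)"

interpretation C: class_induced G "(a, id)" "A \<times> stab" V "char_tensor \<chi> V \<mu>" braid_coeff
  by (rule class_induced)

lemma Nich_eq: "Nich = C.Nich"
  by (simp add: theta_module_def theta_def)

text \<open>Moving \<open>p\<close> from \<open>a\<close> to \<open>b\<close> in the pairing.\<close>

lemma twist_inv:
  assumes "p permutes {1..n}"
  shows "twist (inv' p) = (\<Sum>i\<in>{1..n}. a i * b (inv' p i))"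
proof -
  have "twist (inv' p) = (\<Sum>i\<in>{1..n}. a (p i) * b i)"
    by (simp add: twist_def perm_act_def permutes_inv_inv[OF assms])
  also have "\<dots> = (\<Sum>i\<in>{1..n}. a (p (inv' p i)) * b (inv' p i))"
    using sum.permute[OF permutes_inv[OF assms], of "\<lambda>i. a (p i) * b i"] by (simp add: comp_def)
  also have "\<dots> = (\<Sum>i\<in>{1..n}. a i * b (inv' p i))"
    using permutes_inverses(1)[OF assms] by simp
  finally show ?thesis .
qed

lemma twist_id: "twist id = (if odd (card (bit_support n a \<inter> bit_support n b)) then 1 else 0)"
proof -
  let ?W = "bit_support n a \<inter> bit_support n b"
  have "twist id = (\<Sum>i\<in>{1..n}. if i \<in> ?W then 1 else 0)"
    unfolding twist_def perm_act_id by (intro sum.cong) (auto simp: bit_support_def)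
  also have "\<dots> = (\<Sum>i\<in>{1..n} \<inter> ?W. 1)" by (rule sum.inter_restrict[symmetric]) simp
  also have "{1..n} \<inter> ?W = ?W" by (auto simp: bit_support_def)
  finally have "twist id = (\<Sum>i\<in>?W. 1)" .
  then show ?thesis by (simp add: bit_of_nat)
qed

lemma full_support_iff: "card (bit_support n x) = n \<longleftrightarrow> (\<forall>i\<in>{1..n}. x i = 1)"
proof -
  have sub: "bit_support n x \<subseteq> {1..n}" by (auto simp: bit_support_def)
  have "card (bit_support n x) = n \<longleftrightarrow> bit_support n x = {1..n}"
    using card_subset_eq[OF _ sub] by auto
  also have "\<dots> \<longleftrightarrow> (\<forall>i\<in>{1..n}. x i = 1)" by (auto simp: bit_support_def)
  finally show ?thesis .
qed

lemma same_support_iff: "bit_support n x = bit_support n y \<longleftrightarrow> (\<forall>i\<in>{1..n}. x i = y i)"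
  by (auto simp: bit_support_def set_eq_iff) (metis bit_not_zero_iff)+

text \<open>If \<open>a = b\<close>, the two pairings agree by symmetry; if \<open>a\<close> or \<open>b\<close> is constant, both equal the pairing
  of \<open>a\<close> and \<open>b\<close>.\<close>

lemma twist_inv_eq:
  assumes p: "p permutes {1..n}"
    and "(\<forall>i\<in>{1..n}. b i = a i) \<or> (\<forall>i\<in>{1..n}. a i = 1) \<or> (\<forall>i\<in>{1..n}. b i = 1)"
  shows "twist (inv' p) = twist p"
proof -
  have inv: "inv' p i \<in> {1..n}" if "i \<in> {1..n}" for i
    using permutes_in_image[OF permutes_inv[OF p]] that by blast
  have perm: "(\<Sum>i\<in>{1..n}. f (inv' p i)) = (\<Sum>i\<in>{1..n}. f i)" for f :: "nat \<Rightarrow> bit"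
    using sum.permute[OF permutes_inv[OF p], of f] by (simp add: comp_def)
  from assms(2) show ?thesis
  proof (elim disjE)
    assume "\<forall>i\<in>{1..n}. b i = a i"
    then show ?thesis unfolding twist_inv[OF p] unfolding twist_def perm_act_def
      using inv by (intro sum.cong) (auto simp: mult.commute)
  next
    assume *: "\<forall>i\<in>{1..n}. a i = 1"
    have "twist (inv' p) = (\<Sum>i\<in>{1..n}. b (inv' p i))" unfolding twist_inv[OF p]
      by (intro sum.cong) (use * in auto)
    moreover have "twist p = (\<Sum>i\<in>{1..n}. b i)" unfolding twist_def perm_act_def
      by (intro sum.cong) (use * inv in auto)
    ultimately show ?thesis by (simp add: perm)
  next
    assume *: "\<forall>i\<in>{1..n}. b i = 1"
    have "twist (inv' p) = (\<Sum>i\<in>{1..n}. a i)" unfolding twist_inv[OF p]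
      by (intro sum.cong) (use * inv in auto)
    moreover have "twist p = (\<Sum>i\<in>{1..n}. a (inv' p i))" unfolding twist_def perm_act_def
      by (intro sum.cong) (use * in auto)
    ultimately show ?thesis by (simp add: perm)
  qed
qed

lemma fin_dim_if_odd_and_supports:
  assumes "odd (card (bit_support n a \<inter> bit_support n b))"
    and "bit_support n b = bit_support n a \<or> card (bit_support n a) = n \<or> card (bit_support n b) = n"
  shows "vectorspace.fin_dim \<complex>\<^sub>F Nich"
  unfolding Nich_eq
proof (rule C.fin_dim_class_nichols)
  fix k assume "k \<in> carrier G"
  then have "inv' (snd k) \<circ> snd k = id" using permutes_inv_o[of "snd k" "{1..n}"] by (simp add: G_simps)
  then show "braid_coeff k k = -1" using twist_id assms(1) by (simp add: sign_bit_def)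
next
  fix k k' assume k: "k \<in> carrier G" "k' \<in> carrier G"
  let ?p = "inv' (snd k') \<circ> snd k"
  have p: "snd k permutes {1..n}" "snd k' permutes {1..n}" using k by (auto simp: G_simps)
  have "inv' ?p = inv' (snd k) \<circ> inv' (inv' (snd k'))"
    using p by (intro o_inv_distrib) (auto intro: permutes_bij permutes_inv)
  then have "inv' ?p = inv' (snd k) \<circ> snd k'" using permutes_inv_inv[OF p(2)] by simp
  moreover have "twist (inv' ?p) = twist ?p"
    using twist_inv_eq[OF permutes_compose[OF p(1) permutes_inv[OF p(2)]]] assms(2)
    unfolding same_support_iff full_support_iff by blast
  ultimately show "braid_coeff k k' * braid_coeff k' k = 1" by (simp add: sign_bit_def)
qed

lemma not_fin_dim_if_even:
  assumes "even (card (bit_support n a \<inter> bit_support n b))"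
  shows "\<not> vectorspace.fin_dim \<complex>\<^sub>F Nich"
  unfolding Nich_eq
  by (rule C.not_fin_dim_class_nichols_if_eq_1) (use twist_id assms in \<open>simp add: sign_bit_def G_simps\<close>)

text \<open>The 3-cycle \<open>h = (i j l)\<close> gives the triangle \<open>1, h, h\<^sup>-\<^sup>1\<close>: all quotients of neighbours are \<open>h\<close> in one
  direction and \<open>h\<^sup>-\<^sup>1 = h\<^sup>2\<close> in the other, and the two signs \<open>\<chi>(h \<sqdot> a)\<close> and \<open>\<chi>(h\<^sup>-\<^sup>1 \<sqdot> a)\<close> are opposite since
  \<open>twist h + twist h\<^sup>-\<^sup>1\<close> is the displayed sum over \<open>i\<close>, \<open>j\<close>, \<open>l\<close>; all other points contribute twice
  the same term. The three degrees differ because \<open>a\<close> is not constant on \<open>{i, j, l}\<close>.\<close>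

lemma not_fin_dim_if_3_cycle:
  assumes ijl: "i \<in> {1..n}" "j \<in> {1..n}" "l \<in> {1..n}" "i \<noteq> j" "i \<noteq> l" "j \<noteq> l"
    and ne: "\<not> (a i = a j \<and> a j = a l)"
    and sum: "(a l + a j) * b i + ((a i + a l) * b j + (a j + a i) * b l) = 1"
    and odd: "odd (card (bit_support n a \<inter> bit_support n b))"
  shows "\<not> vectorspace.fin_dim \<complex>\<^sub>F Nich"
proof -
  define h where "h = transpose i j \<circ> transpose j l"
  define h' where "h' = transpose j l \<circ> transpose i j"
  have h: "h permutes {1..n}" "h' permutes {1..n}"
    using ijl by (auto simp: h_def h'_def intro!: permutes_compose permutes_swap_id)
  have hh': "h \<circ> h' = id" by (simp add: h_def h'_def fun_eq_iff)
  have inv_h: "inv' h = h'" "inv' h' = h"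
    using hh' h by (metis inv_unique_comp permutes_bij permutes_inv_inv permutes_inv_o(2) comp_assoc comp_id id_comp)+
  have vals: "h i = j" "h j = l" "h l = i" "h' i = l" "h' j = i" "h' l = j"
    using ijl by (auto simp: h_def h'_def transpose_def)
  have other: "h x = x" "h' x = x" if "x \<notin> {i, j, l}" for x
    using that by (auto simp: h_def h'_def transpose_def)
  have sq: "h \<circ> h = h'" "h' \<circ> h' = h"
  proof -
    show "h \<circ> h = h'"
    proof
      fix x show "(h \<circ> h) x = h' x" using vals other[of x] by (cases "x \<in> {i, j, l}") auto
    qed
    show "h' \<circ> h' = h"
    proof
      fix x show "(h' \<circ> h') x = h x" using vals other[of x] by (cases "x \<in> {i, j, l}") auto
    qed
  qed
  have "twist h + twist h' = (\<Sum>x\<in>{1..n}. (a (h' x) + a (h x)) * b x)"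
    by (simp add: twist_def perm_act_def inv_h sum.distrib distrib_right)
  also have "\<dots> = (\<Sum>x\<in>{i, j, l}. (a (h' x) + a (h x)) * b x)"
    by (rule sum.mono_neutral_right) (use ijl other in \<open>auto simp: bit_add_self\<close>)
  also have "\<dots> = 1" using ijl sum by (simp add: vals)
  finally have s: "twist h + twist h' = 1" .
  define e where "e = sign_bit (twist h')"
  have e: "sign_bit (twist h) = -e" "e * e = 1"
    using s by (cases "twist h = 0"; cases "twist h' = 0"; simp add: e_def sign_bit_def)+
  define k where "k p = ((\<lambda>i :: nat. 0 :: bit), p :: nat \<Rightarrow> nat)" for p
  have kG: "k id \<in> carrier G" "k h \<in> carrier G" "k h' \<in> carrier G"
    using h A_simps(2) by (auto simp: k_def G_simps permutes_id)
  have gr: "C.grade (k p) = (perm_act p a, id)" if "k p \<in> carrier G" for p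
    using conj_translation(1)[OF that a] by (simp add: k_def)
  have pa: "perm_act id a = a" "perm_act h a = (\<lambda>x. a (h' x))" "perm_act h' a = (\<lambda>x. a (h x))"
    by (auto simp: perm_act_def inv_h)
  show ?thesis unfolding Nich_eq
  proof (rule C.not_fin_dim_class_nichols_if_triangle[OF kG])
    show "C.grade (k id) \<noteq> C.grade (k h)"
      using ne vals unfolding gr[OF kG(1)] gr[OF kG(2)] pa by (metis prod.inject)
    show "C.grade (k id) \<noteq> C.grade (k h')"
      using ne vals unfolding gr[OF kG(1)] gr[OF kG(3)] pa by (metis prod.inject)
    show "C.grade (k h) \<noteq> C.grade (k h')"
      using ne vals unfolding gr[OF kG(2)] gr[OF kG(3)] pa by (metis prod.inject)
    show "triangle braid_coeff e (k id) (k h) (k h')"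
    proof
      show "k id \<noteq> k h" "k id \<noteq> k h'" "k h \<noteq> k h'"
        using vals ijl by (auto simp: k_def)
      show "e * e = 1" by (rule e)
      have "twist id = 1" using twist_id odd by simp
      then show "braid_coeff (k id) (k id) = -1" "braid_coeff (k h) (k h) = -1" "braid_coeff (k h') (k h') = -1"
        using hh' permutes_inv_o(2)[OF h(1)] permutes_inv_o(2)[OF h(2)]
        by (simp_all add: k_def sign_bit_def)
      show "braid_coeff (k id) (k h) = e" "braid_coeff (k h) (k h') = e" "braid_coeff (k h') (k id) = e"
        "braid_coeff (k h) (k id) = -e" "braid_coeff (k h') (k h) = -e" "braid_coeff (k id) (k h') = -e"
        by (simp_all add: k_def inv_h sq e flip: e_def)
    qed
  qed
qed

text \<open>The point \<open>i\<close> is in both supports, and \<open>j\<close>, \<open>l\<close> are points of two different ones of the three sets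
  where not both of \<open>a\<close>, \<open>b\<close> are 1; that two of these sets are nonempty is the negation of the
  conditions. In all three cases the sum of the previous lemma is odd.\<close>

lemma not_fin_dim_if_supports:
  assumes odd: "odd (card (bit_support n a \<inter> bit_support n b))"
    and not: "\<not> (bit_support n b = bit_support n a \<or> card (bit_support n a) = n \<or> card (bit_support n b) = n)"
  shows "\<not> vectorspace.fin_dim \<complex>\<^sub>F Nich"
proof -
  have bit: "x = 0 \<or> x = 1" for x :: bit by (cases "x = 0") auto
  obtain i where i: "i \<in> {1..n}" "a i = 1" "b i = 1"
  proof -
    have "bit_support n a \<inter> bit_support n b \<noteq> {}" using odd by (metis card.empty even_zero)
    then show ?thesis using that by (auto simp: bit_support_def)
  qed
  obtain x where x: "x \<in> {1..n}" "b x \<noteq> a x" using not unfolding same_support_iff by blast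
  obtain y where y: "y \<in> {1..n}" "a y = 0"
    using not bit[of "a _"] unfolding full_support_iff by blast
  obtain z where z: "z \<in> {1..n}" "b z = 0"
    using not bit[of "b _"] unfolding full_support_iff by blast
  have "\<exists>j\<in>{1..n}. \<exists>l\<in>{1..n}. (a j = 1 \<and> b j = 0 \<and> a l = 0 \<and> b l = 1) \<or>
     (a j = 1 \<and> b j = 0 \<and> a l = 0 \<and> b l = 0) \<or> (a j = 0 \<and> b j = 1 \<and> a l = 0 \<and> b l = 0)"
  proof (cases "a x = 0")
    case True
    then have "a x = 0" "b x = 1" using x(2) bit[of "b x"] by auto
    then show ?thesis using x(1) z bit[of "a z"] by blast
  next
    case False
    then have "a x = 1" "b x = 0" using x(2) bit[of "a x"] bit[of "b x"] by auto
    then show ?thesis using x(1) y bit[of "b y"] by blast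
  qed
  then obtain j l where jl: "j \<in> {1..n}" "l \<in> {1..n}" "(a j = 1 \<and> b j = 0 \<and> a l = 0 \<and> b l = 1) \<or>
     (a j = 1 \<and> b j = 0 \<and> a l = 0 \<and> b l = 0) \<or> (a j = 0 \<and> b j = 1 \<and> a l = 0 \<and> b l = 0)" by blast
  have two: "1 + 1 = (0 :: bit)" by (rule bit_add_self)
  show ?thesis
  proof (rule not_fin_dim_if_3_cycle[OF i(1) jl(1,2) _ _ _ _ _ odd])
    show "i \<noteq> j" "i \<noteq> l" "j \<noteq> l" using i jl(3) by auto
    show "\<not> (a i = a j \<and> a j = a l)" using i jl(3) by auto
    show "(a l + a j) * b i + ((a i + a l) * b j + (a j + a i) * b l) = 1"
      using jl(3) by (elim disjE conjE) (simp_all add: i two)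
  qed
qed

end

theorem theorem2p3:
  fixes n :: nat
    and A :: "(nat \<Rightarrow> bit) set"
    and a b :: "nat \<Rightarrow> bit"
    and \<chi> :: "(nat \<Rightarrow> bit) \<Rightarrow> complex"
    and V :: "(complex, 'v) module"
    and \<mu> :: "(nat \<Rightarrow> nat) \<Rightarrow> 'v \<Rightarrow> 'v"
  assumes "n > 2"
    and "subgroup A (bit_group n)"
    and "\<And>h x. h \<in> carrier (sym_group n) \<Longrightarrow> x \<in> A \<Longrightarrow> perm_act h x \<in> A"
    and "a \<in> A"
    and "b \<in> carrier (bit_group n)"
    and "\<chi> = bit_character n A b"
    and "irreducible_representation ((sym_group n)\<lparr>carrier := char_stabilizer n A a \<chi>\<rparr>) V \<mu>"
  shows "vectorspace.fin_dim \<complex>\<^sub>F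
           (nichols_algebra_of_class (semidirect n A) (a, id)
              (theta_module n A a \<chi> V \<mu>) (theta n A a \<chi> V \<mu>))
         \<longleftrightarrow> odd (card (bit_support n a \<inter> bit_support n b)) \<and>
             (bit_support n b = bit_support n a \<or> card (bit_support n a) = n \<or>
              card (bit_support n b) = n)"
proof -
  interpret class_data n A a b \<chi> V \<mu>
    by (intro class_data.intro stable_subgroup.intro class_data_axioms.intro assms)
  show ?thesis using fin_dim_if_odd_and_supports not_fin_dim_if_even not_fin_dim_if_supports by blast
qed

end
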